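(* Let $(G,\cdot)$ be a tightly network codeable (TNC) group of order $d^2$ with TNC representation $\{U_g\}_{g\in G}$, and consider a noisy implementation of the dense network coding protocol for $(G,\cdot)$, given by a resource state $\sigma^r_{AB}$, encoding channels $\mathcal E^r_1,\mathcal E^r_2$, transmission channels $\mathcal T^r_1,\mathcal T^r_2$ and a decoding channel $\mathcal D^r$, as described in the context. Let $Z$ be the correct value $g\cdot h$ of the function and $Z'$ the output of the noisy implementation. Then $$\Pr[Z=Z']\ \ge\ 1-(\varepsilon_{st}+\varepsilon_{enc,1}+\varepsilon_{enc,2}+\varepsilon_{tr,1}+\varepsilon_{tr,2}+\varepsilon_{dec}),$$ where $\varepsilon_{st}=\frac12\|\sigma^r-\sigma^{id}\|_1$, $\varepsilon_{enc,i}=\frac12\|\mathcal E_i^r-\mathcal E_i^{id}\|_\diamond$, $\varepsilon_{tr,i}=\frac12\|\mathcal T_i^r-\mathcal T_i^{id}\|_\diamond$ ($i=1,2$), and $\varepsilon_{dec}=\frac12\|\mathcal D^r-\mathcal D^{id}\|_\diamond$.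
   Context: A group $(G,\cdot)$ of order $d^2$ is tightly network codeable (TNC) if there are unitaries $\{U_g\}_{g\in G}$ on $\mathbb C^d$ (a TNC representation) with $\mathrm{Tr}[U_g^\dagger U_h]=d\,\delta_{g,h}$ for all $g,h$, and unit-modulus complex numbers $\omega(g,h)$ with $U_gU_h=\omega(g,h)U_{g\cdot h}$ for all $g,h$. Ideal protocol: two senders receive classical inputs $g,h\in G$ in registers $X,Y$ and share $\sigma^{id}=|\Phi\rangle\langle\Phi|$ on $A\otimes B=\mathbb C^d\otimes\mathbb C^d$, $|\Phi\rangle=\frac1{\sqrt d}\sum_i|i\rangle|i\rangle$. The ideal encoder $\mathcal E_1^{id}$ maps $X\otimes A$ to $\mathbb C^d$ by $|g\rangle\langle g|\otimes\rho\mapsto U_g\rho U_g^\dagger$ (dephasing $X$ first), and $\mathcal E_2^{id}$ maps $Y\otimes B$ to $\mathbb C^d$ by $|h\rangle\langle h|\otimes\rho\mapsto U_h^T\rho (U_h^T)^\dagger$. The ideal transmissions $\mathcal T_1^{id},\mathcal T_2^{id}$ are noiseless identity channels. The ideal decoder is the measurement channel $\mathcal D^{id}(K)=\sum_{g\in G}\langle\Phi_g|K|\Phi_g\rangle\,|g\rangle\langle g|$ with $|\Phi_g\rangle=(U_g\otimes I)|\Phi\rangle$ (an orthonormal basis), whose output register is $Z'$. A noisy implementation replaces each ideal component independently by a "real" one: a state $\sigma^r_{AB}$ on the same space and quantum channels $\mathcal E_i^r,\mathcal T_i^r,\mathcal D^r$ with the same input and output spaces as their ideal counterparts ($\mathcal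 D^r$ has a classical output in $G$). With inputs given by the joint classical state $\rho_{ZXY}=\frac1{|G|^2}\sum_{g,h}|g\cdot h\rangle\langle g\cdot h|_Z\otimes|g\rangle\langle g|_X\otimes|h\rangle\langle h|_Y$, the joint distribution of $(Z,Z')$ is that of $\big(\mathrm{id}_Z\otimes\mathcal D^r\circ(\mathcal T_1^r\otimes\mathcal T_2^r)\circ(\mathcal E_1^r\otimes\mathcal E_2^r)\big)(\rho_{ZXY}\otimes\sigma^r_{AB})$. $\|\cdot\|_1$ is the trace norm and $\|\cdot\|_\diamond$ is the diamond norm: for channels $\mathcal E,\mathcal F$ with input $A$, $\|\mathcal E-\mathcal F\|_\diamond=\sup_{R,\rho_{RA}}\|(\mathrm{id}_R\otimes(\mathcal E-\mathcal F))(\rho_{RA})\|_1$ over finite-dimensional $R$ and states $\rho_{RA}$. *)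

theory Defs
  imports
    "Jordan_Normal_Form.Schur_Decomposition"
    "Jordan_Normal_Form.Char_Poly"
    "HOL-Algebra.Coset"
begin

text \<open>
  Operators on \<open>\<complex>\<^sup>n\<close> are complex \<open>n \<times> n\<close> matrices. The tensor product \<open>\<complex>\<^sup>m \<otimes> \<complex>\<^sup>n\<close> is
  \<open>\<complex>\<^bsup>m*n\<^esup>\<close>, where the basis vector \<open>|i\<rangle>|j\<rangle>\<close> has index \<open>i * n + j\<close>; with this convention the
  product is strictly associative.
\<close>

definition kron :: "complex mat \<Rightarrow> complex mat \<Rightarrow> complex mat" where
  "kron A B = mat (dim_row A * dim_row B) (dim_col A * dim_col B)
     (\<lambda>(r, c). A $$ (r div dim_row B, c div dim_col B) * B $$ (r mod dim_row B, c mod dim_col B))"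

definition ketbra :: "complex vec \<Rightarrow> complex vec \<Rightarrow> complex mat" where
  "ketbra v w = mat (dim_vec v) (dim_vec w) (\<lambda>(i, j). v $ i * cnj (w $ j))"

text \<open>Finite sums are taken entrywise, because \<open>complex mat\<close> has no zero common to all dimensions.\<close>

definition mat_sum :: "nat \<Rightarrow> nat \<Rightarrow> ('i \<Rightarrow> complex mat) \<Rightarrow> 'i set \<Rightarrow> complex mat" where
  "mat_sum m n f S = mat m n (\<lambda>ij. \<Sum>x\<in>S. f x $$ ij)"

definition mat_trace :: "complex mat \<Rightarrow> complex" where
  "mat_trace A = (\<Sum>i<dim_row A. A $$ (i, i))"

definition unitary_mat :: "nat \<Rightarrow> complex mat \<Rightarrow> bool" where
  "unitary_mat n V \<longleftrightarrow> V \<in> carrier_mat n n \<and> mat_adjoint V * V = 1\<^sub>m n \<and> V * mat_adjoint V = 1\<^sub>m n"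

text \<open>In the order on \<open>complex\<close>, \<open>0 \<le> z\<close> means that \<open>z\<close> is real and nonnegative.\<close>

definition psd_mat :: "nat \<Rightarrow> complex mat \<Rightarrow> bool" where
  "psd_mat n A \<longleftrightarrow> A \<in> carrier_mat n n \<and> mat_adjoint A = A \<and>
     (\<forall>v\<in>carrier_vec n. 0 \<le> (A *\<^sub>v v) \<bullet>c v)"

definition density_mat :: "nat \<Rightarrow> complex mat \<Rightarrow> bool" where
  "density_mat n \<rho> \<longleftrightarrow> psd_mat n \<rho> \<and> mat_trace \<rho> = 1"

text \<open>
  The trace norm is the sum of the singular values, i.e. of the square roots of the eigenvalues of
  \<open>A\<^sup>\<dagger>A\<close> counted with multiplicity.
\<close>

definition trace_norm :: "complex mat \<Rightarrow> real" where
  "trace_norm A = (\<Sum>x\<in>#proots (char_poly (mat_adjoint A * A)). sqrt (Re x))"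

text \<open>
  For linear \<open>E\<close> from operators on \<open>\<complex>\<^bsup>m1\<^esup>\<close> to operators on \<open>\<complex>\<^bsup>n1\<^esup>\<close> and \<open>F\<close> from operators on
  \<open>\<complex>\<^bsup>m2\<^esup>\<close> to operators on \<open>\<complex>\<^bsup>n2\<^esup>\<close>, the map \<open>E \<otimes> F\<close> is the linear extension of
  \<open>|i\<rangle>\<langle>j| \<otimes> |k\<rangle>\<langle>l| \<mapsto> E (|i\<rangle>\<langle>j|) \<otimes> F (|k\<rangle>\<langle>l|)\<close>.
\<close>

definition tensor_map ::
  "nat \<Rightarrow> nat \<Rightarrow> nat \<Rightarrow> nat \<Rightarrow> (complex mat \<Rightarrow> complex mat) \<Rightarrow> (complex mat \<Rightarrow> complex mat)
     \<Rightarrow> complex mat \<Rightarrow> complex mat" where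
  "tensor_map m1 n1 m2 n2 E F K =
     mat_sum (n1 * n2) (n1 * n2)
       (\<lambda>(i, j, k, l). K $$ (i * m2 + k, j * m2 + l) \<cdot>\<^sub>m
          kron (E (ketbra (unit_vec m1 i) (unit_vec m1 j)))
               (F (ketbra (unit_vec m2 k) (unit_vec m2 l))))
       ({..<m1} \<times> {..<m1} \<times> {..<m2} \<times> {..<m2})"

text \<open>Completely positive trace-preserving linear maps; values outside \<open>carrier_mat m m\<close> are irrelevant.\<close>

definition quantum_channel :: "nat \<Rightarrow> nat \<Rightarrow> (complex mat \<Rightarrow> complex mat) \<Rightarrow> bool" where
  "quantum_channel m n E \<longleftrightarrow>
     (\<forall>A\<in>carrier_mat m m. E A \<in> carrier_mat n n) \<and>
     (\<forall>A\<in>carrier_mat m m. \<forall>B\<in>carrier_mat m m. E (A + B) = E A + E B) \<and>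
     (\<forall>c. \<forall>A\<in>carrier_mat m m. E (c \<cdot>\<^sub>m A) = c \<cdot>\<^sub>m E A) \<and>
     (\<forall>r A. psd_mat (r * m) A \<longrightarrow> psd_mat (r * n) (tensor_map r r m n (\<lambda>K. K) E A)) \<and>
     (\<forall>A\<in>carrier_mat m m. mat_trace (E A) = mat_trace A)"

text \<open>
  The reference system \<open>R = \<complex>\<^sup>r\<close> ranges over all finite dimensions. The supremum is finite
  (at most 2) for differences of channels, the only case in which it is used.
\<close>

definition diamond_norm :: "nat \<Rightarrow> nat \<Rightarrow> (complex mat \<Rightarrow> complex mat) \<Rightarrow> real" where
  "diamond_norm m n \<Delta> =
     (SUP (r, \<rho>)\<in>{(r, \<rho>). density_mat (r * m) \<rho>}. trace_norm (tensor_map r r m n (\<lambda>K. K) \<Delta> \<rho>))"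

definition tnc_representation ::
  "('g, 'b) monoid_scheme \<Rightarrow> nat \<Rightarrow> ('g \<Rightarrow> complex mat) \<Rightarrow> bool" where
  "tnc_representation G d U \<longleftrightarrow>
     group G \<and> finite (carrier G) \<and> Coset.order G = d\<^sup>2 \<and>
     (\<forall>g\<in>carrier G. unitary_mat d (U g)) \<and>
     (\<forall>g\<in>carrier G. \<forall>h\<in>carrier G.
        mat_trace (mat_adjoint (U g) * U h) = (if g = h then of_nat d else 0)) \<and>
     (\<exists>\<omega> :: 'g \<Rightarrow> 'g \<Rightarrow> complex. \<forall>g\<in>carrier G. \<forall>h\<in>carrier G.
        cmod (\<omega> g h) = 1 \<and> U g * U h = \<omega> g h \<cdot>\<^sub>m U (g \<otimes>\<^bsub>G\<^esub> h))"

text \<open>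
  A classical register holding an element of \<open>G\<close> is \<open>\<complex>\<^bsup>d\<^sup>2\<^esup>\<close>, where the basis vector \<open>|g\<rangle>\<close> is
  the one with index \<open>ix g\<close>, for a bijection \<open>ix\<close> from \<open>G\<close> to \<open>{..<d\<^sup>2}\<close>.
\<close>

definition classical :: "nat \<Rightarrow> ('g \<Rightarrow> nat) \<Rightarrow> 'g \<Rightarrow> complex mat" where
  "classical d ix g = ketbra (unit_vec (d\<^sup>2) (ix g)) (unit_vec (d\<^sup>2) (ix g))"

definition max_entangled :: "nat \<Rightarrow> complex vec" where
  "max_entangled d =
     vec (d * d) (\<lambda>k. if k div d = k mod d then complex_of_real (1 / sqrt (real d)) else 0)"

definition ideal_state :: "nat \<Rightarrow> complex mat" where
  "ideal_state d = ketbra (max_entangled d) (max_entangled d)"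

text \<open>
  \<open>K \<mapsto> \<Sum>\<^sub>g V\<^sub>g (\<langle>g| \<otimes> I) K (|g\<rangle> \<otimes> I) V\<^sub>g\<^sup>\<dagger>\<close>, i.e. the first register is dephased, then
  \<open>|g\<rangle>\<langle>g| \<otimes> \<rho> \<mapsto> V\<^sub>g \<rho> V\<^sub>g\<^sup>\<dagger>\<close>.
\<close>

definition controlled_encoder ::
  "('g, 'b) monoid_scheme \<Rightarrow> nat \<Rightarrow> ('g \<Rightarrow> nat) \<Rightarrow> ('g \<Rightarrow> complex mat) \<Rightarrow> complex mat \<Rightarrow> complex mat" where
  "controlled_encoder G d ix V K =
     mat_sum d d
       (\<lambda>g. V g * mat d d (\<lambda>(i, j). K $$ (ix g * d + i, ix g * d + j)) * mat_adjoint (V g))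
       (carrier G)"

definition ideal_encoder1 ::
  "('g, 'b) monoid_scheme \<Rightarrow> nat \<Rightarrow> ('g \<Rightarrow> nat) \<Rightarrow> ('g \<Rightarrow> complex mat) \<Rightarrow> complex mat \<Rightarrow> complex mat" where
  "ideal_encoder1 G d ix U = controlled_encoder G d ix U"

definition ideal_encoder2 ::
  "('g, 'b) monoid_scheme \<Rightarrow> nat \<Rightarrow> ('g \<Rightarrow> nat) \<Rightarrow> ('g \<Rightarrow> complex mat) \<Rightarrow> complex mat \<Rightarrow> complex mat" where
  "ideal_encoder2 G d ix U = controlled_encoder G d ix (\<lambda>h. transpose_mat (U h))"

definition ideal_transmission :: "complex mat \<Rightarrow> complex mat" where
  "ideal_transmission K = K"

definition code_state :: "nat \<Rightarrow> ('g \<Rightarrow> complex mat) \<Rightarrow> 'g \<Rightarrow> complex vec" where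
  "code_state d U g = kron (U g) (1\<^sub>m d) *\<^sub>v max_entangled d"

definition ideal_decoder ::
  "('g, 'b) monoid_scheme \<Rightarrow> nat \<Rightarrow> ('g \<Rightarrow> nat) \<Rightarrow> ('g \<Rightarrow> complex mat) \<Rightarrow> complex mat \<Rightarrow> complex mat" where
  "ideal_decoder G d ix U K =
     mat_sum (d\<^sup>2) (d\<^sup>2)
       (\<lambda>g. ((K *\<^sub>v code_state d U g) \<bullet>c code_state d U g) \<cdot>\<^sub>m classical d ix g)
       (carrier G)"

definition classical_output :: "nat \<Rightarrow> (complex mat \<Rightarrow> complex mat) \<Rightarrow> bool" where
  "classical_output m E \<longleftrightarrow> (\<forall>K\<in>carrier_mat m m. diagonal_mat (E K))"

definition input_state ::
  "('g, 'b) monoid_scheme \<Rightarrow> nat \<Rightarrow> ('g \<Rightarrow> nat) \<Rightarrow> complex mat" where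
  "input_state G d ix =
     (1 / (of_nat (Coset.order G))\<^sup>2) \<cdot>\<^sub>m
       mat_sum (d\<^sup>2 * d\<^sup>2 * d\<^sup>2) (d\<^sup>2 * d\<^sup>2 * d\<^sup>2)
         (\<lambda>(g, h). kron (classical d ix (g \<otimes>\<^bsub>G\<^esub> h)) (kron (classical d ix g) (classical d ix h)))
         (carrier G \<times> carrier G)"

text \<open>The unitary \<open>\<complex>\<^sup>m \<otimes> \<complex>\<^sup>n \<rightarrow> \<complex>\<^sup>n \<otimes> \<complex>\<^sup>m\<close> mapping \<open>|i\<rangle>|j\<rangle>\<close> to \<open>|j\<rangle>|i\<rangle>\<close>.\<close>

definition swap_mat :: "nat \<Rightarrow> nat \<Rightarrow> complex mat" where
  "swap_mat m n = mat (n * m) (m * n) (\<lambda>(r, c). if r div m = c mod n \<and> r mod m = c div n then 1 else 0)"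

text \<open>
  \<open>\<rho>\<^bsub>ZXY\<^esub> \<otimes> \<sigma>\<^bsub>AB\<^esub>\<close> with its registers rearranged from \<open>ZXYAB\<close> to \<open>ZXAYB\<close>, so that the
  encoders act on the adjacent pairs \<open>XA\<close> and \<open>YB\<close>.
\<close>

definition joint_input ::
  "('g, 'b) monoid_scheme \<Rightarrow> nat \<Rightarrow> ('g \<Rightarrow> nat) \<Rightarrow> complex mat \<Rightarrow> complex mat" where
  "joint_input G d ix \<sigma> =
     (let W = kron (1\<^sub>m (d\<^sup>2 * d\<^sup>2)) (kron (swap_mat (d\<^sup>2) d) (1\<^sub>m d))
      in W * kron (input_state G d ix) \<sigma> * mat_adjoint W)"

definition protocol_output ::
  "('g, 'b) monoid_scheme \<Rightarrow> nat \<Rightarrow> ('g \<Rightarrow> nat) \<Rightarrow> complex mat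
     \<Rightarrow> (complex mat \<Rightarrow> complex mat) \<Rightarrow> (complex mat \<Rightarrow> complex mat)
     \<Rightarrow> (complex mat \<Rightarrow> complex mat) \<Rightarrow> (complex mat \<Rightarrow> complex mat)
     \<Rightarrow> (complex mat \<Rightarrow> complex mat) \<Rightarrow> complex mat" where
  "protocol_output G d ix \<sigma> E1 E2 T1 T2 D =
     tensor_map (d\<^sup>2) (d\<^sup>2) ((d\<^sup>2 * d) * (d\<^sup>2 * d)) (d\<^sup>2)
       (\<lambda>K. K)
       (D \<circ> tensor_map d d d d T1 T2 \<circ> tensor_map (d\<^sup>2 * d) d (d\<^sup>2 * d) d E1 E2)
       (joint_input G d ix \<sigma>)"

text \<open>The distribution of the outcome \<open>(z, z')\<close> for a state of two classical registers \<open>ZZ'\<close>.\<close>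

definition outcome_prob :: "nat \<Rightarrow> ('g \<Rightarrow> nat) \<Rightarrow> complex mat \<Rightarrow> 'g \<times> 'g \<Rightarrow> real" where
  "outcome_prob d ix \<tau> = (\<lambda>(z, z'). Re (mat_trace (kron (classical d ix z) (classical d ix z') * \<tau>)))"

definition success_prob ::
  "('g, 'b) monoid_scheme \<Rightarrow> nat \<Rightarrow> ('g \<Rightarrow> nat) \<Rightarrow> complex mat \<Rightarrow> real" where
  "success_prob G d ix \<tau> =
     (\<Sum>zz'\<in>{(z, z'). z \<in> carrier G \<and> z' \<in> carrier G \<and> z = z'}. outcome_prob d ix \<tau> zz')"

end

theory Submission
  imports Defs
begin

text \<open>
  Fix the inputs \<open>(g, h)\<close> and replace the real components by the ideal ones one at a time, in the order
  decoder, first and second transmission, first and second encoder, state, so that everything after the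
  replaced component is already ideal or can be commuted before it. The success probability is then always of the form \<open>\<langle>w| \<rho> |w\<rangle>\<close> for a unit vector \<open>w\<close>, and for two states it changes by at
  most half the trace norm of their difference, since that difference is Hermitian with trace zero: write
  it in an eigenbasis and bound \<open>\<Sum>\<^sub>k c\<^sub>k (p\<^sub>k - 1/2)\<close> with \<open>0 \<le> p\<^sub>k \<le> 1\<close>. With all components ideal the
  state before the measurement is the code state of \<open>g \<cdot> h\<close> up to a phase, because
  \<open>(U\<^sub>g \<otimes> U\<^sub>h\<^sup>T)|\<Phi>\<rangle> = (U\<^sub>g U\<^sub>h \<otimes> I)|\<Phi>\<rangle>\<close>. That the diamond norms are suprema of bounded sets requires the
  ideal components to be channels, which follows from their Kraus forms.
\<close>

section \<open>Spectral decomposition and the trace norm\<close>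

text \<open>The obstacle is composition: a chain of triangle inequalities would need contractivity
  of the trace norm under channels and submultiplicativity of the diamond norm. Working backwards
  from the output avoids both. Whatever precedes the replaced component merely prepares some density
  matrix, and whatever follows it has become part of the test vector: the basis vector of the
  outcome turns into a code state, and the code state into the maximally entangled vector up to a
  phase. Each diamond norm is then evaluated at a single reference system, namely the register of
  dimension d that the component leaves alone, or the trivial one for the decoder. The two encoders
  act on different factors, so each can be made the last to act when its turn comes. Treating the
  pairs (g, h) separately is possible because the input is a classical mixture and the event Z = Z'
  only reads diagonal blocks.\<close>

definition quad_form :: "nat \<Rightarrow> complex mat \<Rightarrow> (nat \<Rightarrow> complex) \<Rightarrow> complex" where
  "quad_form n A v = (\<Sum>i<n. \<Sum>j<n. cnj (v i) * A $$ (i, j) * v j)"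

section \<open>Adjoints, positivity and unitary matrices in coordinates\<close>

lemma mat_adjoint_dim [simp]:
  "dim_row (mat_adjoint A) = dim_col A" "dim_col (mat_adjoint A) = dim_row A"
  by (auto simp: mat_adjoint_def)

lemma mat_adjoint_carrier [simp]:
  "A \<in> carrier_mat m n \<Longrightarrow> mat_adjoint A \<in> carrier_mat n m"
  by (intro carrier_matI) auto

lemma mat_adjoint_index [simp]:
  assumes "i < dim_col A" "j < dim_row A"
  shows "mat_adjoint (A :: complex mat) $$ (i, j) = cnj (A $$ (j, i))"
  using assms by (auto simp: mat_adjoint_def mat_of_rows_def)

lemma mult_mat_index:
  assumes "A \<in> carrier_mat m n" "B \<in> carrier_mat n p" "i < m" "j < p"
  shows "(A * B) $$ (i, j) = (\<Sum>k<n. A $$ (i, k) * B $$ (k, j))"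
  using assms by (auto simp: scalar_prod_def atLeast0LessThan)

lemma mult_mat_vec_inner:
  assumes "A \<in> carrier_mat n n" "v \<in> carrier_vec n"
  shows "(A *\<^sub>v v) \<bullet>c v = quad_form n A (\<lambda>i. v $ i)"
proof -
  have "(A *\<^sub>v v) \<bullet>c v = (\<Sum>i<n. (\<Sum>j<n. A $$ (i, j) * v $ j) * cnj (v $ i))"
    using assms by (simp add: scalar_prod_def atLeast0LessThan)
  also have "\<dots> = quad_form n A (\<lambda>i. v $ i)"
    unfolding quad_form_def sum_distrib_right by (simp add: ac_simps)
  finally show ?thesis .
qed

lemma quad_form_vec: "quad_form n A (\<lambda>i. vec n v $ i) = quad_form n A v"
  by (simp add: quad_form_def)

lemma mat_adjoint_eqD:
  assumes "mat_adjoint A = (A :: complex mat)" "A \<in> carrier_mat n n" "i < n" "j < n"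
  shows "A $$ (i, j) = cnj (A $$ (j, i))"
proof -
  have "mat_adjoint A $$ (i, j) = cnj (A $$ (j, i))" using assms(2-) by simp
  then show ?thesis unfolding assms(1) .
qed

lemma mat_adjoint_eqI:
  assumes A: "(A :: complex mat) \<in> carrier_mat n n"
    and h: "\<And>i j. i < n \<Longrightarrow> j < n \<Longrightarrow> A $$ (i, j) = cnj (A $$ (j, i))"
  shows "mat_adjoint A = A"
proof (rule eq_matI)
  fix i j assume "i < dim_row A" "j < dim_col A"
  then have ij: "i < n" "j < n" using A by auto
  have "mat_adjoint A $$ (i, j) = cnj (A $$ (j, i))" using ij A by simp
  also have "\<dots> = A $$ (i, j)" by (rule h[OF ij, symmetric])
  finally show "mat_adjoint A $$ (i, j) = A $$ (i, j)" .
qed (use A in auto)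

text \<open>Test vectors are plain functions here, so that they can be written as lambda terms and
  reindexed by \<open>div\<close> and \<open>mod\<close> without carrier conditions. Truncation by
  \<open>vec n\<close> shows that this is the same notion of positivity.\<close>

lemma psd_mat_iff:
  "psd_mat n A \<longleftrightarrow> A \<in> carrier_mat n n \<and> mat_adjoint A = A \<and> (\<forall>v. 0 \<le> quad_form n A v)"
proof (cases "A \<in> carrier_mat n n")
  case True
  have "(\<forall>v\<in>carrier_vec n. 0 \<le> (A *\<^sub>v v) \<bullet>c v) \<longleftrightarrow> (\<forall>v. 0 \<le> quad_form n A v)"
  proof
    assume "\<forall>v\<in>carrier_vec n. 0 \<le> (A *\<^sub>v v) \<bullet>c v"
    then have "0 \<le> quad_form n A (\<lambda>i. vec n v $ i)" for v using mult_mat_vec_inner[OF True, of "vec n v"] by (metis vec_carrier)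
    then show "\<forall>v. 0 \<le> quad_form n A v" unfolding quad_form_vec by blast
  qed (simp add: mult_mat_vec_inner[OF True])
  then show ?thesis by (simp add: psd_mat_def)
qed (simp add: psd_mat_def)

lemma unitary_mat_columns:
  assumes "unitary_mat n V" "k < n" "l < n"
  shows "(\<Sum>i<n. cnj (V $$ (i, k)) * V $$ (i, l)) = (if k = l then 1 else 0)"
proof -
  have V: "V \<in> carrier_mat n n" and e: "mat_adjoint V * V = 1\<^sub>m n" using assms by (auto simp: unitary_mat_def)
  have "(mat_adjoint V * V) $$ (k, l) = (\<Sum>i<n. cnj (V $$ (i, k)) * V $$ (i, l))"
    using V assms by (subst mult_mat_index[of _ n n _ n]) auto
  then show ?thesis using e assms by simp
qed

lemma unitary_mat_rows:
  assumes "unitary_mat n V" "i < n" "j < n"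
  shows "(\<Sum>k<n. V $$ (i, k) * cnj (V $$ (j, k))) = (if i = j then 1 else 0)"
proof -
  have V: "V \<in> carrier_mat n n" and e: "V * mat_adjoint V = 1\<^sub>m n" using assms by (auto simp: unitary_mat_def)
  have "(V * mat_adjoint V) $$ (i, j) = (\<Sum>k<n. V $$ (i, k) * cnj (V $$ (j, k)))"
    using V assms by (subst mult_mat_index[of _ n n _ n]) auto
  then show ?thesis using e assms by simp
qed

text \<open>A left inverse of a square matrix is also a right inverse, so orthonormal columns
  already give orthonormal rows. \<open>code_state_complete\<close> rests on this.\<close>

lemma unitary_matI:
  assumes V: "V \<in> carrier_mat n n"
    and "\<And>k l. k < n \<Longrightarrow> l < n \<Longrightarrow> (\<Sum>i<n. cnj (V $$ (i, k)) * V $$ (i, l)) = (if k = l then 1 else 0)"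
  shows "unitary_mat n V"
proof -
  have e: "mat_adjoint V * V = 1\<^sub>m n"
  proof (rule eq_matI)
    fix k l assume "k < dim_row (1\<^sub>m n :: complex mat)" "l < dim_col (1\<^sub>m n :: complex mat)"
    then have kl: "k < n" "l < n" by auto
    have "(mat_adjoint V * V) $$ (k, l) = (\<Sum>i<n. cnj (V $$ (i, k)) * V $$ (i, l))"
      using V kl by (subst mult_mat_index[of _ n n _ n]) auto
    then show "(mat_adjoint V * V) $$ (k, l) = (1\<^sub>m n :: complex mat) $$ (k, l)"
      using assms(2)[OF kl] kl by simp
  qed (use V in auto)
  then show ?thesis
    using mat_mult_left_right_inverse[OF _ V e] V by (simp add: unitary_mat_def)
qed

section \<open>Traces and the spectral theorem for Hermitian matrices\<close>

lemma mat_trace_eq: "A \<in> carrier_mat n n \<Longrightarrow> mat_trace A = (\<Sum>i<n. A $$ (i, i))"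
  by (auto simp: mat_trace_def)

lemma mat_trace_comm:
  assumes "A \<in> carrier_mat m n" "B \<in> carrier_mat n m"
  shows "mat_trace (A * B) = mat_trace (B * A)"
proof -
  have "mat_trace (A * B) = (\<Sum>i<m. \<Sum>k<n. A $$ (i, k) * B $$ (k, i))"
    unfolding mat_trace_eq[OF mult_carrier_mat[OF assms]]
    by (intro sum.cong refl mult_mat_index[OF assms]) auto
  also have "\<dots> = (\<Sum>k<n. \<Sum>i<m. B $$ (k, i) * A $$ (i, k))"
    by (subst sum.swap) (simp add: mult.commute)
  also have "\<dots> = mat_trace (B * A)"
    unfolding mat_trace_eq[OF mult_carrier_mat[OF assms(2,1)]]
    by (intro sum.cong refl mult_mat_index[OF assms(2,1), symmetric]) auto
  finally show ?thesis .
qed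

text \<open>The trace is the sum of the eigenvalues with multiplicity, read off the diagonal of a
  Schur form. If \<mu> were the only eigenvalue, the trace would be n times \<mu>.\<close>

lemma exists_eigenvector_ne:
  fixes B :: "complex mat"
  assumes B: "B \<in> carrier_mat n n" and tr: "mat_trace B \<noteq> of_nat n * \<mu>"
  obtains \<nu> x where "\<nu> \<noteq> \<mu>" "x \<in> carrier_vec n" "x \<noteq> 0\<^sub>v n" "B *\<^sub>v x = \<nu> \<cdot>\<^sub>v x"
proof -
  obtain es where cp: "char_poly B = (\<Prod>a\<leftarrow>es. [:- a, 1:])"
    using char_poly_factorized[OF B] by blast
  obtain T P Q where sd: "schur_decomposition B es = (T, P, Q)" by (metis prod_cases3)
  from schur_decomposition[OF B cp sd] have sim: "similar_mat_wit B T P Q" and dg: "diag_mat T = es" by auto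
  note w = similar_mat_witD2[OF B sim]
  have c: "T \<in> carrier_mat n n" "P \<in> carrier_mat n n" "Q \<in> carrier_mat n n" using w by blast+
  have "mat_trace B = mat_trace ((P * T) * Q)" using w(3) by simp
  also have "\<dots> = mat_trace (Q * (P * T))" using c by (intro mat_trace_comm[of _ n n]) auto
  also have "Q * (P * T) = T" using c w(2) by (simp add: assoc_mult_mat[of _ n n _ n _ n, symmetric])
  finally have "(\<Sum>i<n. T $$ (i, i)) \<noteq> (\<Sum>i<n. \<mu>)" using tr mat_trace_eq[OF c(1)] by simp
  then obtain i where i: "i < n" "T $$ (i, i) \<noteq> \<mu>" by (meson lessThan_iff sum.cong)
  have "T $$ (i, i) \<in> set es" using i c unfolding dg[symmetric] diag_mat_def by auto
  then have "poly (char_poly B) (T $$ (i, i)) = 0"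
    unfolding cp by (auto simp: poly_prod_list prod_list_zero_iff)
  then have "eigenvalue B (T $$ (i, i))" using eigenvalue_root_char_poly[OF B] by simp
  then obtain x where "eigenvector B x (T $$ (i, i))" by (auto simp: eigenvalue_def)
  then show thesis using i(2) B by (intro that[of "T $$ (i, i)" x]) (auto simp: eigenvector_def)
qed

text \<open>
  Deflation: adding \<open>\<Sum>\<^sub>a (\<mu> - c\<^sub>a) v\<^sub>a v\<^sub>a\<^sup>\<dagger>\<close> moves all known eigenvalues to \<open>\<mu>\<close>. Comparing traces,
  a suitable \<open>\<mu>\<close> cannot be the only eigenvalue, and an eigenvector for another eigenvalue is
  orthogonal to all \<open>v\<^sub>a\<close>.
\<close>

lemma orthonormal_eigenvectors:
  fixes A :: "complex mat"
  assumes A: "A \<in> carrier_mat n n" and herm: "mat_adjoint A = A"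
  shows "k \<le> n \<Longrightarrow> \<exists>V (c :: nat \<Rightarrow> real).
    (\<forall>a<k. \<forall>b<k. (\<Sum>i<n. cnj (V i a) * V i b) = (if a = b then 1 else 0)) \<and>
    (\<forall>a<k. \<forall>i<n. (\<Sum>j<n. A $$ (i, j) * V j a) = of_real (c a) * V i a)"
proof (induction k)
  case (Suc k)
  then obtain V and c :: "nat \<Rightarrow> real"
    where on: "\<And>a b. a < k \<Longrightarrow> b < k \<Longrightarrow> (\<Sum>i<n. cnj (V i a) * V i b) = (if a = b then 1 else 0)"
      and ev: "\<And>a i. a < k \<Longrightarrow> i < n \<Longrightarrow> (\<Sum>j<n. A $$ (i, j) * V j a) = of_real (c a) * V i a"
    using Suc_leD by blast
  \<comment> \<open>If \<open>mat_trace B\<close> were n times \<mu>, then \<mu> would be exactly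
    the quotient on the right. The summand 1 rules this out, and k < n makes the quotient
    meaningful.\<close>
  define \<mu> where "\<mu> = (Re (mat_trace A) - (\<Sum>a<k. c a)) / (real n - real k) + 1"
  define D where "D i j = (\<Sum>a<k. of_real (\<mu> - c a) * V i a * cnj (V j a))" for i j
  define B where "B = mat n n (\<lambda>(i, j). A $$ (i, j) + D i j)"
  have B: "B \<in> carrier_mat n n" by (simp add: B_def)
  have Dx: "(\<Sum>j<n. D i j * x j) = (\<Sum>a<k. of_real (\<mu> - c a) * V i a * (\<Sum>j<n. cnj (V j a) * x j))" for i x
    unfolding D_def sum_distrib_left sum_distrib_right
    by (subst sum.swap) (simp add: mult_ac)
  have "mat_trace B = mat_trace A + (\<Sum>i<n. D i i)"
    unfolding mat_trace_eq[OF A] mat_trace_eq[OF B] sum.distrib[symmetric] by (simp add: B_def)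
  also have "(\<Sum>i<n. D i i) = (\<Sum>a<k. of_real (\<mu> - c a) * (\<Sum>i<n. cnj (V i a) * V i a))"
    unfolding D_def sum_distrib_left by (subst sum.swap) (simp add: mult_ac)
  also have "\<dots> = (\<Sum>a<k. of_real (\<mu> - c a))" by (intro sum.cong) (auto simp: on)
  finally have trB: "mat_trace B = mat_trace A + of_real (real k * \<mu> - (\<Sum>a<k. c a))"
    by (simp add: sum_subtractf)
  have "mat_trace B \<noteq> of_nat n * of_real \<mu>"
  proof
    assume "mat_trace B = of_nat n * of_real \<mu>"
    then have "Re (mat_trace B) = real n * \<mu>" by simp
    then have "Re (mat_trace A) - (\<Sum>a<k. c a) = (real n - real k) * \<mu>"
      unfolding trB by (simp add: algebra_simps)
    moreover have pos: "real n - real k > 0" using Suc.prems by simp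
    then have "(real n - real k) * \<mu> = Re (mat_trace A) - (\<Sum>a<k. c a) + (real n - real k)"
      unfolding \<mu>_def distrib_left by simp
    ultimately show False using pos by linarith
  qed
  from exists_eigenvector_ne[OF B this] obtain \<nu> x
    where nu: "\<nu> \<noteq> of_real \<mu>" and x: "x \<in> carrier_vec n" "x \<noteq> 0\<^sub>v n" "B *\<^sub>v x = \<nu> \<cdot>\<^sub>v x" .
  have Bx: "(\<Sum>j<n. B $$ (i, j) * x $ j) = \<nu> * x $ i" if "i < n" for i
  proof -
    have "(B *\<^sub>v x) $ i = (\<Sum>j<n. B $$ (i, j) * x $ j)"
      using that B x(1) by (auto simp: scalar_prod_def atLeast0LessThan)
    then show ?thesis using x that by simp
  qed
  have Bh: "B $$ (i, j) = cnj (B $$ (j, i))" if "i < n" "j < n" for i j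
  proof -
    have "B $$ (i, j) = cnj (A $$ (j, i)) + D i j"
      using that mat_adjoint_eqD[OF herm A that] by (simp add: B_def)
    also have "D i j = cnj (D j i)" by (simp add: D_def mult_ac)
    finally show ?thesis using that by (simp add: B_def)
  qed
  have Bv: "(\<Sum>j<n. B $$ (i, j) * V j a) = of_real \<mu> * V i a" if "a < k" "i < n" for a i
  proof -
    have "(\<Sum>j<n. B $$ (i, j) * V j a) = (\<Sum>j<n. A $$ (i, j) * V j a) + (\<Sum>j<n. D i j * V j a)"
      using that by (simp add: B_def algebra_simps sum.distrib)
    also have "(\<Sum>j<n. D i j * V j a) = (\<Sum>b<k. if b = a then of_real (\<mu> - c a) * V i a else 0)"
      unfolding Dx using that by (intro sum.cong) (auto simp: on)
    finally show ?thesis using that ev by (simp add: algebra_simps)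
  qed
  \<comment> \<open>B is self-adjoint: moving it across the inner product only conjugates. This
    serves both the orthogonality to the old eigenvectors and the reality of \<nu>.\<close>
  have sa: "(\<Sum>i<n. cnj (y i) * (\<Sum>j<n. B $$ (i, j) * z j)) = cnj (\<Sum>i<n. cnj (z i) * (\<Sum>j<n. B $$ (i, j) * y j))"
    for y z
  proof -
    have "(\<Sum>i<n. cnj (y i) * (\<Sum>j<n. B $$ (i, j) * z j)) = (\<Sum>j<n. \<Sum>i<n. cnj (y i) * (B $$ (i, j) * z j))"
      unfolding sum_distrib_left by (rule sum.swap)
    also have "\<dots> = (\<Sum>j<n. \<Sum>i<n. cnj (y i) * (cnj (B $$ (j, i)) * z j))"
      by (intro sum.cong refl arg_cong2[of _ _ _ _ "(*)"] Bh) auto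
    finally show ?thesis by (simp add: sum_distrib_left mult_ac)
  qed
  have orth: "(\<Sum>i<n. cnj (V i a) * x $ i) = 0" if "a < k" for a
  proof -
    have "\<nu> * (\<Sum>i<n. cnj (V i a) * x $ i) = (\<Sum>i<n. cnj (V i a) * (\<Sum>j<n. B $$ (i, j) * x $ j))"
      by (subst sum_distrib_left, intro sum.cong refl) (simp add: Bx mult.left_commute)
    also have "\<dots> = cnj (\<Sum>i<n. cnj (x $ i) * (\<Sum>j<n. B $$ (i, j) * V j a))" by (rule sa)
    also have "\<dots> = cnj (\<Sum>i<n. cnj (x $ i) * (of_real \<mu> * V i a))" using that by (simp add: Bv)
    also have "\<dots> = of_real \<mu> * (\<Sum>i<n. cnj (V i a) * x $ i)" by (simp add: sum_distrib_left mult_ac)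
    finally show ?thesis using nu by simp
  qed
  \<comment> \<open>Orthogonality to the old eigenvectors annihilates the correction D, so x is an
    eigenvector of A itself.\<close>
  have Ax: "(\<Sum>j<n. A $$ (i, j) * x $ j) = \<nu> * x $ i" if "i < n" for i
  proof -
    have "(\<Sum>j<n. B $$ (i, j) * x $ j) = (\<Sum>j<n. A $$ (i, j) * x $ j) + (\<Sum>j<n. D i j * x $ j)"
      using that by (simp add: B_def algebra_simps sum.distrib)
    then show ?thesis using Dx[of i "\<lambda>j. x $ j"] orth Bx[OF that] by simp
  qed
  define s where "s = sqrt (\<Sum>i<n. (cmod (x $ i))\<^sup>2)"
  obtain i0 where "i0 < n" "x $ i0 \<noteq> 0" using x(1,2) by (metis eq_vecI index_zero_vec carrier_vecD)
  then have "0 < (\<Sum>i<n. (cmod (x $ i))\<^sup>2)" by (intro sum_pos2[of _ i0]) auto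
  then have s: "s > 0" "s * s = (\<Sum>i<n. (cmod (x $ i))\<^sup>2)" by (auto simp: s_def)
  have nrm: "(\<Sum>i<n. cnj (x $ i) * x $ i) = of_real s * of_real s"
    by (simp only: of_real_mult[symmetric] s(2)) (simp add: complex_norm_square mult.commute del: of_real_power)
  have nu_real: "\<nu> = of_real (Re \<nu>)"
  proof -
    have "(\<Sum>i<n. cnj (x $ i) * (\<Sum>j<n. B $$ (i, j) * x $ j)) = \<nu> * (of_real s * of_real s)"
      unfolding nrm[symmetric] by (subst (2) sum_distrib_left, intro sum.cong refl) (simp add: Bx mult.left_commute)
    then have "\<nu> * (of_real s * of_real s) = cnj (\<nu> * (of_real s * of_real s))" using sa[of "\<lambda>i. x $ i" "\<lambda>i. x $ i"] by simp
    then have "\<nu> = cnj \<nu>" using s(1) by simp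
    then show ?thesis by (simp add: complex_eq_iff)
  qed
  define V' where "V' i a = (if a = k then x $ i / of_real s else V i a)" for i a
  define c' where "c' a = (if a = k then Re \<nu> else c a)" for a
  have "(\<Sum>i<n. cnj (V' i a) * V' i b) = (if a = b then 1 else 0)" if "a < Suc k" "b < Suc k" for a b
  proof -
    have o: "(\<Sum>i<n. cnj (x $ i) * V i a) = 0" if "a < k" for a
    proof -
      have "(\<Sum>i<n. cnj (x $ i) * V i a) = cnj (\<Sum>i<n. cnj (V i a) * x $ i)" by (simp add: mult.commute)
      then show ?thesis using orth[OF that] by simp
    qed
    consider "a < k" "b < k" | "a = k" "b < k" | "a < k" "b = k" | "a = k" "b = k"
      using \<open>a < Suc k\<close> \<open>b < Suc k\<close> by (auto simp: less_Suc_eq)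
    then show ?thesis
    proof cases
      case 1 then show ?thesis using on by (simp add: V'_def)
    next
      case 2 then show ?thesis using o[of b] by (simp add: V'_def sum_divide_distrib[symmetric])
    next
      case 3 then show ?thesis using orth[of a] by (simp add: V'_def sum_divide_distrib[symmetric])
    next
      case 4
      have "(\<Sum>i<n. cnj (V' i k) * V' i k) = (\<Sum>i<n. cnj (x $ i) * x $ i) / (of_real s * of_real s)"
        unfolding sum_divide_distrib by (simp add: V'_def)
      then show ?thesis unfolding nrm using 4 s(1) by simp
    qed
  qed
  moreover have "(\<Sum>j<n. A $$ (i, j) * V' j a) = of_real (c' a) * V' i a" if "a < Suc k" "i < n" for a i
  proof (cases "a = k")
    case True
    then show ?thesis using Ax[OF that(2)] nu_real by (simp add: V'_def c'_def sum_divide_distrib[symmetric])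
  next
    case False
    then show ?thesis using that ev by (simp add: V'_def c'_def)
  qed
  ultimately show ?case by blast
qed simp

section \<open>The trace norm of a Hermitian matrix\<close>

lemma proots_linear_factors: "proots (\<Prod>a\<leftarrow>as. [:- a, 1:]) = mset (as :: 'a :: idom list)"
proof (induction as)
  case (Cons a as)
  have "(\<Prod>a\<leftarrow>as. [:- a, 1:]) \<noteq> 0" by (simp add: prod_list_zero_iff image_iff del: mult_pCons_left)
  then show ?case using Cons by (simp add: proots_mult del: mult_pCons_left)
qed simp

text \<open>The entrywise form of A = V diag(c) V\<dagger>, with real c because only Hermitian
  matrices are decomposed. Unitarity of V is kept apart, so \<open>quad_form_spectral\<close> is a
  mere rearrangement of sums.\<close>

definition spectral_sum :: "nat \<Rightarrow> complex mat \<Rightarrow> complex mat \<Rightarrow> (nat \<Rightarrow> real) \<Rightarrow> bool" where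
  "spectral_sum n A V c \<longleftrightarrow>
     (\<forall>i<n. \<forall>j<n. A $$ (i, j) = (\<Sum>k<n. of_real (c k) * V $$ (i, k) * cnj (V $$ (j, k))))"

lemma spectral_sumD:
  "spectral_sum n A V c \<Longrightarrow> i < n \<Longrightarrow> j < n \<Longrightarrow>
     A $$ (i, j) = (\<Sum>k<n. of_real (c k) * V $$ (i, k) * cnj (V $$ (j, k)))"
  by (simp add: spectral_sum_def)

text \<open>For Hermitian A the matrix A\<dagger>A is A A = V C C V\<dagger>, whose eigenvalues are
  the squares of the \<open>c k\<close>. The square roots in \<open>trace_norm\<close> turn them
  into absolute values.\<close>

lemma hermitian_spectral:
  fixes A :: "complex mat"
  assumes A: "A \<in> carrier_mat n n" and herm: "mat_adjoint A = A"
  obtains V and c :: "nat \<Rightarrow> real" where "unitary_mat n V"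
    "spectral_sum n A V c"
    "trace_norm A = (\<Sum>k<n. \<bar>c k\<bar>)"
proof -
  obtain W and c :: "nat \<Rightarrow> real"
    where on: "\<And>a b. a < n \<Longrightarrow> b < n \<Longrightarrow> (\<Sum>i<n. cnj (W i a) * W i b) = (if a = b then 1 else 0)"
      and ev: "\<And>a i. a < n \<Longrightarrow> i < n \<Longrightarrow> (\<Sum>j<n. A $$ (i, j) * W j a) = of_real (c a) * W i a"
    using orthonormal_eigenvectors[OF A herm order_refl] by blast
  define V where "V = mat n n (\<lambda>(i, k). W i k)"
  have V: "V \<in> carrier_mat n n" by (simp add: V_def)
  have U: "unitary_mat n V" using on by (intro unitary_matI[OF V]) (simp add: V_def)
  have VV: "mat_adjoint V * V = 1\<^sub>m n" "V * mat_adjoint V = 1\<^sub>m n" using U by (auto simp: unitary_mat_def)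
  note aV = mat_adjoint_carrier[OF V]
  define C where "C = mat n n (\<lambda>(k, l). if k = l then complex_of_real (c k) else 0)"
  have C: "C \<in> carrier_mat n n" by (simp add: C_def)
  have C0: "C $$ (k, l) = 0" if "k < n" "l < n" "k \<noteq> l" for k l using that by (simp add: C_def)
  have cC: "C $$ (k, k) = of_real (c k)" if "k < n" for k using that by (simp add: C_def)
  have "A * V = V * C"
  proof (rule eq_matI)
    fix i k assume "i < dim_row (V * C)" "k < dim_col (V * C)"
    then have ik: "i < n" "k < n" using V C by auto
    have "(A * V) $$ (i, k) = of_real (c k) * W i k"
      unfolding mult_mat_index[OF A V ik] using ev[of k i] ik by (simp add: V_def)
    moreover have "(V * C) $$ (i, k) = (\<Sum>l<n. if l = k then V $$ (i, k) * of_real (c k) else 0)"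
      unfolding mult_mat_index[OF V C ik] using ik by (intro sum.cong) (auto simp: C_def)
    ultimately show "(A * V) $$ (i, k) = (V * C) $$ (i, k)" using ik by (simp add: V_def mult.commute)
  qed (use A V C in auto)
  then have AV: "A = V * C * mat_adjoint V"
    using assoc_mult_mat[OF A V aV] VV A by simp
  have ent: "A $$ (i, j) = (\<Sum>k<n. of_real (c k) * V $$ (i, k) * cnj (V $$ (j, k)))" if "i < n" "j < n" for i j
  proof -
    have "A $$ (i, j) = (\<Sum>k<n. (V * C) $$ (i, k) * mat_adjoint V $$ (k, j))"
      using that V C by (subst AV, subst mult_mat_index[of _ n n _ n]) auto
    also have "\<dots> = (\<Sum>k<n. of_real (c k) * V $$ (i, k) * cnj (V $$ (j, k)))"
    proof (intro sum.cong refl)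
      fix k assume "k \<in> {..<n}"
      then have k: "k < n" by simp
      have "(V * C) $$ (i, k) = (\<Sum>l<n. V $$ (i, l) * C $$ (l, k))"
        using that V C k by (subst mult_mat_index[of _ n n _ n]) auto
      also have "\<dots> = (\<Sum>l<n. if l = k then V $$ (i, k) * of_real (c k) else 0)"
        using C0 cC k by (intro sum.cong) auto
      also have "\<dots> = of_real (c k) * V $$ (i, k)" using k by (simp add: mult.commute)
      finally show "(V * C) $$ (i, k) * mat_adjoint V $$ (k, j) = of_real (c k) * V $$ (i, k) * cnj (V $$ (j, k))"
        using V k that by simp
    qed
    finally show ?thesis .
  qed
  have CC: "C * C \<in> carrier_mat n n" using C by auto
  have CCe: "(C * C) $$ (k, l) = (if k = l then of_real ((c k)\<^sup>2) else 0)" if "k < n" "l < n" for k l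
  proof -
    have "(C * C) $$ (k, l) = (\<Sum>j<n. C $$ (k, j) * C $$ (j, l))"
      using that C by (subst mult_mat_index[of _ n n _ n]) auto
    also have "\<dots> = (\<Sum>j<n. if j = k then C $$ (k, k) * C $$ (k, l) else 0)"
      using C0 that by (intro sum.cong) auto
    also have "\<dots> = C $$ (k, k) * C $$ (k, l)" using that by simp
    finally show ?thesis using C0 cC that by (auto simp: power2_eq_square)
  qed
  have "similar_mat_wit (mat_adjoint A * A) (C * C) V (mat_adjoint V)"
  proof (rule similar_mat_witI[of _ _ n])
    have "mat_adjoint A * A = V * C * (mat_adjoint V * V) * C * mat_adjoint V"
      unfolding herm using V C aV by (subst (1 2) AV) (simp add: assoc_mult_mat[of _ n n _ n _ n] mult_carrier_mat[of _ n n _ n])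
    then show "mat_adjoint A * A = V * (C * C) * mat_adjoint V"
      using VV V C aV by (simp add: assoc_mult_mat[of _ n n _ n _ n] mult_carrier_mat[of _ n n _ n])
  qed (use VV V C aV A herm in auto)
  then have "char_poly (mat_adjoint A * A) = char_poly (C * C)"
    by (intro char_poly_similar) (auto simp: similar_mat_def)
  also have "\<dots> = (\<Prod>a\<leftarrow>diag_mat (C * C). [:- a, 1:])"
    by (rule char_poly_upper_triangular[OF CC], rule upper_triangularI) (use CCe C in simp)
  also have "diag_mat (C * C) = map (\<lambda>k. of_real ((c k)\<^sup>2)) [0..<n]"
    unfolding diag_mat_def using CCe C by auto
  finally have cp: "char_poly (mat_adjoint A * A) = (\<Prod>k\<leftarrow>[0..<n]. [:- of_real ((c k)\<^sup>2), 1:])"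
    by (simp add: o_def)
  have "proots (char_poly (mat_adjoint A * A)) = mset (map (\<lambda>k. of_real ((c k)\<^sup>2)) [0..<n])"
    using proots_linear_factors[of "map (\<lambda>k. of_real ((c k)\<^sup>2)) [0..<n]"] unfolding cp by (simp add: o_def)
  then have "trace_norm A = (\<Sum>x\<in>#mset (map (\<lambda>k. complex_of_real ((c k)\<^sup>2)) [0..<n]). sqrt (Re x))"
    by (simp add: trace_norm_def)
  also have "\<dots> = (\<Sum>k\<leftarrow>[0..<n]. \<bar>c k\<bar>)"
    by (simp only: mset_map[symmetric] sum_mset_sum_list map_map) (simp add: o_def)
  also have "\<dots> = (\<Sum>k<n. \<bar>c k\<bar>)" by (simp add: interv_sum_list_conv_sum_set_nat atLeast0LessThan)
  finally have "trace_norm A = (\<Sum>k<n. \<bar>c k\<bar>)" .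
  moreover have "spectral_sum n A V c" using ent by (simp add: spectral_sum_def)
  ultimately show thesis using that[OF U] by blast
qed

section \<open>Quadratic forms and traces in an eigenbasis\<close>

lemma quad_form_minus:
  assumes "A \<in> carrier_mat n n" "B \<in> carrier_mat n n"
  shows "quad_form n (A - B) v = quad_form n A v - quad_form n B v"
  using assms by (simp add: quad_form_def sum_subtractf[symmetric] algebra_simps)

lemma mat_trace_minus:
  assumes "A \<in> carrier_mat n n" "B \<in> carrier_mat n n"
  shows "mat_trace (A - B) = mat_trace A - mat_trace B"
  using assms by (simp add: mat_trace_def sum_subtractf[symmetric])

lemma mult_cnj_cmod: "cnj z * z = of_real ((cmod z)\<^sup>2)"
  by (simp add: complex_norm_square mult.commute del: of_real_power)

text \<open>The inner sum is the coordinate of w along column k of V, that is, an entry of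
  V\<dagger>w.\<close>

lemma quad_form_spectral:
  assumes "spectral_sum n A V c"
  shows "quad_form n A w = of_real (\<Sum>k<n. c k * (cmod (\<Sum>i<n. cnj (V $$ (i, k)) * w i))\<^sup>2)"
proof -
  let ?u = "\<lambda>k. \<Sum>i<n. cnj (V $$ (i, k)) * w i"
  have "quad_form n A w = (\<Sum>i<n. \<Sum>j<n. \<Sum>k<n. of_real (c k) * ((cnj (w i) * V $$ (i, k)) * (cnj (V $$ (j, k)) * w j)))"
    unfolding quad_form_def
    by (intro sum.cong refl) (simp add: spectral_sumD[OF assms] sum_distrib_left sum_distrib_right mult_ac)
  also have "\<dots> = (\<Sum>k<n. \<Sum>i<n. \<Sum>j<n. of_real (c k) * ((cnj (w i) * V $$ (i, k)) * (cnj (V $$ (j, k)) * w j)))"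
    by (subst (3) sum.swap, subst (2) sum.swap, rule refl)
  also have "\<dots> = (\<Sum>k<n. of_real (c k) * (cnj (?u k) * ?u k))"
    unfolding cnj_sum complex_cnj_mult sum_product by (simp add: sum_distrib_left mult_ac)
  also have "\<dots> = of_real (\<Sum>k<n. c k * (cmod (?u k))\<^sup>2)"
    unfolding mult_cnj_cmod by simp
  finally show ?thesis .
qed

text \<open>Parseval, obtained by reading V V\<dagger> = I as a spectral sum of the identity with
  all coefficients 1.\<close>

lemma unitary_mat_norm:
  assumes "unitary_mat n V"
  shows "(\<Sum>k<n. (cmod (\<Sum>i<n. cnj (V $$ (i, k)) * w i))\<^sup>2) = (\<Sum>i<n. (cmod (w i))\<^sup>2)"
proof -
  have "quad_form n (1\<^sub>m n) w = of_real (\<Sum>k<n. 1 * (cmod (\<Sum>i<n. cnj (V $$ (i, k)) * w i))\<^sup>2)"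
    by (intro quad_form_spectral) (simp add: spectral_sum_def unitary_mat_rows[OF assms])
  moreover have "quad_form n (1\<^sub>m n) w = (\<Sum>i<n. \<Sum>j<n. if j = i then cnj (w i) * w i else 0)"
    unfolding quad_form_def by (intro sum.cong refl) auto
  ultimately have "complex_of_real (\<Sum>k<n. (cmod (\<Sum>i<n. cnj (V $$ (i, k)) * w i))\<^sup>2) = (\<Sum>i<n. cnj (w i) * w i)"
    by simp
  also have "\<dots> = of_real (\<Sum>i<n. (cmod (w i))\<^sup>2)" unfolding mult_cnj_cmod by simp
  finally show ?thesis by (simp only: of_real_eq_iff)
qed

lemma mat_trace_spectral:
  assumes A: "A \<in> carrier_mat n n" and U: "unitary_mat n V"
    and ent: "spectral_sum n A V c"
  shows "mat_trace A = of_real (\<Sum>k<n. c k)"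
proof -
  have "mat_trace A = (\<Sum>i<n. \<Sum>k<n. of_real (c k) * (cnj (V $$ (i, k)) * V $$ (i, k)))"
    unfolding mat_trace_eq[OF A] by (intro sum.cong refl) (simp add: spectral_sumD[OF ent] mult_ac)
  also have "\<dots> = (\<Sum>k<n. of_real (c k) * (\<Sum>i<n. cnj (V $$ (i, k)) * V $$ (i, k)))"
    unfolding sum_distrib_left by (rule sum.swap)
  also have "\<dots> = of_real (\<Sum>k<n. c k)"
    unfolding of_real_sum by (intro sum.cong refl) (simp add: unitary_mat_columns[OF U])
  finally show ?thesis .
qed

lemma quad_form_column:
  assumes U: "unitary_mat n V" and l: "l < n"
    and ent: "spectral_sum n A V c"
  shows "quad_form n A (\<lambda>i. V $$ (i, l)) = of_real (c l)"
proof -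
  have "quad_form n A (\<lambda>i. V $$ (i, l)) = of_real (\<Sum>k<n. c k * (cmod (if k = l then 1 else 0))\<^sup>2)"
    unfolding quad_form_spectral[OF ent]
    by (intro arg_cong[where f = of_real] sum.cong refl) (simp add: unitary_mat_columns[OF U _ l])
  also have "(\<Sum>k<n. c k * (cmod (if k = l then 1 else 0))\<^sup>2) = (\<Sum>k<n. if k = l then c l else 0)"
    by (intro sum.cong) auto
  finally show ?thesis using l by simp
qed

text \<open>The trace can be computed in any orthonormal basis: summing over the columns first
  produces V V\<dagger> = I.\<close>

lemma sum_quad_form_columns:
  assumes A: "A \<in> carrier_mat n n" and U: "unitary_mat n V"
  shows "(\<Sum>l<n. quad_form n A (\<lambda>i. V $$ (i, l))) = mat_trace A"
proof -
  have "(\<Sum>l<n. quad_form n A (\<lambda>i. V $$ (i, l))) = (\<Sum>i<n. \<Sum>j<n. \<Sum>l<n. cnj (V $$ (i, l)) * A $$ (i, j) * V $$ (j, l))"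
    unfolding quad_form_def by (subst sum.swap, rule sum.cong[OF refl], rule sum.swap)
  also have "\<dots> = (\<Sum>i<n. \<Sum>j<n. A $$ (i, j) * (\<Sum>l<n. V $$ (j, l) * cnj (V $$ (i, l))))"
    by (simp add: sum_distrib_left mult_ac)
  also have "\<dots> = (\<Sum>i<n. \<Sum>j<n. if j = i then A $$ (i, i) else 0)"
    by (intro sum.cong refl) (simp add: unitary_mat_rows[OF U])
  finally show ?thesis by (simp add: mat_trace_eq[OF A])
qed

section \<open>Differences of density matrices\<close>

lemma density_matD:
  assumes "density_mat n \<rho>"
  shows "\<rho> \<in> carrier_mat n n" "mat_adjoint \<rho> = \<rho>" "0 \<le> quad_form n \<rho> v" "mat_trace \<rho> = 1"
  using assms by (auto simp: density_mat_def psd_mat_iff)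

lemma density_diff_spectral:
  assumes d1: "density_mat n \<rho>1" and d2: "density_mat n \<rho>2"
  obtains V and c :: "nat \<Rightarrow> real" where "unitary_mat n V"
    "spectral_sum n (\<rho>1 - \<rho>2) V c"
    "trace_norm (\<rho>1 - \<rho>2) = (\<Sum>k<n. \<bar>c k\<bar>)" "(\<Sum>k<n. c k) = 0"
proof -
  note D1 = density_matD[OF d1] and D2 = density_matD[OF d2]
  have c: "\<rho>1 - \<rho>2 \<in> carrier_mat n n" using D1 D2 by auto
  have "mat_adjoint (\<rho>1 - \<rho>2) = \<rho>1 - \<rho>2"
  proof (rule mat_adjoint_eqI[OF c])
    fix i j assume ij: "i < n" "j < n"
    show "(\<rho>1 - \<rho>2) $$ (i, j) = cnj ((\<rho>1 - \<rho>2) $$ (j, i))"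
      using mat_adjoint_eqD[OF D1(2,1) ij] mat_adjoint_eqD[OF D2(2,1) ij] D1(1) D2(1) ij by simp
  qed
  from hermitian_spectral[OF c this] obtain V and c :: "nat \<Rightarrow> real" where U: "unitary_mat n V"
    and ent: "spectral_sum n (\<rho>1 - \<rho>2) V c"
    and tn: "trace_norm (\<rho>1 - \<rho>2) = (\<Sum>k<n. \<bar>c k\<bar>)" by blast
  have "complex_of_real (\<Sum>k<n. c k) = mat_trace (\<rho>1 - \<rho>2)"
    by (rule mat_trace_spectral[OF _ U ent, symmetric]) (use D1 D2 in auto)
  also have "\<dots> = 0" using D1 D2 by (simp add: mat_trace_minus[of _ n])
  finally have "(\<Sum>k<n. c k) = 0" by (simp only: of_real_eq_0_iff)
  then show thesis using that[OF U ent tn] by blast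
qed

text \<open>In the eigenbasis of the difference, \<open>c l\<close> is a difference of two
  nonnegative diagonal entries, hence bounded by their sum; each state then contributes its trace 1.
  This keeps the supremum in \<open>diamond_norm\<close> finite.\<close>

lemma trace_norm_density_diff_le:
  assumes d1: "density_mat n \<rho>1" and d2: "density_mat n \<rho>2"
  shows "trace_norm (\<rho>1 - \<rho>2) \<le> 2"
proof -
  note D1 = density_matD[OF d1] and D2 = density_matD[OF d2]
  obtain V and c :: "nat \<Rightarrow> real" where U: "unitary_mat n V"
    and ent: "spectral_sum n (\<rho>1 - \<rho>2) V c"
    and tn: "trace_norm (\<rho>1 - \<rho>2) = (\<Sum>k<n. \<bar>c k\<bar>)" using density_diff_spectral[OF d1 d2] by blast
  let ?q = "\<lambda>\<rho> l. Re (quad_form n \<rho> (\<lambda>i. V $$ (i, l)))"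
  have "\<bar>c l\<bar> \<le> ?q \<rho>1 l + ?q \<rho>2 l" if "l < n" for l
  proof -
    have "c l = Re (quad_form n (\<rho>1 - \<rho>2) (\<lambda>i. V $$ (i, l)))"
      using quad_form_column[OF U that ent] by simp
    then have "c l = ?q \<rho>1 l - ?q \<rho>2 l" using D1 D2 by (simp add: quad_form_minus)
    moreover have "?q \<rho>1 l \<ge> 0" "?q \<rho>2 l \<ge> 0" using D1(3) D2(3) by (simp_all add: less_eq_complex_def)
    ultimately show ?thesis by linarith
  qed
  then have "trace_norm (\<rho>1 - \<rho>2) \<le> (\<Sum>l<n. ?q \<rho>1 l + ?q \<rho>2 l)"
    unfolding tn by (intro sum_mono) auto
  also have "\<dots> = Re (\<Sum>l<n. quad_form n \<rho>1 (\<lambda>i. V $$ (i, l))) + Re (\<Sum>l<n. quad_form n \<rho>2 (\<lambda>i. V $$ (i, l)))"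
    by (simp add: sum.distrib)
  also have "\<dots> = 2" unfolding sum_quad_form_columns[OF D1(1) U] sum_quad_form_columns[OF D2(1) U] using D1 D2 by simp
  finally show ?thesis .
qed

lemma density_quad_form_diff_le:
  assumes d1: "density_mat n \<rho>1" and d2: "density_mat n \<rho>2" and w: "(\<Sum>i<n. (cmod (w i))\<^sup>2) = 1"
  shows "\<bar>Re (quad_form n \<rho>1 w) - Re (quad_form n \<rho>2 w)\<bar> \<le> 1/2 * trace_norm (\<rho>1 - \<rho>2)"
proof -
  note D1 = density_matD[OF d1] and D2 = density_matD[OF d2]
  obtain V and c :: "nat \<Rightarrow> real" where U: "unitary_mat n V"
    and ent: "spectral_sum n (\<rho>1 - \<rho>2) V c"
    and tn: "trace_norm (\<rho>1 - \<rho>2) = (\<Sum>k<n. \<bar>c k\<bar>)" and c0: "(\<Sum>k<n. c k) = 0"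
    using density_diff_spectral[OF d1 d2] by blast
  \<comment> \<open>The squared overlap of w with eigenvector k. By Parseval these weights form a
    probability distribution.\<close>
  define p where "p k = (cmod (\<Sum>i<n. cnj (V $$ (i, k)) * w i))\<^sup>2" for k
  have p_sum: "(\<Sum>k<n. p k) = 1" unfolding p_def unitary_mat_norm[OF U] w ..
  have p0: "0 \<le> p k" for k by (simp add: p_def)
  have p1: "p k \<le> 1" if "k < n" for k
    using member_le_sum[of k "{..<n}" p] p0 that p_sum by simp
  have "Re (quad_form n \<rho>1 w) - Re (quad_form n \<rho>2 w) = Re (quad_form n (\<rho>1 - \<rho>2) w)"
    by (simp add: quad_form_minus[OF D1(1) D2(1)])
  also have "\<dots> = (\<Sum>k<n. c k * p k)"
    unfolding quad_form_spectral[OF ent] p_def by (rule Re_complex_of_real)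
  finally have q: "Re (quad_form n \<rho>1 w) - Re (quad_form n \<rho>2 w) = (\<Sum>k<n. c k * p k)" .
  have "\<bar>\<Sum>k<n. c k * (p k - 1/2)\<bar> \<le> (\<Sum>k<n. 1/2 * \<bar>c k\<bar>)"
  proof (rule order_trans[OF sum_abs], rule sum_mono)
    fix k assume "k \<in> {..<n}"
    then have "\<bar>p k - 1/2\<bar> \<le> 1/2" using p0[of k] p1[of k] unfolding abs_le_iff by auto
    then show "\<bar>c k * (p k - 1/2)\<bar> \<le> 1/2 * \<bar>c k\<bar>"
      unfolding abs_mult by (metis abs_ge_zero mult.commute mult_left_mono)
  qed
  \<comment> \<open>The \<open>c k\<close> sum to zero, so the shift by 1/2 costs nothing; it halves
    the bound that 0 \<le> p k \<le> 1 alone would give.\<close>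
  moreover have "(\<Sum>k<n. c k * (p k - 1/2)) = (\<Sum>k<n. c k * p k)"
    using c0 by (simp add: right_diff_distrib sum_subtractf sum_divide_distrib[symmetric])
  ultimately show ?thesis unfolding q tn by (simp add: sum_distrib_left)
qed

section \<open>Tensor products of operator maps\<close>

lemma tensor_index_less:
  assumes "i < m" "k < (n::nat)" shows "i * n + k < m * n"
proof -
  have "i * n + k < Suc i * n" using assms by simp
  also have "\<dots> \<le> m * n" using assms by (intro mult_right_mono) auto
  finally show ?thesis .
qed

lemma tensor_index_div: "k < (n::nat) \<Longrightarrow> (i * n + k) div n = i"
  and tensor_index_mod: "k < (n::nat) \<Longrightarrow> (i * n + k) mod n = k"
  by auto

lemma tensor_index_cases:
  assumes "p < m * (n::nat)"
  obtains i k where "i < m" "k < n" "p = i * n + k"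
proof (rule that[of "p div n" "p mod n"])
  show "p div n < m" using assms by (simp add: less_mult_imp_div_less)
  have "n > 0" using assms by (cases n) auto
  then show "p mod n < n" by simp
qed simp

lemma tensor_index_eq:
  "k < (n::nat) \<Longrightarrow> l < n \<Longrightarrow> i * n + k = j * n + l \<longleftrightarrow> i = j \<and> k = l"
  by (metis tensor_index_div tensor_index_mod)

lemma sum_tensor_index:
  fixes f :: "nat \<Rightarrow> 'a :: comm_monoid_add"
  shows "(\<Sum>p<m * n. f p) = (\<Sum>i<m. \<Sum>k<n. f (i * n + k))"
proof -
  have "sum f {i * n..<i * n + n} = (\<Sum>k<n. f (i * n + k))" for i
    using sum.shift_bounds_nat_ivl[of f 0 "i * n" n] by (simp add: atLeast0LessThan add.commute)
  then show ?thesis using sum.nat_group[of f n m] by simp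
qed

lemma eq_mat_tensorI:
  assumes "A \<in> carrier_mat (m * n) (m * n)" "B \<in> carrier_mat (m * n) (m * n)"
    and "\<And>i j k l. i < m \<Longrightarrow> j < m \<Longrightarrow> k < n \<Longrightarrow> l < n \<Longrightarrow>
       A $$ (i * n + k, j * n + l) = B $$ (i * n + k, j * n + l)"
  shows "A = B"
proof (rule eq_matI)
  fix p q assume "p < dim_row B" "q < dim_col B"
  then have "p < m * n" "q < m * n" using assms(2) by auto
  then show "A $$ (p, q) = B $$ (p, q)" by (elim tensor_index_cases) (simp add: assms(3))
qed (use assms in auto)

section \<open>Matrix units and the entries of tensor maps\<close>

abbreviation mat_unit :: "nat \<Rightarrow> nat \<Rightarrow> nat \<Rightarrow> complex mat" where
  "mat_unit m i j \<equiv> ketbra (unit_vec m i) (unit_vec m j)"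

lemma mat_unit_carrier [simp]: "mat_unit m i j \<in> carrier_mat m m"
  by (simp add: ketbra_def)

lemma mat_unit_index [simp]:
  "a < m \<Longrightarrow> b < m \<Longrightarrow> i < m \<Longrightarrow> j < m \<Longrightarrow> mat_unit m i j $$ (a, b) = (if a = i \<and> b = j then 1 else 0)"
  by (simp add: ketbra_def)

text \<open>\<open>tensor_map\<close> evaluates its arguments only at matrix units, so its entry
  formulas just need the dimensions of the outputs. Linearity enters later, through
  \<open>operator_linear\<close>.\<close>

definition operator_map :: "nat \<Rightarrow> nat \<Rightarrow> (complex mat \<Rightarrow> complex mat) \<Rightarrow> bool" where
  "operator_map m n E \<longleftrightarrow> (\<forall>A\<in>carrier_mat m m. E A \<in> carrier_mat n n)"

lemma operator_mapD: "operator_map m n E \<Longrightarrow> A \<in> carrier_mat m m \<Longrightarrow> E A \<in> carrier_mat n n"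
  by (simp add: operator_map_def)

lemma operator_map_id: "operator_map m m (\<lambda>K. K)"
  by (simp add: operator_map_def)

lemma tensor_map_carrier [simp]: "tensor_map m1 n1 m2 n2 E F K \<in> carrier_mat (n1 * n2) (n1 * n2)"
  by (simp add: tensor_map_def mat_sum_def)

lemma tensor_map_index:
  assumes E: "operator_map m1 n1 E" and F: "operator_map m2 n2 F"
    and ab: "a < n1" "a' < n1" "b < n2" "b' < n2"
  shows "tensor_map m1 n1 m2 n2 E F K $$ (a * n2 + b, a' * n2 + b') =
    (\<Sum>i<m1. \<Sum>j<m1. \<Sum>k<m2. \<Sum>l<m2. K $$ (i * m2 + k, j * m2 + l) *
       (E (mat_unit m1 i j) $$ (a, a') * F (mat_unit m2 k l) $$ (b, b')))"
proof -
  have c: "E (mat_unit m1 i j) \<in> carrier_mat n1 n1" "F (mat_unit m2 k l) \<in> carrier_mat n2 n2" for i j k l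
    using operator_mapD[OF E] operator_mapD[OF F] by auto
  have d: "dim_row (E (mat_unit m1 i j)) = n1" "dim_col (E (mat_unit m1 i j)) = n1"
    "dim_row (F (mat_unit m2 k l)) = n2" "dim_col (F (mat_unit m2 k l)) = n2" for i j k l
    using c(1)[of i j] c(2)[of k l] by auto
  show ?thesis
    unfolding tensor_map_def mat_sum_def
    using ab tensor_index_less[of a n1 b n2] tensor_index_less[of a' n1 b' n2]
    by (simp add: sum.cartesian_product split_beta kron_def d tensor_index_div tensor_index_mod)
qed

lemma sum_mat_unit:
  fixes f :: "nat \<Rightarrow> nat \<Rightarrow> complex"
  assumes "a < m" "b < m"
  shows "(\<Sum>i<m. \<Sum>j<m. f i j * mat_unit m i j $$ (a, b)) = f a b"
proof -
  have "(\<Sum>i<m. \<Sum>j<m. f i j * mat_unit m i j $$ (a, b)) = (\<Sum>i<m. \<Sum>j<m. if i = a then (if j = b then f a b else 0) else 0)"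
    using assms by (intro sum.cong refl) auto
  also have "\<dots> = (\<Sum>i<m. if i = a then f a b else 0)"
    using assms by (intro sum.cong refl) auto
  finally show ?thesis using assms by simp
qed

lemma tensor_map_id_left_index:
  assumes F: "operator_map m n F" and ab: "a < r" "a' < r" "b < n" "b' < n"
  shows "tensor_map r r m n (\<lambda>K. K) F K $$ (a * n + b, a' * n + b') =
    (\<Sum>k<m. \<Sum>l<m. K $$ (a * m + k, a' * m + l) * F (mat_unit m k l) $$ (b, b'))"
proof -
  have "tensor_map r r m n (\<lambda>K. K) F K $$ (a * n + b, a' * n + b') =
    (\<Sum>i<r. \<Sum>j<r. (\<Sum>k<m. \<Sum>l<m. K $$ (i * m + k, j * m + l) * F (mat_unit m k l) $$ (b, b')) * mat_unit r i j $$ (a, a'))"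
    unfolding tensor_map_index[OF operator_map_id F ab] sum_distrib_right
    by (simp add: mult_ac)
  then show ?thesis unfolding sum_mat_unit[OF ab(1,2)] .
qed

lemma tensor_map_id_right_index:
  assumes E: "operator_map m n E" and ab: "a < n" "a' < n" "b < r" "b' < r"
  shows "tensor_map m n r r E (\<lambda>K. K) K $$ (a * r + b, a' * r + b') =
    (\<Sum>i<m. \<Sum>j<m. K $$ (i * r + b, j * r + b') * E (mat_unit m i j) $$ (a, a'))"
  unfolding tensor_map_index[OF E operator_map_id ab]
proof (intro sum.cong[OF refl])
  fix i j
  have "(\<Sum>k<r. \<Sum>l<r. K $$ (i * r + k, j * r + l) * (E (mat_unit m i j) $$ (a, a') * mat_unit r k l $$ (b, b')))
     = (\<Sum>k<r. \<Sum>l<r. (K $$ (i * r + k, j * r + l) * E (mat_unit m i j) $$ (a, a')) * mat_unit r k l $$ (b, b'))"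
    by (simp only: mult.assoc)
  also have "\<dots> = K $$ (i * r + b, j * r + b') * E (mat_unit m i j) $$ (a, a')"
    by (rule sum_mat_unit[OF ab(3,4)])
  finally show "(\<Sum>k<r. \<Sum>l<r. K $$ (i * r + k, j * r + l) * (E (mat_unit m i j) $$ (a, a') * mat_unit r k l $$ (b, b')))
     = K $$ (i * r + b, j * r + b') * E (mat_unit m i j) $$ (a, a')" .
qed

text \<open>Together with \<open>tensor_map_right_left\<close> this expresses that operations on
  different registers commute: both orders collapse to the same \<open>tensor_map\<close>. It is
  used to move the ideal first encoder in front of the second encoder.\<close>

lemma tensor_map_left_right:
  assumes E: "operator_map m1 n1 E" and F: "operator_map m2 n2 F"
  shows "tensor_map m1 n1 n2 n2 E (\<lambda>K. K) (tensor_map m1 m1 m2 n2 (\<lambda>K. K) F K) = tensor_map m1 n1 m2 n2 E F K"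
proof (rule eq_mat_tensorI[of _ n1 n2])
  fix a a' b b' assume ab: "a < n1" "a' < n1" "b < n2" "b' < n2"
  have "tensor_map m1 n1 n2 n2 E (\<lambda>K. K) (tensor_map m1 m1 m2 n2 (\<lambda>K. K) F K) $$ (a * n2 + b, a' * n2 + b') =
    (\<Sum>i<m1. \<Sum>j<m1. (\<Sum>k<m2. \<Sum>l<m2. K $$ (i * m2 + k, j * m2 + l) * F (mat_unit m2 k l) $$ (b, b')) * E (mat_unit m1 i j) $$ (a, a'))"
    unfolding tensor_map_id_right_index[OF E ab]
    by (intro sum.cong refl arg_cong2[of _ _ _ _ "(*)"] tensor_map_id_left_index[OF F] ab) auto
  also have "\<dots> = tensor_map m1 n1 m2 n2 E F K $$ (a * n2 + b, a' * n2 + b')"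
    unfolding tensor_map_index[OF E F ab] sum_distrib_right by (simp add: mult_ac)
  finally show "tensor_map m1 n1 n2 n2 E (\<lambda>K. K) (tensor_map m1 m1 m2 n2 (\<lambda>K. K) F K) $$ (a * n2 + b, a' * n2 + b')
    = tensor_map m1 n1 m2 n2 E F K $$ (a * n2 + b, a' * n2 + b')" .
qed auto

lemma tensor_map_right_left:
  assumes E: "operator_map m1 n1 E" and F: "operator_map m2 n2 F"
  shows "tensor_map n1 n1 m2 n2 (\<lambda>K. K) F (tensor_map m1 n1 m2 m2 E (\<lambda>K. K) K) = tensor_map m1 n1 m2 n2 E F K"
proof (rule eq_mat_tensorI[of _ n1 n2])
  fix a a' b b' assume ab: "a < n1" "a' < n1" "b < n2" "b' < n2"
  have "tensor_map n1 n1 m2 n2 (\<lambda>K. K) F (tensor_map m1 n1 m2 m2 E (\<lambda>K. K) K) $$ (a * n2 + b, a' * n2 + b') =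
    (\<Sum>k<m2. \<Sum>l<m2. (\<Sum>i<m1. \<Sum>j<m1. K $$ (i * m2 + k, j * m2 + l) * E (mat_unit m1 i j) $$ (a, a')) * F (mat_unit m2 k l) $$ (b, b'))"
    unfolding tensor_map_id_left_index[OF F ab]
    by (intro sum.cong refl arg_cong2[of _ _ _ _ "(*)"] tensor_map_id_right_index[OF E] ab) auto
  also have "\<dots> = (\<Sum>(k, l)\<in>{..<m2} \<times> {..<m2}. \<Sum>(i, j)\<in>{..<m1} \<times> {..<m1}. K $$ (i * m2 + k, j * m2 + l) *
       (E (mat_unit m1 i j) $$ (a, a') * F (mat_unit m2 k l) $$ (b, b')))"
    unfolding sum_distrib_right sum.cartesian_product[symmetric] by (simp add: mult_ac)
  also have "\<dots> = (\<Sum>(i, j)\<in>{..<m1} \<times> {..<m1}. \<Sum>(k, l)\<in>{..<m2} \<times> {..<m2}. K $$ (i * m2 + k, j * m2 + l) *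
       (E (mat_unit m1 i j) $$ (a, a') * F (mat_unit m2 k l) $$ (b, b')))"
    unfolding split_beta by (rule sum.swap)
  also have "\<dots> = tensor_map m1 n1 m2 n2 E F K $$ (a * n2 + b, a' * n2 + b')"
    unfolding tensor_map_index[OF E F ab] sum.cartesian_product[symmetric] by simp
  finally show "tensor_map n1 n1 m2 n2 (\<lambda>K. K) F (tensor_map m1 n1 m2 m2 E (\<lambda>K. K) K) $$ (a * n2 + b, a' * n2 + b')
    = tensor_map m1 n1 m2 n2 E F K $$ (a * n2 + b, a' * n2 + b')" .
qed auto

section \<open>Exchanging the tensor factors: conjugation by \<open>swap_mat m n\<close>,
  entrywise\<close>

definition swap_factors :: "nat \<Rightarrow> nat \<Rightarrow> complex mat \<Rightarrow> complex mat" where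
  "swap_factors m n K = mat (n * m) (n * m)
     (\<lambda>(p, q). K $$ (p mod m * n + p div m, q mod m * n + q div m))"

lemma swap_factors_carrier [simp]: "swap_factors m n K \<in> carrier_mat (n * m) (n * m)"
  by (simp add: swap_factors_def)

lemma swap_factors_index [simp]:
  assumes "i < m" "j < m" "k < n" "l < n"
  shows "swap_factors m n K $$ (k * m + i, l * m + j) = K $$ (i * n + k, j * n + l)"
  using assms tensor_index_less[of k n i m] tensor_index_less[of l n j m]
  by (simp add: swap_factors_def tensor_index_div tensor_index_mod)

text \<open>The diamond norm has its reference system on the left, so a map on the left factor is
  flipped to the right. The outer flip later disappears into the test vector by
  \<open>quad_form_swap_factors\<close>.\<close>

lemma tensor_map_swap:
  assumes E: "operator_map m n E"
  shows "tensor_map m n r r E (\<lambda>K. K) K = swap_factors r n (tensor_map r r m n (\<lambda>K. K) E (swap_factors m r K))"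
proof (rule eq_mat_tensorI[of _ n r])
  fix a a' b b' assume ab: "a < n" "a' < n" "b < r" "b' < r"
  have "(\<Sum>i<m. \<Sum>j<m. K $$ (i * r + b, j * r + b') * E (mat_unit m i j) $$ (a, a'))
    = (\<Sum>i<m. \<Sum>j<m. swap_factors m r K $$ (b * m + i, b' * m + j) * E (mat_unit m i j) $$ (a, a'))"
    using ab by (intro sum.cong refl) simp
  then show "tensor_map m n r r E (\<lambda>K. K) K $$ (a * r + b, a' * r + b') =
    swap_factors r n (tensor_map r r m n (\<lambda>K. K) E (swap_factors m r K)) $$ (a * r + b, a' * r + b')"
    using ab by (simp add: tensor_map_id_right_index[OF E] tensor_map_id_left_index[OF E])
qed auto

lemma quad_form_tensor:
  "quad_form (m * n) A v =
    (\<Sum>i<m. \<Sum>k<n. \<Sum>j<m. \<Sum>l<n. cnj (v (i * n + k)) * A $$ (i * n + k, j * n + l) * v (j * n + l))"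
  unfolding quad_form_def sum_tensor_index ..

lemma quad_form_swap_factors:
  "quad_form (n * m) (swap_factors m n K) w = quad_form (m * n) K (\<lambda>p. w (p mod n * m + p div n))"
proof -
  have "quad_form (n * m) (swap_factors m n K) w =
    (\<Sum>k<n. \<Sum>i<m. \<Sum>l<n. \<Sum>j<m. cnj (w (k * m + i)) * K $$ (i * n + k, j * n + l) * w (l * m + j))"
    unfolding quad_form_tensor by (intro sum.cong refl) simp
  also have "\<dots> = (\<Sum>i<m. \<Sum>k<n. \<Sum>j<m. \<Sum>l<n. cnj (w (k * m + i)) * K $$ (i * n + k, j * n + l) * w (l * m + j))"
    by (subst sum.swap, rule sum.cong[OF refl], rule sum.cong[OF refl], rule sum.swap)
  also have "\<dots> = quad_form (m * n) K (\<lambda>p. w (p mod n * m + p div n))"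
    unfolding quad_form_tensor by (intro sum.cong refl) (simp add: tensor_index_div tensor_index_mod)
  finally show ?thesis .
qed

lemma mat_trace_tensor:
  "A \<in> carrier_mat (m * n) (m * n) \<Longrightarrow> mat_trace A = (\<Sum>i<m. \<Sum>k<n. A $$ (i * n + k, i * n + k))"
  by (simp add: mat_trace_eq sum_tensor_index)

lemma density_swap_factors:
  assumes "density_mat (m * n) K"
  shows "density_mat (n * m) (swap_factors m n K)"
proof -
  note D = density_matD[OF assms]
  have "mat_adjoint (swap_factors m n K) = swap_factors m n K"
  proof (rule mat_adjoint_eqI)
    fix p q assume "p < n * m" "q < n * m"
    then show "swap_factors m n K $$ (p, q) = cnj (swap_factors m n K $$ (q, p))"
      by (elim tensor_index_cases)
        (simp add: mat_adjoint_eqD[OF D(2,1), symmetric] tensor_index_less)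
  qed simp
  moreover have "mat_trace (swap_factors m n K) = 1"
  proof -
    have "mat_trace (swap_factors m n K) = (\<Sum>k<n. \<Sum>i<m. K $$ (i * n + k, i * n + k))"
      by (simp add: mat_trace_tensor[of _ n m])
    also have "\<dots> = mat_trace K" unfolding mat_trace_tensor[OF D(1)] by (rule sum.swap)
    finally show ?thesis using D(4) by simp
  qed
  ultimately show ?thesis using D(3) by (simp add: density_mat_def psd_mat_iff quad_form_swap_factors)
qed

section \<open>Channels and the diamond norm\<close>

lemmas tensor_map_dim [simp] = carrier_matD[OF tensor_map_carrier]

definition operator_linear :: "nat \<Rightarrow> nat \<Rightarrow> (complex mat \<Rightarrow> complex mat) \<Rightarrow> bool" where
  "operator_linear m n E \<longleftrightarrow> operator_map m n E \<and>
     (\<forall>A\<in>carrier_mat m m. \<forall>B\<in>carrier_mat m m. E (A + B) = E A + E B) \<and>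
     (\<forall>c. \<forall>A\<in>carrier_mat m m. E (c \<cdot>\<^sub>m A) = c \<cdot>\<^sub>m E A)"

lemma quantum_channel_linear: "quantum_channel m n E \<Longrightarrow> operator_linear m n E"
  by (simp add: quantum_channel_def operator_linear_def operator_map_def)

lemma operator_linear_map: "operator_linear m n E \<Longrightarrow> operator_map m n E"
  by (simp add: operator_linear_def)

lemmas quantum_channel_map = operator_linear_map[OF quantum_channel_linear]

text \<open>The entries of K are switched on one at a time, each step adding a multiple of a matrix
  unit. This reconciles E with \<open>tensor_map\<close>, which sees E only on matrix units.\<close>

lemma operator_linear_expand:
  assumes E: "operator_linear m n E" and K: "K \<in> carrier_mat m m" and ab: "a < n" "b < n"
  shows "E K $$ (a, b) = (\<Sum>k<m. \<Sum>l<m. K $$ (k, l) * E (mat_unit m k l) $$ (a, b))"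
proof -
  note mp = operator_mapD[OF operator_linear_map[OF E]]
  have add: "E (A + B) = E A + E B" if "A \<in> carrier_mat m m" "B \<in> carrier_mat m m" for A B
    using E that by (simp add: operator_linear_def)
  have sm: "E (c \<cdot>\<^sub>m A) = c \<cdot>\<^sub>m E A" if "A \<in> carrier_mat m m" for c A
    using E that by (simp add: operator_linear_def)
  have "E (mat m m (\<lambda>p. if p \<in> S then K $$ p else 0)) $$ (a, b) = (\<Sum>(k, l)\<in>S. K $$ (k, l) * E (mat_unit m k l) $$ (a, b))"
    if "finite S" "S \<subseteq> {..<m} \<times> {..<m}" for S
    using that
  proof (induction S rule: finite_induct)
    case empty
    \<comment> \<open>The zero matrix is written as 0 times itself, so that homogeneity makes its
      image zero.\<close>
    have "mat m m (\<lambda>p. if p \<in> {} then K $$ p else 0) = 0 \<cdot>\<^sub>m (0\<^sub>m m m :: complex mat)" by (rule eq_matI) auto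
    then have "E (mat m m (\<lambda>p. if p \<in> {} then K $$ p else 0)) = 0 \<cdot>\<^sub>m E (0\<^sub>m m m)"
      by (simp only: sm[OF zero_carrier_mat])
    then show ?case using mp[of "0\<^sub>m m m"] ab by auto
  next
    case (insert p S)
    obtain k l where p: "p = (k, l)" "k < m" "l < m" using insert.prems by auto
    let ?KS = "mat m m (\<lambda>p. if p \<in> S then K $$ p else 0)"
    have "mat m m (\<lambda>q. if q \<in> insert p S then K $$ q else 0) = ?KS + K $$ p \<cdot>\<^sub>m mat_unit m k l"
      using p insert.hyps by (intro eq_matI) (auto simp: ketbra_def)
    then have "E (mat m m (\<lambda>q. if q \<in> insert p S then K $$ q else 0)) = E ?KS + K $$ p \<cdot>\<^sub>m E (mat_unit m k l)"
      by (simp add: add sm)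
    moreover have "E ?KS \<in> carrier_mat n n" "E (mat_unit m k l) \<in> carrier_mat n n" by (auto intro: mp)
    ultimately show ?case using insert ab p by simp
  qed
  from this[of "{..<m} \<times> {..<m}"]
  have "E (mat m m (\<lambda>p. if p \<in> {..<m} \<times> {..<m} then K $$ p else 0)) $$ (a, b)
    = (\<Sum>k<m. \<Sum>l<m. K $$ (k, l) * E (mat_unit m k l) $$ (a, b))"
    by (simp add: sum.cartesian_product)
  moreover have "mat m m (\<lambda>p. if p \<in> {..<m} \<times> {..<m} then K $$ p else 0) = K"
    using K by (intro eq_matI) auto
  ultimately show ?thesis by simp
qed

lemma operator_linear_tensor_map:
  assumes E: "operator_map m1 n1 E" and F: "operator_map m2 n2 F"
  shows "operator_linear (m1 * m2) (n1 * n2) (tensor_map m1 n1 m2 n2 E F)"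
  unfolding operator_linear_def
proof (intro conjI ballI allI)
  show "operator_map (m1 * m2) (n1 * n2) (tensor_map m1 n1 m2 n2 E F)" by (simp add: operator_map_def)
next
  fix A B :: "complex mat" assume AB: "A \<in> carrier_mat (m1 * m2) (m1 * m2)" "B \<in> carrier_mat (m1 * m2) (m1 * m2)"
  show "tensor_map m1 n1 m2 n2 E F (A + B) = tensor_map m1 n1 m2 n2 E F A + tensor_map m1 n1 m2 n2 E F B"
  proof (rule eq_mat_tensorI[of _ n1 n2])
    fix a a' b b' assume ab: "a < n1" "a' < n1" "b < n2" "b' < n2"
    have "(tensor_map m1 n1 m2 n2 E F A + tensor_map m1 n1 m2 n2 E F B) $$ (a * n2 + b, a' * n2 + b')
      = tensor_map m1 n1 m2 n2 E F A $$ (a * n2 + b, a' * n2 + b') + tensor_map m1 n1 m2 n2 E F B $$ (a * n2 + b, a' * n2 + b')"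
      using ab tensor_index_less[of a n1 b n2] tensor_index_less[of a' n1 b' n2]
      by (intro index_add_mat) auto
    moreover have "tensor_map m1 n1 m2 n2 E F (A + B) $$ (a * n2 + b, a' * n2 + b')
      = tensor_map m1 n1 m2 n2 E F A $$ (a * n2 + b, a' * n2 + b') + tensor_map m1 n1 m2 n2 E F B $$ (a * n2 + b, a' * n2 + b')"
      unfolding tensor_map_index[OF E F ab] sum.distrib[symmetric]
      using AB by (intro sum.cong refl) (simp add: tensor_index_less distrib_right)
    ultimately show "tensor_map m1 n1 m2 n2 E F (A + B) $$ (a * n2 + b, a' * n2 + b')
      = (tensor_map m1 n1 m2 n2 E F A + tensor_map m1 n1 m2 n2 E F B) $$ (a * n2 + b, a' * n2 + b')" by simp
  qed auto
next
  fix c :: complex and A :: "complex mat" assume A: "A \<in> carrier_mat (m1 * m2) (m1 * m2)"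
  show "tensor_map m1 n1 m2 n2 E F (c \<cdot>\<^sub>m A) = c \<cdot>\<^sub>m tensor_map m1 n1 m2 n2 E F A"
  proof (rule eq_mat_tensorI[of _ n1 n2])
    fix a a' b b' assume ab: "a < n1" "a' < n1" "b < n2" "b' < n2"
    have "(c \<cdot>\<^sub>m tensor_map m1 n1 m2 n2 E F A) $$ (a * n2 + b, a' * n2 + b')
      = c * tensor_map m1 n1 m2 n2 E F A $$ (a * n2 + b, a' * n2 + b')"
      using ab tensor_index_less[of a n1 b n2] tensor_index_less[of a' n1 b' n2]
      by (intro index_smult_mat) auto
    moreover have "tensor_map m1 n1 m2 n2 E F (c \<cdot>\<^sub>m A) $$ (a * n2 + b, a' * n2 + b')
      = c * tensor_map m1 n1 m2 n2 E F A $$ (a * n2 + b, a' * n2 + b')"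
      unfolding tensor_map_index[OF E F ab] sum_distrib_left
      using A by (intro sum.cong refl) (simp add: tensor_index_less mult.assoc)
    ultimately show "tensor_map m1 n1 m2 n2 E F (c \<cdot>\<^sub>m A) $$ (a * n2 + b, a' * n2 + b')
      = (c \<cdot>\<^sub>m tensor_map m1 n1 m2 n2 E F A) $$ (a * n2 + b, a' * n2 + b')" by simp
  qed auto
qed

lemma operator_linear_comp:
  assumes "operator_linear m n E" "operator_linear n p F"
  shows "operator_linear m p (F \<circ> E)"
  using assms by (simp add: operator_linear_def operator_map_def)

text \<open>Positivity is the clause on complete positivity. For the trace, the sum over the output
  basis moves inside, where E preserves the trace of every matrix unit, and comes back out as a sum
  over the input basis.\<close>

lemma channel_density:
  assumes E: "quantum_channel m n E" and \<rho>: "density_mat (r * m) \<rho>"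
  shows "density_mat (r * n) (tensor_map r r m n (\<lambda>K. K) E \<rho>)"
proof -
  note D = density_matD[OF \<rho>] and mp = operator_mapD[OF quantum_channel_map[OF E]]
  have tr: "(\<Sum>b<n. E (mat_unit m k l) $$ (b, b)) = mat_trace (mat_unit m k l)" for k l
    using E mat_trace_eq[OF mp[of "mat_unit m k l"]] by (simp add: quantum_channel_def)
  have "mat_trace (tensor_map r r m n (\<lambda>K. K) E \<rho>)
    = (\<Sum>a<r. \<Sum>b<n. \<Sum>k<m. \<Sum>l<m. \<rho> $$ (a * m + k, a * m + l) * E (mat_unit m k l) $$ (b, b))"
    unfolding mat_trace_tensor[OF tensor_map_carrier]
    by (intro sum.cong[OF refl]) (simp add: tensor_map_id_left_index[OF quantum_channel_map[OF E]])
  also have "\<dots> = (\<Sum>a<r. \<Sum>k<m. \<Sum>l<m. \<rho> $$ (a * m + k, a * m + l) * (\<Sum>b<n. E (mat_unit m k l) $$ (b, b)))"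
    unfolding sum_distrib_left
    by (rule sum.cong[OF refl], subst sum.swap, rule sum.cong[OF refl], rule sum.swap)
  also have "\<dots> = (\<Sum>a<r. \<Sum>k<m. \<Sum>l<m. \<rho> $$ (a * m + k, a * m + l) * (\<Sum>b<m. mat_unit m k l $$ (b, b)))"
    unfolding tr mat_trace_eq[OF mat_unit_carrier] ..
  also have "\<dots> = (\<Sum>a<r. \<Sum>b<m. \<Sum>k<m. \<Sum>l<m. \<rho> $$ (a * m + k, a * m + l) * mat_unit m k l $$ (b, b))"
    unfolding sum_distrib_left
    by (rule sym, rule sum.cong[OF refl], subst sum.swap, rule sum.cong[OF refl], rule sum.swap)
  also have "\<dots> = (\<Sum>a<r. \<Sum>b<m. \<rho> $$ (a * m + b, a * m + b))"
    by (intro sum.cong[OF refl] sum_mat_unit) auto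
  also have "\<dots> = 1" using D mat_trace_tensor[OF D(1)] by simp
  finally show ?thesis using E \<rho> by (simp add: density_mat_def quantum_channel_def)
qed

lemma tensor_map_diff:
  assumes E: "operator_map m n E" and F: "operator_map m n F"
  shows "tensor_map r r m n (\<lambda>K. K) (\<lambda>K. E K - F K) \<rho> =
    tensor_map r r m n (\<lambda>K. K) E \<rho> - tensor_map r r m n (\<lambda>K. K) F \<rho>"
proof (rule eq_mat_tensorI[of _ r n])
  have EF: "operator_map m n (\<lambda>K. E K - F K)" using F by (simp add: operator_map_def minus_carrier_mat)
  fix a a' b b' assume ab: "a < r" "a' < r" "b < n" "b' < n"
  have "(tensor_map r r m n (\<lambda>K. K) E \<rho> - tensor_map r r m n (\<lambda>K. K) F \<rho>) $$ (a * n + b, a' * n + b') =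
    tensor_map r r m n (\<lambda>K. K) E \<rho> $$ (a * n + b, a' * n + b') - tensor_map r r m n (\<lambda>K. K) F \<rho> $$ (a * n + b, a' * n + b')"
    using ab by (intro index_minus_mat) (auto simp: tensor_index_less)
  also have "\<dots> = tensor_map r r m n (\<lambda>K. K) (\<lambda>K. E K - F K) \<rho> $$ (a * n + b, a' * n + b')"
    unfolding tensor_map_id_left_index[OF E ab] tensor_map_id_left_index[OF F ab] tensor_map_id_left_index[OF EF ab]
      sum_subtractf[symmetric]
    using operator_mapD[OF F] ab by (intro sum.cong refl) (simp add: right_diff_distrib carrier_matD[OF operator_mapD[OF F]])
  finally show "tensor_map r r m n (\<lambda>K. K) (\<lambda>K. E K - F K) \<rho> $$ (a * n + b, a' * n + b') =
    (tensor_map r r m n (\<lambda>K. K) E \<rho> - tensor_map r r m n (\<lambda>K. K) F \<rho>) $$ (a * n + b, a' * n + b')" by simp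
qed (auto intro!: minus_carrier_mat)

lemma trace_norm_le_diamond_norm:
  assumes E: "quantum_channel m n E" and F: "quantum_channel m n F" and \<rho>: "density_mat (r * m) \<rho>"
  shows "trace_norm (tensor_map r r m n (\<lambda>K. K) E \<rho> - tensor_map r r m n (\<lambda>K. K) F \<rho>)
    \<le> diamond_norm m n (\<lambda>K. E K - F K)"
proof -
  note tm = tensor_map_diff[OF quantum_channel_map[OF E] quantum_channel_map[OF F]]
  have "bdd_above ((\<lambda>(r, \<rho>). trace_norm (tensor_map r r m n (\<lambda>K. K) (\<lambda>K. E K - F K) \<rho>)) ` {(r, \<rho>). density_mat (r * m) \<rho>})"
    unfolding tm by (intro bdd_aboveI[of _ 2])
      (auto intro!: trace_norm_density_diff_le channel_density[OF E] channel_density[OF F])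
  then have "(\<lambda>(r, \<rho>). trace_norm (tensor_map r r m n (\<lambda>K. K) (\<lambda>K. E K - F K) \<rho>)) (r, \<rho>) \<le> diamond_norm m n (\<lambda>K. E K - F K)"
    unfolding diamond_norm_def using \<rho> by (intro cSUP_upper) auto
  then show ?thesis by (simp add: tm)
qed

text \<open>The untouched left register, of dimension r, serves as the reference system of the
  diamond norm.\<close>

lemma channel_replace_right:
  assumes E: "quantum_channel m n E" and F: "quantum_channel m n F" and \<rho>: "density_mat (r * m) \<rho>"
    and w: "(\<Sum>i<r * n. (cmod (w i))\<^sup>2) = 1"
  shows "Re (quad_form (r * n) (tensor_map r r m n (\<lambda>K. K) F \<rho>) w) - 1/2 * diamond_norm m n (\<lambda>K. E K - F K)
    \<le> Re (quad_form (r * n) (tensor_map r r m n (\<lambda>K. K) E \<rho>) w)"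
  using density_quad_form_diff_le[OF channel_density[OF E \<rho>] channel_density[OF F \<rho>] w]
    trace_norm_le_diamond_norm[OF E F \<rho>] by linarith

lemma channel_replace_left:
  assumes E: "quantum_channel m n E" and F: "quantum_channel m n F" and \<rho>: "density_mat (m * r) \<rho>"
    and w: "(\<Sum>i<n * r. (cmod (w i))\<^sup>2) = 1"
  shows "Re (quad_form (n * r) (tensor_map m n r r F (\<lambda>K. K) \<rho>) w) - 1/2 * diamond_norm m n (\<lambda>K. E K - F K)
    \<le> Re (quad_form (n * r) (tensor_map m n r r E (\<lambda>K. K) \<rho>) w)"
proof -
  \<comment> \<open>The test vector with its two factors exchanged, which is still a unit
    vector.\<close>
  let ?w = "\<lambda>p. w (p mod n * r + p div n)"
  have "(\<Sum>i<r * n. (cmod (?w i))\<^sup>2) = (\<Sum>b<r. \<Sum>a<n. (cmod (w (a * r + b)))\<^sup>2)"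
    unfolding sum_tensor_index by (simp add: tensor_index_div tensor_index_mod)
  also have "\<dots> = 1" unfolding w[symmetric] sum_tensor_index by (rule sum.swap)
  finally have w': "(\<Sum>i<r * n. (cmod (?w i))\<^sup>2) = 1" .
  show ?thesis
    unfolding tensor_map_swap[OF quantum_channel_map[OF E]] tensor_map_swap[OF quantum_channel_map[OF F]]
      quad_form_swap_factors
    by (rule channel_replace_right[OF E F density_swap_factors[OF \<rho>] w'])
qed

lemma channel_density_left:
  assumes E: "quantum_channel m n E" and \<rho>: "density_mat (m * r) \<rho>"
  shows "density_mat (n * r) (tensor_map m n r r E (\<lambda>K. K) \<rho>)"
  unfolding tensor_map_swap[OF quantum_channel_map[OF E]]
  by (intro density_swap_factors channel_density[OF E] \<rho>)

section \<open>Kraus forms\<close>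

lemma sum_swap_last:
  "(\<Sum>a\<in>A. \<Sum>b\<in>B. \<Sum>g\<in>C. h a b g) = (\<Sum>g\<in>C. \<Sum>a\<in>A. \<Sum>b\<in>B. h a b (g :: 'g) :: 'a :: comm_monoid_add)"
proof -
  have "(\<Sum>a\<in>A. \<Sum>b\<in>B. \<Sum>g\<in>C. h a b g) = (\<Sum>a\<in>A. \<Sum>g\<in>C. \<Sum>b\<in>B. h a b g)"
    by (rule sum.cong[OF refl], rule sum.swap)
  also have "\<dots> = (\<Sum>g\<in>C. \<Sum>a\<in>A. \<Sum>b\<in>B. h a b g)" by (rule sum.swap)
  finally show ?thesis .
qed

lemma sum_swap_pairs:
  "(\<Sum>a\<in>A. \<Sum>b\<in>B. \<Sum>k\<in>C. \<Sum>l\<in>D. h a b k l) = (\<Sum>k\<in>C. \<Sum>l\<in>D. \<Sum>a\<in>A. \<Sum>b\<in>B. h a b k l :: 'a :: comm_monoid_add)"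
  by (rule trans[OF sum_swap_last], rule sum.cong[OF refl], rule sum_swap_last)

text \<open>Kraus operators pass to the test vector: w\<dagger>(B K B\<dagger>)w =
  (B\<dagger>w)\<dagger> K (B\<dagger>w). This yields positivity in \<open>psd_kraus\<close> and
  pulls the code state back through the encoders in \<open>ideal_run\<close>.\<close>

lemma quad_form_kraus:
  assumes X: "\<And>p q. p < n \<Longrightarrow> q < n \<Longrightarrow>
      X $$ (p, q) = (\<Sum>g\<in>S. \<Sum>k<m. \<Sum>l<m. B g p k * K $$ (k, l) * cnj (B g q l))"
  shows "quad_form n X w = (\<Sum>g\<in>S. quad_form m K (\<lambda>k. \<Sum>p<n. cnj (B g p k) * w p))"
proof -
  have "quad_form n X w = (\<Sum>p<n. \<Sum>q<n. \<Sum>g\<in>S. \<Sum>k<m. \<Sum>l<m. cnj (w p) * (B g p k * K $$ (k, l) * cnj (B g q l)) * w q)"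
    unfolding quad_form_def by (intro sum.cong[OF refl]) (simp add: X sum_distrib_left sum_distrib_right)
  also have "\<dots> = (\<Sum>g\<in>S. \<Sum>p<n. \<Sum>q<n. \<Sum>k<m. \<Sum>l<m. cnj (w p) * (B g p k * K $$ (k, l) * cnj (B g q l)) * w q)"
    by (rule sum_swap_last)
  also have "\<dots> = (\<Sum>g\<in>S. \<Sum>k<m. \<Sum>l<m. \<Sum>p<n. \<Sum>q<n. cnj (w p) * (B g p k * K $$ (k, l) * cnj (B g q l)) * w q)"
    by (rule sum.cong[OF refl], rule sum_swap_pairs)
  also have "\<dots> = (\<Sum>g\<in>S. quad_form m K (\<lambda>k. \<Sum>p<n. cnj (B g p k) * w p))"
    unfolding quad_form_def
  proof (intro sum.cong[OF refl])
    fix g k l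
    have "(\<Sum>p<n. \<Sum>q<n. cnj (w p) * (B g p k * K $$ (k, l) * cnj (B g q l)) * w q)
      = (\<Sum>p<n. \<Sum>q<n. B g p k * cnj (w p) * (cnj (B g q l) * w q)) * K $$ (k, l)"
      unfolding sum_distrib_right by (simp add: mult_ac)
    then show "(\<Sum>p<n. \<Sum>q<n. cnj (w p) * (B g p k * K $$ (k, l) * cnj (B g q l)) * w q)
      = cnj (\<Sum>p<n. cnj (B g p k) * w p) * K $$ (k, l) * (\<Sum>q<n. cnj (B g q l) * w q)"
      unfolding sum_product[symmetric] by (simp add: mult_ac)
  qed
  finally show ?thesis .
qed

lemma psd_kraus:
  assumes "X \<in> carrier_mat n n" and K: "psd_mat m K"
    and X: "\<And>p q. p < n \<Longrightarrow> q < n \<Longrightarrow>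
      X $$ (p, q) = (\<Sum>g\<in>S. \<Sum>k<m. \<Sum>l<m. B g p k * K $$ (k, l) * cnj (B g q l))"
  shows "psd_mat n X"
proof -
  have K': "K \<in> carrier_mat m m" "mat_adjoint K = K" "0 \<le> quad_form m K v" for v using K by (auto simp: psd_mat_iff)
  have "mat_adjoint X = X"
  proof (rule mat_adjoint_eqI[OF assms(1)])
    fix p q assume pq: "p < n" "q < n"
    have "cnj (X $$ (q, p)) = (\<Sum>g\<in>S. \<Sum>k<m. \<Sum>l<m. B g p l * cnj (K $$ (k, l)) * cnj (B g q k))"
      unfolding X[OF pq(2,1)] cnj_sum by (simp add: mult_ac)
    also have "\<dots> = (\<Sum>g\<in>S. \<Sum>l<m. \<Sum>k<m. B g p l * cnj (K $$ (k, l)) * cnj (B g q k))"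
      by (rule sum.cong[OF refl], rule sum.swap)
    also have "\<dots> = (\<Sum>g\<in>S. \<Sum>l<m. \<Sum>k<m. B g p l * K $$ (l, k) * cnj (B g q k))"
      by (intro sum.cong[OF refl] arg_cong2[of _ _ _ _ "(*)"] refl mat_adjoint_eqD[OF K'(2,1), symmetric]) auto
    finally show "X $$ (p, q) = cnj (X $$ (q, p))" unfolding X[OF pq] ..
  qed
  moreover have "0 \<le> quad_form n X v" for v
  proof -
    have "quad_form n X v = (\<Sum>g\<in>S. quad_form m K (\<lambda>k. \<Sum>p<n. cnj (B g p k) * v p))"
      by (rule quad_form_kraus) (rule X)
    then show ?thesis using K'(3) by (simp add: sum_nonneg)
  qed
  ultimately show ?thesis using assms(1) by (simp add: psd_mat_iff)
qed

lemma sum_tensor_block: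
  fixes f :: "nat \<Rightarrow> 'a :: comm_monoid_add"
  assumes "i < r"
  shows "(\<Sum>p<r * m. if p div m = i then f p else 0) = (\<Sum>k<m. f (i * m + k))"
proof -
  have "(\<Sum>p<r * m. if p div m = i then f p else 0) = (\<Sum>j<r. \<Sum>k<m. if j = i then f (i * m + k) else 0)"
    unfolding sum_tensor_index by (intro sum.cong[OF refl]) (auto simp: tensor_index_div)
  also have "\<dots> = (\<Sum>j<r. if j = i then \<Sum>k<m. f (i * m + k) else 0)"
    by (intro sum.cong[OF refl]) auto
  finally show ?thesis using assms by simp
qed

text \<open>Factors that vanish off one block of size m cut the sums down to that block. They come
  from Kraus operators built with I \<otimes> A or with \<langle>g| \<otimes> I.\<close>

lemma sum_tensor_block2:
  fixes f :: "nat \<Rightarrow> nat \<Rightarrow> complex"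
  assumes "i < r" "j < r"
  shows "(\<Sum>p<r * m. \<Sum>q<r * m. (if p div m = i then u p else 0) * f p q * (if q div m = j then v q else 0))
    = (\<Sum>k<m. \<Sum>l<m. u (i * m + k) * f (i * m + k) (j * m + l) * v (j * m + l))"
proof -
  have "(\<Sum>p<r * m. \<Sum>q<r * m. (if p div m = i then u p else 0) * f p q * (if q div m = j then v q else 0))
    = (\<Sum>p<r * m. if p div m = i then (\<Sum>q<r * m. if q div m = j then u p * f p q * v q else 0) else 0)"
  proof (intro sum.cong[OF refl])
    fix p
    show "(\<Sum>q<r * m. (if p div m = i then u p else 0) * f p q * (if q div m = j then v q else 0))
      = (if p div m = i then (\<Sum>q<r * m. if q div m = j then u p * f p q * v q else 0) else 0)"
      by (cases "p div m = i") (auto intro!: sum.cong)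
  qed
  then show ?thesis unfolding sum_tensor_block[OF assms(1)] sum_tensor_block[OF assms(2)] .
qed

text \<open>\<open>compl\<close> is the completeness relation \<Sum> A\<dagger>A = I, read at the
  entry (l, k), and gives trace preservation. Complete positivity holds because id \<otimes> E again
  has a Kraus form.\<close>

lemma quantum_channel_kraus:
  assumes car: "\<And>K. K \<in> carrier_mat m m \<Longrightarrow> E K \<in> carrier_mat n n"
    and ent: "\<And>K a b. K \<in> carrier_mat m m \<Longrightarrow> a < n \<Longrightarrow> b < n \<Longrightarrow>
      E K $$ (a, b) = (\<Sum>g\<in>S. \<Sum>k<m. \<Sum>l<m. A g a k * K $$ (k, l) * cnj (A g b l))"
    and compl: "\<And>k l. k < m \<Longrightarrow> l < m \<Longrightarrow> (\<Sum>g\<in>S. \<Sum>a<n. A g a k * cnj (A g a l)) = (if k = l then 1 else 0)"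
  shows "quantum_channel m n E"
  unfolding quantum_channel_def
proof (intro conjI ballI allI impI)
  fix K :: "complex mat" assume K: "K \<in> carrier_mat m m"
  then show "E K \<in> carrier_mat n n" by (rule car)
  have "mat_trace (E K) = (\<Sum>a<n. \<Sum>g\<in>S. \<Sum>k<m. \<Sum>l<m. A g a k * K $$ (k, l) * cnj (A g a l))"
    unfolding mat_trace_eq[OF car[OF K]] by (intro sum.cong[OF refl]) (simp add: ent K)
  also have "\<dots> = (\<Sum>k<m. \<Sum>l<m. \<Sum>g\<in>S. \<Sum>a<n. A g a k * K $$ (k, l) * cnj (A g a l))"
    by (subst sum_swap_pairs, rule sum.cong[OF refl], rule sum.cong[OF refl], rule sum.swap)
  also have "\<dots> = (\<Sum>k<m. \<Sum>l<m. K $$ (k, l) * (\<Sum>g\<in>S. \<Sum>a<n. A g a k * cnj (A g a l)))"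
    by (simp add: sum_distrib_left mult_ac)
  also have "\<dots> = (\<Sum>k<m. \<Sum>l<m. if l = k then K $$ (k, k) else 0)"
    by (intro sum.cong[OF refl]) (auto simp: compl)
  finally show "mat_trace (E K) = mat_trace K" by (simp add: mat_trace_eq[OF K])
next
  fix A' B' :: "complex mat" assume AB: "A' \<in> carrier_mat m m" "B' \<in> carrier_mat m m"
  show "E (A' + B') = E A' + E B'"
  proof (rule eq_matI)
    fix a b assume "a < dim_row (E A' + E B')" "b < dim_col (E A' + E B')"
    then have ab: "a < n" "b < n" using car[OF AB(2)] by auto
    have "(E A' + E B') $$ (a, b) = E A' $$ (a, b) + E B' $$ (a, b)" using ab car[OF AB(2)] by simp
    also have "\<dots> = E (A' + B') $$ (a, b)"
      unfolding ent[OF AB(1) ab] ent[OF AB(2) ab] ent[OF add_carrier_mat[OF AB(2)] ab] sum.distrib[symmetric]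
      using AB by (intro sum.cong[OF refl]) (simp add: algebra_simps)
    finally show "E (A' + B') $$ (a, b) = (E A' + E B') $$ (a, b)" ..
  qed (use car[OF AB(2)] car[OF add_carrier_mat[OF AB(2)], of A'] in auto)
next
  fix c :: complex and A' :: "complex mat" assume A': "A' \<in> carrier_mat m m"
  show "E (c \<cdot>\<^sub>m A') = c \<cdot>\<^sub>m E A'"
  proof (rule eq_matI)
    fix a b assume "a < dim_row (c \<cdot>\<^sub>m E A')" "b < dim_col (c \<cdot>\<^sub>m E A')"
    then have ab: "a < n" "b < n" using car[OF A'] by auto
    have "(c \<cdot>\<^sub>m E A') $$ (a, b) = c * E A' $$ (a, b)" using ab car[OF A'] by simp
    also have "\<dots> = E (c \<cdot>\<^sub>m A') $$ (a, b)"
      unfolding ent[OF A' ab] ent[OF smult_carrier_mat[OF A'] ab] sum_distrib_left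
      using A' by (intro sum.cong[OF refl]) (simp add: mult_ac)
    finally show "E (c \<cdot>\<^sub>m A') $$ (a, b) = (c \<cdot>\<^sub>m E A') $$ (a, b)" ..
  qed (use car[OF A'] car[OF smult_carrier_mat[OF A'], of c] in auto)
next
  fix r and K :: "complex mat" assume K: "psd_mat (r * m) K"
  have mp: "operator_map m n E" using car by (simp add: operator_map_def)
  \<comment> \<open>The Kraus operator I \<otimes> \<open>A g\<close> of id \<otimes> E: block
    indices must agree, inner indices go through \<open>A g\<close>.\<close>
  define B where "B g p q = (if q div m = p div n then A g (p mod n) (q mod m) else 0)" for g p q
  have unit: "E (mat_unit m k l) $$ (a, b) = (\<Sum>g\<in>S. A g a k * cnj (A g b l))" if "a < n" "b < n" "k < m" "l < m" for a b k l
  proof -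
    have "(\<Sum>k'<m. \<Sum>l'<m. A g a k' * mat_unit m k l $$ (k', l') * cnj (A g b l')) = A g a k * cnj (A g b l)" for g
    proof -
      have "(\<Sum>k'<m. \<Sum>l'<m. A g a k' * mat_unit m k l $$ (k', l') * cnj (A g b l'))
        = (\<Sum>k'<m. \<Sum>l'<m. (A g a k' * cnj (A g b l')) * mat_unit m k' l' $$ (k, l))"
        using that by (intro sum.cong[OF refl]) auto
      then show ?thesis unfolding sum_mat_unit[OF that(3,4)] .
    qed
    then show ?thesis using that by (simp add: ent)
  qed
  show "psd_mat (r * n) (tensor_map r r m n (\<lambda>K. K) E K)"
  proof (rule psd_kraus[OF tensor_map_carrier K])
    fix p q assume "p < r * n" "q < r * n"
    then obtain i a j b where p: "i < r" "a < n" "p = i * n + a" and q: "j < r" "b < n" "q = j * n + b"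
      by (elim tensor_index_cases)
    have "tensor_map r r m n (\<lambda>K. K) E K $$ (p, q) = (\<Sum>k<m. \<Sum>l<m. K $$ (i * m + k, j * m + l) * (\<Sum>g\<in>S. A g a k * cnj (A g b l)))"
      unfolding p(3) q(3) tensor_map_id_left_index[OF mp p(1) q(1) p(2) q(2)]
      using p q by (intro sum.cong[OF refl]) (simp add: unit)
    also have "\<dots> = (\<Sum>k<m. \<Sum>l<m. \<Sum>g\<in>S. A g a k * K $$ (i * m + k, j * m + l) * cnj (A g b l))"
      unfolding sum_distrib_left by (simp add: mult_ac)
    also have "\<dots> = (\<Sum>g\<in>S. \<Sum>k<m. \<Sum>l<m. A g a k * K $$ (i * m + k, j * m + l) * cnj (A g b l))"
      by (rule sum_swap_last)
    also have "\<dots> = (\<Sum>g\<in>S. \<Sum>p'<r * m. \<Sum>q'<r * m. B g p p' * K $$ (p', q') * cnj (B g q q'))"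
    proof (rule sum.cong[OF refl])
      fix g
      have "(\<Sum>p'<r * m. \<Sum>q'<r * m. B g p p' * K $$ (p', q') * cnj (B g q q'))
        = (\<Sum>p'<r * m. \<Sum>q'<r * m. (if p' div m = i then A g a (p' mod m) else 0) * K $$ (p', q')
             * (if q' div m = j then cnj (A g b (q' mod m)) else 0))"
        unfolding B_def p(3) q(3) tensor_index_div[OF p(2)] tensor_index_mod[OF p(2)]
          tensor_index_div[OF q(2)] tensor_index_mod[OF q(2)] if_distrib[of cnj] complex_cnj_zero ..
      also have "\<dots> = (\<Sum>k<m. \<Sum>l<m. A g a k * K $$ (i * m + k, j * m + l) * cnj (A g b l))"
        unfolding sum_tensor_block2[OF p(1) q(1)] by (simp add: tensor_index_mod)
      finally show "(\<Sum>k<m. \<Sum>l<m. A g a k * K $$ (i * m + k, j * m + l) * cnj (A g b l))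
        = (\<Sum>p'<r * m. \<Sum>q'<r * m. B g p p' * K $$ (p', q') * cnj (B g q q'))" ..
    qed
    finally show "tensor_map r r m n (\<lambda>K. K) E K $$ (p, q)
      = (\<Sum>g\<in>S. \<Sum>p'<r * m. \<Sum>q'<r * m. B g p p' * K $$ (p', q') * cnj (B g q q'))" .
  qed
qed

section \<open>The ideal components\<close>

locale tnc =
  fixes G :: "('g, 'b) monoid_scheme" (structure)
    and d :: nat and U :: "'g \<Rightarrow> complex mat" and ix :: "'g \<Rightarrow> nat"
  assumes tnc: "tnc_representation G d U" and ix: "bij_betw ix (carrier G) {..<d\<^sup>2}"
begin

sublocale group G using tnc by (simp add: tnc_representation_def)

lemma finite_carrier: "finite (carrier G)"
  and order_eq: "Coset.order G = d\<^sup>2"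
  and U_unitary: "g \<in> carrier G \<Longrightarrow> unitary_mat d (U g)"
  using tnc by (auto simp: tnc_representation_def)

lemma U_carrier: "g \<in> carrier G \<Longrightarrow> U g \<in> carrier_mat d d"
  using U_unitary by (simp add: unitary_mat_def)

lemma d_pos: "0 < d"
proof -
  have "carrier G \<noteq> {}" using one_closed by blast
  then have "0 < card (carrier G)" using finite_carrier by (simp add: card_gt_0_iff)
  then show ?thesis using order_eq by (cases d) (auto simp: Coset.order_def)
qed

lemma ix_less: "g \<in> carrier G \<Longrightarrow> ix g < d\<^sup>2"
  using bij_betw_apply[OF ix] by auto

lemma ix_eq_iff: "g \<in> carrier G \<Longrightarrow> h \<in> carrier G \<Longrightarrow> ix g = ix h \<longleftrightarrow> g = h"
  using bij_betw_imp_inj_on[OF ix] by (auto dest: inj_onD)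

lemma sum_ix: "(\<Sum>g\<in>carrier G. f (ix g)) = (\<Sum>x<d\<^sup>2. f x)"
  by (rule sum.reindex_bij_betw[OF ix])

lemma sum_carrier_delta:
  "g \<in> carrier G \<Longrightarrow> (\<Sum>h\<in>carrier G. if ix h = ix g then f h else 0) = (f g :: 'a :: comm_monoid_add)"
proof -
  assume g: "g \<in> carrier G"
  have "(\<Sum>h\<in>carrier G. if ix h = ix g then f h else 0) = (\<Sum>h\<in>carrier G. if h = g then f g else 0)"
    by (intro sum.cong[OF refl]) (auto simp: ix_eq_iff g)
  then show ?thesis using g finite_carrier by simp
qed

section \<open>The ideal encoders\<close>

lemma controlled_encoder_index:
  assumes V: "\<And>g. g \<in> carrier G \<Longrightarrow> V g \<in> carrier_mat d d" and ab: "a < d" "b < d"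
  shows "controlled_encoder G d ix V K $$ (a, b) =
    (\<Sum>g\<in>carrier G. \<Sum>k<d. \<Sum>l<d. V g $$ (a, k) * K $$ (ix g * d + k, ix g * d + l) * cnj (V g $$ (b, l)))"
proof -
  have "(V g * mat d d (\<lambda>(i, j). K $$ (ix g * d + i, ix g * d + j)) * mat_adjoint (V g)) $$ (a, b)
    = (\<Sum>k<d. \<Sum>l<d. V g $$ (a, k) * K $$ (ix g * d + k, ix g * d + l) * cnj (V g $$ (b, l)))"
    if g: "g \<in> carrier G" for g
  proof -
    let ?M = "mat d d (\<lambda>(i, j). K $$ (ix g * d + i, ix g * d + j))"
    have "(V g * ?M * mat_adjoint (V g)) $$ (a, b) = (\<Sum>l<d. (V g * ?M) $$ (a, l) * mat_adjoint (V g) $$ (l, b))"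
      using V[OF g] ab by (intro mult_mat_index[of _ d d _ d]) auto
    also have "\<dots> = (\<Sum>l<d. \<Sum>k<d. V g $$ (a, k) * K $$ (ix g * d + k, ix g * d + l) * cnj (V g $$ (b, l)))"
    proof (rule sum.cong[OF refl])
      fix l assume l: "l \<in> {..<d}"
      have "(V g * ?M) $$ (a, l) = (\<Sum>k<d. V g $$ (a, k) * ?M $$ (k, l))"
        using V[OF g] ab l by (intro mult_mat_index[of _ d d _ d]) auto
      then show "(V g * ?M) $$ (a, l) * mat_adjoint (V g) $$ (l, b)
        = (\<Sum>k<d. V g $$ (a, k) * K $$ (ix g * d + k, ix g * d + l) * cnj (V g $$ (b, l)))"
        using V[OF g] ab l by (simp add: sum_distrib_right)
    qed
    also have "\<dots> = (\<Sum>k<d. \<Sum>l<d. V g $$ (a, k) * K $$ (ix g * d + k, ix g * d + l) * cnj (V g $$ (b, l)))"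
      by (rule sum.swap)
    finally show ?thesis .
  qed
  then show ?thesis using ab by (simp add: controlled_encoder_def mat_sum_def)
qed

text \<open>The Kraus operators are V g (\<langle>g| \<otimes> I). Completeness combines the
  unitarity of each \<open>V g\<close> with the fact that the |g\<rangle>\<langle>g| add up to I,
  because \<open>ix\<close> is onto.\<close>

lemma controlled_encoder_channel:
  assumes V: "\<And>g. g \<in> carrier G \<Longrightarrow> unitary_mat d (V g)"
  shows "quantum_channel (d\<^sup>2 * d) d (controlled_encoder G d ix V)"
proof (rule quantum_channel_kraus[where S = "carrier G" and A = "\<lambda>g a k. if k div d = ix g then V g $$ (a, k mod d) else 0"])
  fix K show "controlled_encoder G d ix V K \<in> carrier_mat d d"
    by (simp add: controlled_encoder_def mat_sum_def)
  fix a b assume ab: "a < d" "b < d"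
  have Vc: "V g \<in> carrier_mat d d" if "g \<in> carrier G" for g using V[OF that] by (simp add: unitary_mat_def)
  have "controlled_encoder G d ix V K $$ (a, b) =
    (\<Sum>g\<in>carrier G. \<Sum>k<d. \<Sum>l<d. V g $$ (a, k) * K $$ (ix g * d + k, ix g * d + l) * cnj (V g $$ (b, l)))"
    by (rule controlled_encoder_index[OF _ ab]) (rule Vc)
  also have "\<dots> = (\<Sum>g\<in>carrier G. \<Sum>k<d\<^sup>2 * d. \<Sum>l<d\<^sup>2 * d.
      (if k div d = ix g then V g $$ (a, k mod d) else 0) * K $$ (k, l) * (if l div d = ix g then cnj (V g $$ (b, l mod d)) else 0))"
    by (rule sum.cong[OF refl], subst sum_tensor_block2) (auto simp: ix_less tensor_index_mod)
  finally show "controlled_encoder G d ix V K $$ (a, b) = (\<Sum>g\<in>carrier G. \<Sum>k<d\<^sup>2 * d. \<Sum>l<d\<^sup>2 * d.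
      (if k div d = ix g then V g $$ (a, k mod d) else 0) * K $$ (k, l) * cnj (if l div d = ix g then V g $$ (b, l mod d) else 0))"
    unfolding if_distrib[of cnj] complex_cnj_zero .
next
  fix k l assume "k < d\<^sup>2 * d" "l < d\<^sup>2 * d"
  then obtain x i y j where k: "x < d\<^sup>2" "i < d" "k = x * d + i" and l: "y < d\<^sup>2" "j < d" "l = y * d + j"
    by (elim tensor_index_cases)
  have "(\<Sum>g\<in>carrier G. \<Sum>a<d. (if k div d = ix g then V g $$ (a, k mod d) else 0)
      * cnj (if l div d = ix g then V g $$ (a, l mod d) else 0))
    = (\<Sum>g\<in>carrier G. if ix g = x then if y = x then (\<Sum>a<d. cnj (V g $$ (a, j)) * V g $$ (a, i)) else 0 else 0)"
    unfolding k(3) l(3) tensor_index_div[OF k(2)] tensor_index_div[OF l(2)] tensor_index_mod[OF k(2)] tensor_index_mod[OF l(2)]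
    by (intro sum.cong[OF refl]) (auto simp: mult.commute)
  also have "\<dots> = (\<Sum>g\<in>carrier G. if ix g = x then if y = x then if j = i then 1 else 0 else 0 else 0)"
    by (intro sum.cong[OF refl]) (simp add: unitary_mat_columns[OF V] k l)
  also have "\<dots> = (\<Sum>z<d\<^sup>2. if z = x then if y = x then if j = i then 1 else 0 else 0 else 0)"
    by (rule sum_ix)
  also have "\<dots> = (if k = l then 1 else 0)" using k l by (auto simp: tensor_index_eq)
  finally show "(\<Sum>g\<in>carrier G. \<Sum>a<d. (if k div d = ix g then V g $$ (a, k mod d) else 0)
      * cnj (if l div d = ix g then V g $$ (a, l mod d) else 0)) = (if k = l then 1 else 0)" .
qed

lemma transpose_unitary:
  assumes "unitary_mat d V" shows "unitary_mat d (transpose_mat V)"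
proof (rule unitary_matI)
  have V: "V \<in> carrier_mat d d" using assms by (simp add: unitary_mat_def)
  then show "transpose_mat V \<in> carrier_mat d d" by simp
  fix k l assume "k < d" "l < d"
  then have "(\<Sum>i<d. cnj (transpose_mat V $$ (i, k)) * transpose_mat V $$ (i, l)) = (\<Sum>i<d. V $$ (l, i) * cnj (V $$ (k, i)))"
    using V by (simp add: mult.commute)
  also have "\<dots> = (if l = k then 1 else 0)" using \<open>k < d\<close> \<open>l < d\<close> by (rule unitary_mat_rows[OF assms, rotated])
  finally show "(\<Sum>i<d. cnj (transpose_mat V $$ (i, k)) * transpose_mat V $$ (i, l)) = (if k = l then 1 else 0)"
    by auto
qed

lemma ideal_encoder1_channel: "quantum_channel (d\<^sup>2 * d) d (ideal_encoder1 G d ix U)"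
  and ideal_encoder2_channel: "quantum_channel (d\<^sup>2 * d) d (ideal_encoder2 G d ix U)"
  unfolding ideal_encoder1_def ideal_encoder2_def
  by (intro controlled_encoder_channel transpose_unitary U_unitary; assumption)+

section \<open>Code states and the ideal decoder\<close>

lemma code_state_carrier:
  assumes "g \<in> carrier G" shows "code_state d U g \<in> carrier_vec (d * d)"
proof (rule carrier_vecI)
  have "dim_row (U g) = d" by (rule carrier_matD(1)[OF U_carrier[OF assms]])
  then show "dim_vec (code_state d U g) = d * d" by (simp add: code_state_def kron_def)
qed

lemma max_entangled_index:
  "i < d \<Longrightarrow> j < d \<Longrightarrow> max_entangled d $ (i * d + j) = (if i = j then 1 / of_real (sqrt (real d)) else 0)"
  by (simp add: max_entangled_def tensor_index_less tensor_index_div tensor_index_mod)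

text \<open>U \<otimes> I applied to the maximally entangled vector writes out the rows of U one
  after another. Inner products of code states are therefore trace inner products of the
  \<open>U g\<close>.\<close>

lemma code_state_index:
  assumes g: "g \<in> carrier G" and ij: "i < d" "j < d"
  shows "code_state d U g $ (i * d + j) = U g $$ (i, j) / of_real (sqrt (real d))"
proof -
  note Ug = carrier_matD[OF U_carrier[OF g]]
  have "code_state d U g $ (i * d + j) = (\<Sum>q<d * d. kron (U g) (1\<^sub>m d) $$ (i * d + j, q) * max_entangled d $ q)"
    using ij Ug unfolding code_state_def
    by (subst index_mult_mat_vec) (simp_all add: kron_def scalar_prod_def atLeast0LessThan tensor_index_less max_entangled_def)
  also have "\<dots> = (\<Sum>k<d. \<Sum>l<d. if l = j then if k = l then U g $$ (i, k) / of_real (sqrt (real d)) else 0 else 0)"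
    unfolding sum_tensor_index
    using ij Ug by (intro sum.cong[OF refl])
      (simp add: kron_def tensor_index_less tensor_index_div tensor_index_mod max_entangled_index)
  also have "\<dots> = (\<Sum>k<d. if k = j then U g $$ (i, j) / of_real (sqrt (real d)) else 0)"
    using ij by (intro sum.cong[OF refl]) auto
  finally show ?thesis using ij by simp
qed

lemma sqrt_d: "of_real (sqrt (real d)) * of_real (sqrt (real d)) = (of_nat d :: complex)"
  by (simp only: of_real_mult[symmetric]) simp

lemma code_state_orthonormal:
  assumes g: "g \<in> carrier G" and h: "h \<in> carrier G"
  shows "(\<Sum>p<d * d. cnj (code_state d U g $ p) * code_state d U h $ p) = (if g = h then 1 else 0)"
proof -
  note Ug = U_carrier[OF g] and Uh = U_carrier[OF h]
  have "(\<Sum>p<d * d. cnj (code_state d U g $ p) * code_state d U h $ p)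
    = (\<Sum>i<d. \<Sum>j<d. cnj (U g $$ (i, j)) * U h $$ (i, j)) / (of_real (sqrt (real d)) * of_real (sqrt (real d)))"
    unfolding sum_tensor_index sum_divide_distrib
    by (intro sum.cong[OF refl]) (simp add: code_state_index g h)
  also have "(\<Sum>i<d. \<Sum>j<d. cnj (U g $$ (i, j)) * U h $$ (i, j)) = (\<Sum>j<d. \<Sum>i<d. cnj (U g $$ (i, j)) * U h $$ (i, j))"
    by (rule sum.swap)
  also have "\<dots> = (\<Sum>j<d. (mat_adjoint (U g) * U h) $$ (j, j))"
    using Ug Uh by (intro sum.cong[OF refl], subst mult_mat_index[of _ d d _ d]) auto
  also have "\<dots> = mat_trace (mat_adjoint (U g) * U h)"
    using Ug Uh by (intro mat_trace_eq[symmetric]) auto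
  also have "\<dots> = (if g = h then of_nat d else 0)" using tnc g h by (simp add: tnc_representation_def)
  finally show ?thesis using d_pos by (simp add: sqrt_d)
qed

lemma code_state_norm:
  assumes "g \<in> carrier G"
  shows "(\<Sum>p<d * d. (cmod (code_state d U g $ p))\<^sup>2) = 1"
proof -
  have "complex_of_real (\<Sum>p<d * d. (cmod (code_state d U g $ p))\<^sup>2) = 1"
    using code_state_orthonormal[OF assms assms] unfolding mult_cnj_cmod by simp
  then show ?thesis by (simp only: of_real_eq_1_iff)
qed

text \<open>
  The \<open>d\<^sup>2\<close> orthonormal code states form a square matrix with orthonormal columns,
  so they are complete.
\<close>

lemma code_state_complete:
  assumes kl: "k < d * d" "l < d * d"
  shows "(\<Sum>g\<in>carrier G. code_state d U g $ k * cnj (code_state d U g $ l)) = (if k = l then 1 else 0)"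
proof -
  define e where "e = the_inv_into (carrier G) ix"
  have e: "e x \<in> carrier G" "ix (e x) = x" if "x < d\<^sup>2" for x
    using that ix unfolding e_def bij_betw_def
    by (auto intro: the_inv_into_into[OF _ _ subset_refl] f_the_inv_into_f)
  have eix: "e (ix g) = g" if "g \<in> carrier G" for g
    using that ix unfolding e_def bij_betw_def by (auto intro: the_inv_into_f_f)
  define M where "M = mat (d * d) (d * d) (\<lambda>(p, x). code_state d U (e x) $ p)"
  have dd: "d * d = d\<^sup>2" by (simp add: power2_eq_square)
  have M: "unitary_mat (d * d) M"
  proof (rule unitary_matI)
    fix x y assume xy: "x < d * d" "y < d * d"
    then have "(\<Sum>p<d * d. cnj (M $$ (p, x)) * M $$ (p, y)) = (if e x = e y then 1 else 0)"
      using code_state_orthonormal[of "e x" "e y"] e by (simp add: M_def dd)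
    also have "e x = e y \<longleftrightarrow> x = y" using e xy unfolding dd by metis
    finally show "(\<Sum>p<d * d. cnj (M $$ (p, x)) * M $$ (p, y)) = (if x = y then 1 else 0)" .
  qed (simp add: M_def)
  have "(\<Sum>g\<in>carrier G. code_state d U g $ k * cnj (code_state d U g $ l))
    = (\<Sum>g\<in>carrier G. M $$ (k, ix g) * cnj (M $$ (l, ix g)))"
    using kl by (intro sum.cong[OF refl]) (simp add: M_def eix ix_less dd)
  also have "\<dots> = (\<Sum>x<d * d. M $$ (k, x) * cnj (M $$ (l, x)))"
    unfolding dd by (rule sum_ix[where f = "\<lambda>x. M $$ (k, x) * cnj (M $$ (l, x))"])
  also have "\<dots> = (if k = l then 1 else 0)" by (rule unitary_mat_rows[OF M kl])
  finally show ?thesis .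
qed

lemma ideal_decoder_index:
  assumes K: "K \<in> carrier_mat (d * d) (d * d)" and ab: "a < d\<^sup>2" "b < d\<^sup>2"
  shows "ideal_decoder G d ix U K $$ (a, b) =
    (\<Sum>g\<in>carrier G. if ix g = a \<and> ix g = b then quad_form (d * d) K (\<lambda>p. code_state d U g $ p) else 0)"
proof -
  have "ideal_decoder G d ix U K $$ (a, b) =
    (\<Sum>g\<in>carrier G. (((K *\<^sub>v code_state d U g) \<bullet>c code_state d U g) \<cdot>\<^sub>m classical d ix g) $$ (a, b))"
    using ab by (simp add: ideal_decoder_def mat_sum_def)
  also have "\<dots> = (\<Sum>g\<in>carrier G. if ix g = a \<and> ix g = b then quad_form (d * d) K (\<lambda>p. code_state d U g $ p) else 0)"
  proof (intro sum.cong[OF refl])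
    fix g assume g: "g \<in> carrier G"
    have "classical d ix g \<in> carrier_mat (d\<^sup>2) (d\<^sup>2)" by (simp add: classical_def)
    then show "(((K *\<^sub>v code_state d U g) \<bullet>c code_state d U g) \<cdot>\<^sub>m classical d ix g) $$ (a, b)
      = (if ix g = a \<and> ix g = b then quad_form (d * d) K (\<lambda>p. code_state d U g $ p) else 0)"
      using ab ix_less[OF g] mult_mat_vec_inner[OF K code_state_carrier[OF g]]
      by (auto simp: classical_def carrier_matD[OF mat_unit_carrier])
  qed
  finally show ?thesis .
qed

text \<open>The Kraus operators are |g\<rangle>\<langle>\<Phi>_g|, the bra accounting for the
  \<open>cnj\<close>. Their completeness is that of the code states.\<close>

lemma ideal_decoder_channel: "quantum_channel (d * d) (d\<^sup>2) (ideal_decoder G d ix U)"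
proof (rule quantum_channel_kraus[where S = "carrier G" and A = "\<lambda>g a k. if a = ix g then cnj (code_state d U g $ k) else 0"])
  fix K show "ideal_decoder G d ix U K \<in> carrier_mat (d\<^sup>2) (d\<^sup>2)" by (simp add: ideal_decoder_def mat_sum_def)
next
  fix K :: "complex mat" and a b assume K: "K \<in> carrier_mat (d * d) (d * d)" and ab: "a < d\<^sup>2" "b < d\<^sup>2"
  show "ideal_decoder G d ix U K $$ (a, b) = (\<Sum>g\<in>carrier G. \<Sum>k<d * d. \<Sum>l<d * d.
      (if a = ix g then cnj (code_state d U g $ k) else 0) * K $$ (k, l) * cnj (if b = ix g then cnj (code_state d U g $ l) else 0))"
    unfolding ideal_decoder_index[OF K ab] quad_form_def by (intro sum.cong[OF refl]) auto
next
  fix k l assume kl: "k < d * d" "l < d * d"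
  have "(\<Sum>g\<in>carrier G. \<Sum>a<d\<^sup>2. (if a = ix g then cnj (code_state d U g $ k) else 0)
      * cnj (if a = ix g then cnj (code_state d U g $ l) else 0))
    = (\<Sum>g\<in>carrier G. \<Sum>a<d\<^sup>2. if a = ix g then code_state d U g $ l * cnj (code_state d U g $ k) else 0)"
    by (intro sum.cong[OF refl]) auto
  also have "\<dots> = (\<Sum>g\<in>carrier G. code_state d U g $ l * cnj (code_state d U g $ k))"
    by (intro sum.cong[OF refl]) (simp add: ix_less)
  also have "\<dots> = (if k = l then 1 else 0)" using code_state_complete[OF kl(2,1)] by auto
  finally show "(\<Sum>g\<in>carrier G. \<Sum>a<d\<^sup>2. (if a = ix g then cnj (code_state d U g $ k) else 0)
      * cnj (if a = ix g then cnj (code_state d U g $ l) else 0)) = (if k = l then 1 else 0)" .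
qed

lemma ideal_decoder_diag:
  assumes K: "K \<in> carrier_mat (d * d) (d * d)" and g: "g \<in> carrier G"
  shows "ideal_decoder G d ix U K $$ (ix g, ix g) = quad_form (d * d) K (\<lambda>p. code_state d U g $ p)"
  unfolding ideal_decoder_index[OF K ix_less[OF g] ix_less[OF g]] using sum_carrier_delta[OF g] by simp

end

section \<open>Phases, basis vectors and embedded states\<close>

lemma quad_form_cong: "(\<And>p. p < n \<Longrightarrow> v p = w p) \<Longrightarrow> quad_form n A v = quad_form n A w"
  by (simp add: quad_form_def)

lemma quad_form_scale: "quad_form n A (\<lambda>p. c * v p) = of_real ((cmod c)\<^sup>2) * quad_form n A v"
  unfolding quad_form_def mult_cnj_cmod[symmetric] sum_distrib_left by (simp add: mult_ac)

lemma quad_form_unit: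
  assumes "z < n" shows "quad_form n A (\<lambda>p. if p = z then 1 else 0) = A $$ (z, z)"
proof -
  have "quad_form n A (\<lambda>p. if p = z then 1 else 0) = (\<Sum>i<n. \<Sum>j<n. if j = z then if i = z then A $$ (z, z) else 0 else 0)"
    unfolding quad_form_def by (intro sum.cong[OF refl]) auto
  also have "\<dots> = (\<Sum>i<n. if i = z then A $$ (z, z) else 0)" using assms by (intro sum.cong[OF refl]) auto
  finally show ?thesis using assms by simp
qed

lemma sum_embed:
  assumes inj: "inj_on f {..<n}" and sub: "f ` {..<n} \<subseteq> {..<N::nat}"
    and zero: "\<And>p. p < N \<Longrightarrow> p \<notin> f ` {..<n} \<Longrightarrow> h p = (0 :: 'a :: comm_monoid_add)"
  shows "(\<Sum>p<N. h p) = (\<Sum>i<n. h (f i))"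
proof -
  have "(\<Sum>p<N. h p) = (\<Sum>p\<in>f ` {..<n}. h p)"
    using sub zero by (intro sum.mono_neutral_right) auto
  then show ?thesis using sum.reindex[OF inj, of h] by simp
qed

text \<open>P is J \<sigma> J\<dagger> for the isometry J taking basis vector i to basis vector f i,
  so Hermiticity, positivity and trace are inherited from \<sigma>.\<close>

lemma density_embed:
  assumes \<sigma>: "density_mat n \<sigma>" and P: "P \<in> carrier_mat N N"
    and inj: "inj_on f {..<n}" and sub: "f ` {..<n} \<subseteq> {..<N}"
    and ent: "\<And>i j. i < n \<Longrightarrow> j < n \<Longrightarrow> P $$ (f i, f j) = \<sigma> $$ (i, j)"
    and zero: "\<And>p q. p < N \<Longrightarrow> q < N \<Longrightarrow> p \<notin> f ` {..<n} \<or> q \<notin> f ` {..<n} \<Longrightarrow> P $$ (p, q) = 0"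
  shows "density_mat N P"
proof -
  note D = density_matD[OF \<sigma>]
  have "mat_adjoint P = P"
  proof (rule mat_adjoint_eqI[OF P])
    fix p q assume pq: "p < N" "q < N"
    show "P $$ (p, q) = cnj (P $$ (q, p))"
    proof (cases "p \<in> f ` {..<n} \<and> q \<in> f ` {..<n}")
      case True
      then obtain i j where "i < n" "j < n" "p = f i" "q = f j" by auto
      then show ?thesis using mat_adjoint_eqD[OF D(2,1), of i j] by (simp add: ent)
    qed (use zero[OF pq] zero[OF pq(2,1)] in auto)
  qed
  moreover have "quad_form N P v = quad_form n \<sigma> (\<lambda>i. v (f i))" for v
  proof -
    have "quad_form N P v = (\<Sum>i<n. \<Sum>q<N. cnj (v (f i)) * P $$ (f i, q) * v q)"
      unfolding quad_form_def by (rule sum_embed[OF inj sub]) (simp add: zero)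
    also have "\<dots> = (\<Sum>i<n. \<Sum>j<n. cnj (v (f i)) * P $$ (f i, f j) * v (f j))"
      using sub by (intro sum.cong[OF refl] sum_embed[OF inj sub]) (auto simp: zero)
    finally show ?thesis by (simp add: quad_form_def ent)
  qed
  moreover have "mat_trace P = 1"
  proof -
    have "mat_trace P = (\<Sum>i<n. P $$ (f i, f i))"
      unfolding mat_trace_eq[OF P] by (rule sum_embed[OF inj sub]) (simp add: zero)
    then show ?thesis using D(4) by (simp add: ent mat_trace_eq[OF D(1)])
  qed
  ultimately show ?thesis using P D(3) by (simp add: density_mat_def psd_mat_iff)
qed

text \<open>The state \<open>|x\<rangle>\<langle>x|\<^sub>X \<otimes> |y\<rangle>\<langle>y|\<^sub>Y \<otimes> \<sigma>\<^bsub>AB\<^esub>\<close> with registers in the order \<open>XAYB\<close>.\<close>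

definition sender_input :: "nat \<Rightarrow> nat \<Rightarrow> nat \<Rightarrow> complex mat \<Rightarrow> complex mat" where
  "sender_input d x y \<sigma> = (let D = d\<^sup>2 * d; ok = (\<lambda>p. p div D div d = x \<and> p mod D div d = y);
      ab = (\<lambda>p. p div D mod d * d + p mod D mod d)
    in mat (D * D) (D * D) (\<lambda>(p, q). if ok p \<and> ok q then \<sigma> $$ (ab p, ab q) else 0))"

lemma sender_input_carrier [simp]: "sender_input d x y \<sigma> \<in> carrier_mat ((d\<^sup>2 * d) * (d\<^sup>2 * d)) ((d\<^sup>2 * d) * (d\<^sup>2 * d))"
  by (simp add: sender_input_def Let_def)

lemma sender_input_index:
  assumes "i < d\<^sup>2 * d" "k < d\<^sup>2 * d" "j < d\<^sup>2 * d" "l < d\<^sup>2 * d"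
  shows "sender_input d x y \<sigma> $$ (i * (d\<^sup>2 * d) + k, j * (d\<^sup>2 * d) + l) =
    (if i div d = x then if j div d = x then if k div d = y then if l div d = y then
       \<sigma> $$ (i mod d * d + k mod d, j mod d * d + l mod d) else 0 else 0 else 0 else 0)"
  using tensor_index_less[OF assms(1,2)] tensor_index_less[OF assms(3,4)]
  unfolding sender_input_def Let_def
  by (simp add: tensor_index_div[OF assms(2)] tensor_index_mod[OF assms(2)] tensor_index_div[OF assms(4)] tensor_index_mod[OF assms(4)]
      mod_less[OF assms(2)] mod_less[OF assms(4)])

lemma sender_input_density:
  assumes \<sigma>: "density_mat (d * d) \<sigma>" and x: "x < d\<^sup>2" and y: "y < d\<^sup>2"
  shows "density_mat ((d\<^sup>2 * d) * (d\<^sup>2 * d)) (sender_input d x y \<sigma>)"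
proof -
  let ?D = "d\<^sup>2 * d"
  \<comment> \<open>The index (a, b) of AB goes to the index ((x, a), (y, b)) of XAYB.\<close>
  define f where "f p = (x * d + p div d) * ?D + (y * d + p mod d)" for p
  have lt: "x * d + p div d < ?D" "y * d + p mod d < ?D" "p div d < d" "p mod d < d" if "p < d * d" for p
    using that by (auto elim!: tensor_index_cases simp: tensor_index_less x y tensor_index_div tensor_index_mod)
  show ?thesis
  proof (rule density_embed[OF \<sigma> sender_input_carrier, of f])
    show "inj_on f {..<d * d}"
    proof (rule inj_onI)
      fix p q assume pq: "p \<in> {..<d * d}" "q \<in> {..<d * d}" and e: "f p = f q"
      have "x * d + p div d = x * d + q div d \<and> y * d + p mod d = y * d + q mod d"
        using e lt[of p] lt[of q] pq unfolding f_def by (subst (asm) tensor_index_eq) auto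
      then show "p = q" by (metis add_left_cancel div_mult_mod_eq)
    qed
    show "f ` {..<d * d} \<subseteq> {..<?D * ?D}"
      using tensor_index_less[OF lt(1,2)] by (auto simp: f_def)
    fix p q assume pq: "p < d * d" "q < d * d"
    note lp = lt[OF pq(1)] and lq = lt[OF pq(2)]
    show "sender_input d x y \<sigma> $$ (f p, f q) = \<sigma> $$ (p, q)"
      unfolding f_def sender_input_index[OF lp(1,2) lq(1,2)] tensor_index_div[OF lp(3)] tensor_index_mod[OF lp(3)]
        tensor_index_div[OF lp(4)] tensor_index_mod[OF lp(4)] tensor_index_div[OF lq(3)] tensor_index_mod[OF lq(3)]
        tensor_index_div[OF lq(4)] tensor_index_mod[OF lq(4)] by simp
  next
    fix p q assume pq: "p < ?D * ?D" "q < ?D * ?D" and o: "p \<notin> f ` {..<d * d} \<or> q \<notin> f ` {..<d * d}"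
    \<comment> \<open>Conversely, every index with X part x and Y part y lies in the range of f, so
      \<open>sender_input\<close> vanishes off that range.\<close>
    have *: "p \<in> f ` {..<d * d}" if "i < ?D" "k < ?D" "p = i * ?D + k" "i div d = x" "k div d = y" for p i k
    proof -
      have "d > 0" using that(1) by (cases d) auto
      then have "i mod d * d + k mod d < d * d" by (intro tensor_index_less) auto
      moreover have "f (i mod d * d + k mod d) = p"
        using \<open>d > 0\<close> that by (auto simp: f_def tensor_index_div tensor_index_mod)
      ultimately show ?thesis by blast
    qed
    obtain i k where p: "i < ?D" "k < ?D" "p = i * ?D + k" using tensor_index_cases[OF pq(1)] .
    obtain j l where q: "j < ?D" "l < ?D" "q = j * ?D + l" using tensor_index_cases[OF pq(2)] .
    show "sender_input d x y \<sigma> $$ (p, q) = 0"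
      using o *[OF p] *[OF q] unfolding p(3) q(3) sender_input_index[OF p(1,2) q(1,2)] by auto
  qed
qed

section \<open>The ideal encoders on classical inputs\<close>

context tnc
begin

text \<open>The input is |g\<rangle>\<langle>g| \<otimes> |s\<rangle>\<langle>t|, so only the Kraus
  operator of g survives. Matrix units with two different X parts have coefficient zero in a
  \<open>sender_input\<close>.\<close>

lemma controlled_encoder_unit:
  assumes V: "\<And>g. g \<in> carrier G \<Longrightarrow> V g \<in> carrier_mat d d" and g: "g \<in> carrier G"
    and lt: "a < d" "b < d" "s < d" "t < d"
  shows "controlled_encoder G d ix V (mat_unit (d\<^sup>2 * d) (ix g * d + s) (ix g * d + t)) $$ (a, b) = V g $$ (a, s) * cnj (V g $$ (b, t))"
proof -
  have "controlled_encoder G d ix V (mat_unit (d\<^sup>2 * d) (ix g * d + s) (ix g * d + t)) $$ (a, b) =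
    (\<Sum>h\<in>carrier G. \<Sum>k<d. \<Sum>l<d. V h $$ (a, k) * mat_unit (d\<^sup>2 * d) (ix g * d + s) (ix g * d + t) $$ (ix h * d + k, ix h * d + l) * cnj (V h $$ (b, l)))"
    by (rule controlled_encoder_index[OF _ lt(1,2)]) (rule V)
  also have "\<dots> = (\<Sum>h\<in>carrier G. \<Sum>k<d. \<Sum>l<d. if ix h = ix g then (V h $$ (a, k) * cnj (V h $$ (b, l))) * mat_unit d k l $$ (s, t) else 0)"
    using g lt by (intro sum.cong[OF refl]) (auto simp: tensor_index_less ix_less tensor_index_eq)
  also have "\<dots> = (\<Sum>h\<in>carrier G. if ix h = ix g then (\<Sum>k<d. \<Sum>l<d. (V h $$ (a, k) * cnj (V h $$ (b, l))) * mat_unit d k l $$ (s, t)) else 0)"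
    by (intro sum.cong[OF refl]) auto
  also have "\<dots> = V g $$ (a, s) * cnj (V g $$ (b, t))"
    unfolding sum_carrier_delta[OF g] by (rule sum_mat_unit[OF lt(3,4)])
  finally show ?thesis .
qed

text \<open>On classical inputs the encoders conjugate \<sigma> by the single operator V g \<otimes>
  W h. The right-hand side is laid out as a Kraus form for \<open>quad_form_kraus\<close>.\<close>

lemma ideal_encoding_index:
  assumes V: "\<And>g. g \<in> carrier G \<Longrightarrow> unitary_mat d (V g)" and W: "\<And>g. g \<in> carrier G \<Longrightarrow> unitary_mat d (W g)"
    and g: "g \<in> carrier G" and h: "h \<in> carrier G" and pq: "p < d * d" "q < d * d"
  shows "tensor_map (d\<^sup>2 * d) d (d\<^sup>2 * d) d (controlled_encoder G d ix V) (controlled_encoder G d ix W)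
      (sender_input d (ix g) (ix h) \<sigma>) $$ (p, q) =
    (\<Sum>r<d * d. \<Sum>s<d * d. (V g $$ (p div d, r div d) * W h $$ (p mod d, r mod d)) * \<sigma> $$ (r, s)
        * cnj (V g $$ (q div d, s div d) * W h $$ (q mod d, s mod d)))"
proof -
  let ?D = "d\<^sup>2 * d"
  let ?E = "controlled_encoder G d ix V" and ?F = "controlled_encoder G d ix W"
  have Vc: "V g \<in> carrier_mat d d" "W g \<in> carrier_mat d d" if "g \<in> carrier G" for g
    using V[OF that] W[OF that] by (auto simp: unitary_mat_def)
  note mpE = quantum_channel_map[OF controlled_encoder_channel, OF V]
  note mpF = quantum_channel_map[OF controlled_encoder_channel, OF W]
  obtain a b a' b' where p: "a < d" "b < d" "p = a * d + b" and q: "a' < d" "b' < d" "q = a' * d + b'"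
    using pq by (elim tensor_index_cases)
  define H where "H i j k l = \<sigma> $$ (i mod d * d + k mod d, j mod d * d + l mod d)
      * (?E (mat_unit ?D i j) $$ (a, a') * ?F (mat_unit ?D k l) $$ (b, b'))" for i j k l
  have H: "H (ix g * d + s) (ix g * d + s') (ix h * d + t) (ix h * d + t') = \<sigma> $$ (s * d + t, s' * d + t')
      * ((V g $$ (a, s) * cnj (V g $$ (a', s'))) * (W h $$ (b, t) * cnj (W h $$ (b', t'))))"
    if "s < d" "s' < d" "t < d" "t' < d" for s s' t t'
    using p q that
    by (simp add: H_def controlled_encoder_unit[OF Vc(1) g] controlled_encoder_unit[OF Vc(2) h] tensor_index_mod)
  have "tensor_map ?D d ?D d ?E ?F (sender_input d (ix g) (ix h) \<sigma>) $$ (p, q) =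
    (\<Sum>i<?D. \<Sum>j<?D. \<Sum>k<?D. \<Sum>l<?D. sender_input d (ix g) (ix h) \<sigma> $$ (i * ?D + k, j * ?D + l) *
       (?E (mat_unit ?D i j) $$ (a, a') * ?F (mat_unit ?D k l) $$ (b, b')))"
    unfolding p(3) q(3) by (rule tensor_map_index[OF mpE mpF p(1) q(1) p(2) q(2)])
  also have "\<dots> = (\<Sum>i<?D. \<Sum>j<?D. \<Sum>k<?D. \<Sum>l<?D.
      if i div d = ix g then if j div d = ix g then if k div d = ix h then if l div d = ix h then H i j k l else 0 else 0 else 0 else 0)"
    by (intro sum.cong[OF refl]) (simp add: sender_input_index H_def)
  \<comment> \<open>Each condition concerns one index only; pulled outward, it confines the
    corresponding sum to a block of size d.\<close>
  also have "\<dots> = (\<Sum>i<?D. if i div d = ix g then (\<Sum>j<?D. if j div d = ix g then (\<Sum>k<?D. if k div d = ix h then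
      (\<Sum>l<?D. if l div d = ix h then H i j k l else 0) else 0) else 0) else 0)"
  proof -
    have pull: "(\<Sum>x<n. if c then f x else 0) = (if c then (\<Sum>x<n. f x) else 0)" for c n and f :: "nat \<Rightarrow> complex"
      by simp
    show ?thesis unfolding pull ..
  qed
  also have "\<dots> = (\<Sum>s<d. \<Sum>s'<d. \<Sum>t<d. \<Sum>t'<d. H (ix g * d + s) (ix g * d + s') (ix h * d + t) (ix h * d + t'))"
    unfolding sum_tensor_block[OF ix_less[OF g]] sum_tensor_block[OF ix_less[OF h]] ..
  also have "\<dots> = (\<Sum>s<d. \<Sum>t<d. \<Sum>s'<d. \<Sum>t'<d. H (ix g * d + s) (ix g * d + s') (ix h * d + t) (ix h * d + t'))"
    by (rule sum.cong[OF refl], rule sum.swap)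
  also have "\<dots> = (\<Sum>s<d. \<Sum>t<d. \<Sum>s'<d. \<Sum>t'<d. (V g $$ (a, s) * W h $$ (b, t)) * \<sigma> $$ (s * d + t, s' * d + t')
        * cnj (V g $$ (a', s') * W h $$ (b', t')))"
    by (intro sum.cong[OF refl], subst H) (auto simp: mult_ac)
  also have "\<dots> = (\<Sum>r<d * d. \<Sum>s<d * d. (V g $$ (p div d, r div d) * W h $$ (p mod d, r mod d)) * \<sigma> $$ (r, s)
        * cnj (V g $$ (q div d, s div d) * W h $$ (q mod d, s mod d)))"
    unfolding sum_tensor_index p(3) q(3) tensor_index_div[OF p(2)] tensor_index_mod[OF p(2)] tensor_index_div[OF q(2)] tensor_index_mod[OF q(2)]
    by (intro sum.cong[OF refl]) (simp add: tensor_index_div tensor_index_mod)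
  finally show ?thesis .
qed

text \<open>The adjoint of \<open>U g\<close> \<otimes> \<open>U h\<close> transposed takes the code
  state of the product back to the maximally entangled vector up to a phase, which cancels in the
  quadratic form. The resource \<sigma> stays arbitrary because it is replaced last.\<close>

lemma ideal_run:
  assumes g: "g \<in> carrier G" and h: "h \<in> carrier G"
  shows "quad_form (d * d) (tensor_map (d\<^sup>2 * d) d (d\<^sup>2 * d) d (ideal_encoder1 G d ix U) (ideal_encoder2 G d ix U)
      (sender_input d (ix g) (ix h) \<sigma>)) (\<lambda>p. code_state d U (g \<otimes> h) $ p)
    = quad_form (d * d) \<sigma> (\<lambda>p. max_entangled d $ p)"
proof -
  obtain \<omega> where w: "cmod \<omega> = 1" "U g * U h = \<omega> \<cdot>\<^sub>m U (g \<otimes> h)"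
    using tnc g h unfolding tnc_representation_def by blast
  have gh: "g \<otimes> h \<in> carrier G" using g h by simp
  note Ug = U_carrier[OF g] and Uh = U_carrier[OF h] and Ugh = U_carrier[OF gh]
  define B where "B p r = U g $$ (p div d, r div d) * transpose_mat (U h) $$ (p mod d, r mod d)" for p r
  have ww: "cnj \<omega> * \<omega> = 1" using w(1) by (simp only: mult_cnj_cmod) simp
  have prod: "U (g \<otimes> h) $$ (a, b) = cnj \<omega> * (\<Sum>k<d. U g $$ (a, k) * U h $$ (k, b))" if "a < d" "b < d" for a b
  proof -
    have "(\<Sum>k<d. U g $$ (a, k) * U h $$ (k, b)) = (\<omega> \<cdot>\<^sub>m U (g \<otimes> h)) $$ (a, b)"
      unfolding w(2)[symmetric] by (rule mult_mat_index[OF Ug Uh that, symmetric])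
    also have "\<dots> = \<omega> * U (g \<otimes> h) $$ (a, b)" using Ugh that by simp
    finally show ?thesis using ww by (simp add: mult.assoc[symmetric])
  qed
  \<comment> \<open>Reshaped to a d by d matrix, the left-hand side is (U g)\<dagger> U(g h) (U
    h)\<dagger> divided by sqrt d, which is \<open>cnj \<omega>\<close> / sqrt d times the
    identity.\<close>
  have B: "(\<Sum>p<d * d. cnj (B p r) * code_state d U (g \<otimes> h) $ p) = cnj \<omega> * max_entangled d $ r" if r: "r < d * d" for r
  proof -
    obtain s t where st: "s < d" "t < d" "r = s * d + t" using r by (elim tensor_index_cases)
    let ?c = "cnj \<omega> / of_real (sqrt (real d))"
    have "(\<Sum>p<d * d. cnj (B p r) * code_state d U (g \<otimes> h) $ p)
      = (\<Sum>a<d. \<Sum>b<d. \<Sum>k<d. ?c * ((cnj (U g $$ (a, s)) * U g $$ (a, k)) * (U h $$ (k, b) * cnj (U h $$ (t, b)))))"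
      unfolding sum_tensor_index st(3) B_def
      using st Uh by (intro sum.cong[OF refl])
        (simp add: tensor_index_div tensor_index_mod code_state_index[OF gh] prod sum_distrib_left sum_divide_distrib mult_ac)
    also have "\<dots> = (\<Sum>k<d. \<Sum>a<d. \<Sum>b<d. ?c * ((cnj (U g $$ (a, s)) * U g $$ (a, k)) * (U h $$ (k, b) * cnj (U h $$ (t, b)))))"
      by (rule sum_swap_last)
    also have "\<dots> = (\<Sum>k<d. ?c * ((\<Sum>a<d. cnj (U g $$ (a, s)) * U g $$ (a, k)) * (\<Sum>b<d. U h $$ (k, b) * cnj (U h $$ (t, b)))))"
      unfolding sum_product by (simp only: sum_distrib_left)
    also have "\<dots> = (\<Sum>k<d. if k = s then if s = t then ?c else 0 else 0)"
      using st by (intro sum.cong[OF refl])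
        (auto simp: unitary_mat_columns[OF U_unitary[OF g]] unitary_mat_rows[OF U_unitary[OF h]])
    also have "\<dots> = cnj \<omega> * max_entangled d $ r" using st by (simp add: max_entangled_index)
    finally show ?thesis .
  qed
  have "quad_form (d * d) (tensor_map (d\<^sup>2 * d) d (d\<^sup>2 * d) d (ideal_encoder1 G d ix U) (ideal_encoder2 G d ix U)
      (sender_input d (ix g) (ix h) \<sigma>)) (\<lambda>p. code_state d U (g \<otimes> h) $ p)
    = (\<Sum>x\<in>{()}. quad_form (d * d) \<sigma> (\<lambda>r. \<Sum>p<d * d. cnj (B p r) * code_state d U (g \<otimes> h) $ p))"
  proof (rule quad_form_kraus)
    fix p q assume pq: "p < d * d" "q < d * d"
    show "tensor_map (d\<^sup>2 * d) d (d\<^sup>2 * d) d (ideal_encoder1 G d ix U) (ideal_encoder2 G d ix U)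
      (sender_input d (ix g) (ix h) \<sigma>) $$ (p, q) = (\<Sum>x\<in>{()}. \<Sum>k<d * d. \<Sum>l<d * d. B p k * \<sigma> $$ (k, l) * cnj (B q l))"
      unfolding ideal_encoder1_def ideal_encoder2_def B_def
      by (subst ideal_encoding_index[OF _ _ g h pq]) (auto intro: U_unitary transpose_unitary)
  qed
  also have "\<dots> = quad_form (d * d) \<sigma> (\<lambda>r. cnj \<omega> * max_entangled d $ r)"
    using quad_form_cong[OF B] by simp
  also have "\<dots> = quad_form (d * d) \<sigma> (\<lambda>p. max_entangled d $ p)"
    unfolding quad_form_scale using w(1) by simp
  finally show ?thesis .
qed

end

section \<open>The noisy protocol\<close>

text \<open>With a trivial reference system, \<open>tensor_map\<close> is the expansion of E in
  matrix units, which linearity sums up again.\<close>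

lemma tensor_map_one:
  assumes E: "operator_linear m n E" and K: "K \<in> carrier_mat m m"
  shows "tensor_map 1 1 m n (\<lambda>K. K) E K = E K"
proof (rule eq_mat_tensorI[of _ 1 n])
  fix i j k l :: nat assume "i < 1" "j < 1" and kl: "k < n" "l < n"
  then show "tensor_map 1 1 m n (\<lambda>K. K) E K $$ (i * n + k, j * n + l) = E K $$ (i * n + k, j * n + l)"
    using tensor_map_id_left_index[OF operator_linear_map[OF E], of 0 1 0 k l K] operator_linear_expand[OF E K kl] by simp
qed (use operator_mapD[OF operator_linear_map[OF E] K] in auto)

lemma tensor_map_id_id:
  assumes "K \<in> carrier_mat (m * n) (m * n)"
  shows "tensor_map m m n n (\<lambda>K. K) (\<lambda>K. K) K = K"
proof (rule eq_mat_tensorI[of _ m n])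
  fix i j k l assume ij: "i < m" "j < m" and kl: "k < n" "l < n"
  show "tensor_map m m n n (\<lambda>K. K) (\<lambda>K. K) K $$ (i * n + k, j * n + l) = K $$ (i * n + k, j * n + l)"
    unfolding tensor_map_id_left_index[OF operator_map_id ij kl] by (rule sum_mat_unit[OF kl])
qed (use assms in auto)

text \<open>For a channel acting on the whole state the reference system is trivial. The test vector
  is the basis vector of the outcome z, which turns the quadratic form into a diagonal
  entry.\<close>

lemma channel_replace_plain:
  assumes E: "quantum_channel m n E" and F: "quantum_channel m n F" and \<rho>: "density_mat m \<rho>" and z: "z < n"
  shows "Re (F \<rho> $$ (z, z)) - 1/2 * diamond_norm m n (\<lambda>K. E K - F K) \<le> Re (E \<rho> $$ (z, z))"
proof -
  have "(\<Sum>i<1 * n. (cmod (if i = z then 1 else 0))\<^sup>2) = (\<Sum>i<n. if i = z then 1 else 0)"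
    unfolding mult_1 by (intro sum.cong[OF refl]) auto
  then have w: "(\<Sum>i<1 * n. (cmod (if i = z then 1 else 0))\<^sup>2) = 1" using z by simp
  have \<rho>': "density_mat (1 * m) \<rho>" using \<rho> by simp
  show ?thesis
    using channel_replace_right[OF E F \<rho>' w]
    unfolding tensor_map_one[OF quantum_channel_linear[OF E] density_matD(1)[OF \<rho>]]
      tensor_map_one[OF quantum_channel_linear[OF F] density_matD(1)[OF \<rho>]] mult_1 quad_form_unit[OF z] .
qed

lemma ideal_transmission_eq: "ideal_transmission = (\<lambda>K. K)"
  by (rule ext) (simp add: ideal_transmission_def)

lemma ideal_transmission_channel: "quantum_channel d d ideal_transmission"
  unfolding quantum_channel_def ideal_transmission_eq
  by (auto simp: psd_mat_def tensor_map_id_id)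

section \<open>The maximally entangled state\<close>

lemma max_entangled_norm:
  assumes "0 < d" shows "(\<Sum>p<d * d. (cmod (max_entangled d $ p))\<^sup>2) = 1"
proof -
  have "(\<Sum>p<d * d. (cmod (max_entangled d $ p))\<^sup>2) = (\<Sum>i<d. \<Sum>j<d. if j = i then 1 / real d else 0)"
    unfolding sum_tensor_index using assms
    by (intro sum.cong[OF refl])
      (auto simp: max_entangled_def tensor_index_less tensor_index_div tensor_index_mod norm_divide power_divide)
  also have "\<dots> = (\<Sum>i<d. 1 / real d)" by (intro sum.cong[OF refl]) auto
  finally show ?thesis using assms by simp
qed

lemma quad_form_ketbra:
  assumes "v \<in> carrier_vec n"
  shows "quad_form n (ketbra v v) w = of_real ((cmod (\<Sum>i<n. cnj (v $ i) * w i))\<^sup>2)"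
proof -
  have "quad_form n (ketbra v v) w = (\<Sum>i<n. \<Sum>j<n. (v $ i * cnj (w i)) * (cnj (v $ j) * w j))"
    unfolding quad_form_def using assms by (intro sum.cong[OF refl]) (auto simp: ketbra_def mult_ac)
  also have "\<dots> = cnj (\<Sum>i<n. cnj (v $ i) * w i) * (\<Sum>i<n. cnj (v $ i) * w i)"
    unfolding sum_product[symmetric] by simp
  finally show ?thesis unfolding mult_cnj_cmod .
qed

lemma max_entangled_carrier: "max_entangled d \<in> carrier_vec (d * d)"
  by (simp add: max_entangled_def)

lemma max_entangled_inner:
  assumes "0 < d" shows "(\<Sum>p<d * d. cnj (max_entangled d $ p) * max_entangled d $ p) = 1"
  unfolding mult_cnj_cmod using max_entangled_norm[OF assms] by (simp only: of_real_sum[symmetric]) simp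

lemma ideal_state_density:
  assumes "0 < d" shows "density_mat (d * d) (ideal_state d)"
proof -
  have c: "ideal_state d \<in> carrier_mat (d * d) (d * d)"
    using max_entangled_carrier[of d] by (auto simp: ideal_state_def ketbra_def)
  have "mat_adjoint (ideal_state d) = ideal_state d"
    by (rule mat_adjoint_eqI[OF c]) (simp add: ideal_state_def ketbra_def max_entangled_def mult.commute)
  moreover have "0 \<le> quad_form (d * d) (ideal_state d) v" for v
    unfolding ideal_state_def quad_form_ketbra[OF max_entangled_carrier] by (simp add: less_eq_complex_def)
  moreover have "mat_trace (ideal_state d) = (\<Sum>p<d * d. cnj (max_entangled d $ p) * max_entangled d $ p)"
    unfolding mat_trace_eq[OF c] using max_entangled_carrier[of d]
    by (intro sum.cong[OF refl]) (simp add: ideal_state_def ketbra_def mult.commute)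
  ultimately show ?thesis using c max_entangled_inner[OF assms] by (simp add: density_mat_def psd_mat_iff)
qed

section \<open>Kronecker products and relabelling of basis vectors\<close>

lemma kron_carrier: "A \<in> carrier_mat m m' \<Longrightarrow> B \<in> carrier_mat n n' \<Longrightarrow> kron A B \<in> carrier_mat (m * n) (m' * n')"
  by (auto simp: kron_def)

lemma kron_index:
  assumes A: "A \<in> carrier_mat m m'" and B: "B \<in> carrier_mat n n'"
    and "i < m" "j < m'" "k < n" "l < n'"
  shows "kron A B $$ (i * n + k, j * n' + l) = A $$ (i, j) * B $$ (k, l)"
  using carrier_matD[OF A] carrier_matD[OF B] assms(3-)
  by (simp add: kron_def tensor_index_less tensor_index_div tensor_index_mod)

lemma kron_mat_unit:
  assumes "i < m" "j < m" "k < n" "l < n"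
  shows "kron (mat_unit m i j) (mat_unit n k l) = mat_unit (m * n) (i * n + k) (j * n + l)"
proof (rule eq_mat_tensorI[of _ m n])
  fix a b a' b' assume ab: "a < m" "a' < m" "b < n" "b' < n"
  show "kron (mat_unit m i j) (mat_unit n k l) $$ (a * n + b, a' * n + b') = mat_unit (m * n) (i * n + k) (j * n + l) $$ (a * n + b, a' * n + b')"
    unfolding kron_index[OF mat_unit_carrier mat_unit_carrier ab]
    using assms ab by (simp add: tensor_index_less tensor_index_eq)
qed (use kron_carrier[OF mat_unit_carrier mat_unit_carrier] in auto)

lemma mat_trace_mat_unit_mult:
  assumes "A \<in> carrier_mat n n" "c < n"
  shows "mat_trace (mat_unit n c c * A) = A $$ (c, c)"
proof -
  have "mat_trace (mat_unit n c c * A) = (\<Sum>p<n. \<Sum>q<n. mat_unit n c c $$ (p, q) * A $$ (q, p))"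
    unfolding mat_trace_eq[OF mult_carrier_mat[OF mat_unit_carrier assms(1)]]
    by (intro sum.cong[OF refl] mult_mat_index[OF mat_unit_carrier assms(1)]) auto
  also have "\<dots> = (\<Sum>p<n. \<Sum>q<n. A $$ (q, p) * mat_unit n p q $$ (c, c))"
    using assms by (intro sum.cong[OF refl]) auto
  also have "\<dots> = A $$ (c, c)" by (rule sum_mat_unit[OF assms(2,2)])
  finally show ?thesis .
qed

text \<open>Row r of W has its only 1 in column f r, so conjugation by W just relabels
  indices.\<close>

lemma conj_reindex:
  fixes W M :: "complex mat"
  assumes W: "W \<in> carrier_mat N N'" and M: "M \<in> carrier_mat N' N'"
    and ent: "\<And>r q. r < N \<Longrightarrow> q < N' \<Longrightarrow> W $$ (r, q) = (if q = f r then 1 else 0)"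
    and f: "f r < N'" "f s < N'" and rs: "r < N" "s < N"
  shows "(W * M * mat_adjoint W) $$ (r, s) = M $$ (f r, f s)"
proof -
  have WM: "(W * M) $$ (r, q) = M $$ (f r, q)" if "q < N'" for q
  proof -
    have "(W * M) $$ (r, q) = (\<Sum>k<N'. if k = f r then M $$ (f r, q) else 0)"
      unfolding mult_mat_index[OF W M rs(1) that] by (intro sum.cong[OF refl]) (auto simp: ent rs)
    then show ?thesis using f by simp
  qed
  have "(W * M * mat_adjoint W) $$ (r, s) = (\<Sum>q<N'. (W * M) $$ (r, q) * mat_adjoint W $$ (q, s))"
    by (rule mult_mat_index[OF mult_carrier_mat[OF W M] mat_adjoint_carrier[OF W] rs])
  also have "\<dots> = (\<Sum>q<N'. if q = f s then M $$ (f r, f s) else 0)"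
    by (intro sum.cong[OF refl]) (simp add: WM ent rs carrier_matD[OF W])
  finally show ?thesis using f by simp
qed

section \<open>The joint input and the success probability\<close>

context tnc
begin

text \<open>Both indices share z because the success event only reads diagonal blocks of Z. The
  bracketing ((z, x), y) fits the identity on ZX in \<open>joint_input\<close>.\<close>

lemma input_state_index:
  assumes "z < d\<^sup>2" "x < d\<^sup>2" "y < d\<^sup>2" "x' < d\<^sup>2" "y' < d\<^sup>2"
  shows "input_state G d ix $$ ((z * d\<^sup>2 + x) * d\<^sup>2 + y, (z * d\<^sup>2 + x') * d\<^sup>2 + y') =
    1 / (of_nat (d\<^sup>2))\<^sup>2 * (\<Sum>(g, h)\<in>carrier G \<times> carrier G.
      if ix (g \<otimes> h) = z \<and> ix g = x \<and> ix h = y \<and> ix g = x' \<and> ix h = y' then 1 else 0)"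
proof -
  let ?N = "d\<^sup>2 * d\<^sup>2 * d\<^sup>2"
  let ?f = "\<lambda>(g, h). kron (classical d ix (g \<otimes> h)) (kron (classical d ix g) (classical d ix h))"
  let ?r = "(z * d\<^sup>2 + x) * d\<^sup>2 + y" and ?s = "(z * d\<^sup>2 + x') * d\<^sup>2 + y'"
  have lt: "?r < ?N" "?s < ?N" by (intro tensor_index_less assms)+
  \<comment> \<open>The same numbers bracketed as (z, (x, y)), to match the nesting of
    \<open>kron\<close> in \<open>input_state\<close>.\<close>
  have e: "?r = z * (d\<^sup>2 * d\<^sup>2) + (x * d\<^sup>2 + y)" "?s = z * (d\<^sup>2 * d\<^sup>2) + (x' * d\<^sup>2 + y')"
    by (simp_all add: algebra_simps)
  have "?f (g, h) $$ (?r, ?s) = (if ix (g \<otimes> h) = z \<and> ix g = x \<and> ix h = y \<and> ix g = x' \<and> ix h = y' then 1 else 0)"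
    if "g \<in> carrier G" "h \<in> carrier G" for g h
  proof -
    have l: "ix g < d\<^sup>2" "ix h < d\<^sup>2" "ix (g \<otimes> h) < d\<^sup>2" using that by (auto intro!: ix_less)
    have l2: "x * d\<^sup>2 + y < d\<^sup>2 * d\<^sup>2" "x' * d\<^sup>2 + y' < d\<^sup>2 * d\<^sup>2" "ix g * d\<^sup>2 + ix h < d\<^sup>2 * d\<^sup>2"
      by (intro tensor_index_less assms l)+
    have "?f (g, h) $$ (?r, ?s) = mat_unit (d\<^sup>2) (ix (g \<otimes> h)) (ix (g \<otimes> h)) $$ (z, z)
      * mat_unit (d\<^sup>2 * d\<^sup>2) (ix g * d\<^sup>2 + ix h) (ix g * d\<^sup>2 + ix h) $$ (x * d\<^sup>2 + y, x' * d\<^sup>2 + y')"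
      unfolding e classical_def prod.case kron_mat_unit[OF l(1,1,2,2)]
      by (rule kron_index[OF mat_unit_carrier mat_unit_carrier assms(1,1) l2(1,2)])
    then show ?thesis
      unfolding mat_unit_index[OF assms(1,1) l(3,3)] mat_unit_index[OF l2(1,2,3,3)]
        tensor_index_eq[OF assms(3) l(2)] tensor_index_eq[OF assms(5) l(2)] by auto
  qed
  then have "mat_sum ?N ?N ?f (carrier G \<times> carrier G) $$ (?r, ?s) = (\<Sum>(g, h)\<in>carrier G \<times> carrier G.
      if ix (g \<otimes> h) = z \<and> ix g = x \<and> ix h = y \<and> ix g = x' \<and> ix h = y' then 1 else 0)"
    using lt by (auto simp: mat_sum_def intro!: sum.cong)
  moreover have "mat_sum ?N ?N ?f (carrier G \<times> carrier G) \<in> carrier_mat ?N ?N" by (simp add: mat_sum_def)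
  ultimately show ?thesis using lt unfolding input_state_def order_eq by simp
qed

text \<open>The rearrangement W permutes basis vectors, so each entry is one of the unpermuted
  product state at relabelled indices. There the classical registers leave just the pairs (g, h)
  whose product has index z.\<close>

lemma joint_input_index:
  assumes \<sigma>: "\<sigma> \<in> carrier_mat (d * d) (d * d)" and z: "z < d\<^sup>2"
    and kl: "k < (d\<^sup>2 * d) * (d\<^sup>2 * d)" "l < (d\<^sup>2 * d) * (d\<^sup>2 * d)"
  shows "joint_input G d ix \<sigma> $$ (z * ((d\<^sup>2 * d) * (d\<^sup>2 * d)) + k, z * ((d\<^sup>2 * d) * (d\<^sup>2 * d)) + l) =
    1 / (of_nat (d\<^sup>2))\<^sup>2 * (\<Sum>(g, h)\<in>carrier G \<times> carrier G.
      if ix (g \<otimes> h) = z then sender_input d (ix g) (ix h) \<sigma> $$ (k, l) else 0)"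
proof -
  let ?D = "d\<^sup>2 * d"
  define W where "W = kron (1\<^sub>m (d\<^sup>2 * d\<^sup>2)) (kron (swap_mat (d\<^sup>2) d) (1\<^sub>m d))"
  define N where "N = d\<^sup>2 * d\<^sup>2 * (d * d\<^sup>2 * d)"
  \<comment> \<open>This takes an index of ZXAYB to the matching one of ZXYAB: with c for the pair
    ZX, (c, a, y, b) goes to (c, y, a, b).\<close>
  define f where "f r = (r div (d * d\<^sup>2 * d) * d\<^sup>2 + r mod (d * d\<^sup>2 * d) div d mod d\<^sup>2) * (d * d)
    + (r mod (d * d\<^sup>2 * d) div d div d\<^sup>2 * d + r mod (d * d\<^sup>2 * d) mod d)" for r
  have f: "f (c * (d * d\<^sup>2 * d) + ((a * d\<^sup>2 + y) * d + b)) = (c * d\<^sup>2 + y) * (d * d) + (a * d + b)"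
    if "a < d" "y < d\<^sup>2" "b < d" for c a y b
  proof -
    have "(a * d\<^sup>2 + y) * d + b < d * d\<^sup>2 * d" using that by (intro tensor_index_less)
    then show ?thesis unfolding f_def
      using that by (simp only: tensor_index_div tensor_index_mod)
  qed
  have sw: "swap_mat (d\<^sup>2) d \<in> carrier_mat (d * d\<^sup>2) (d\<^sup>2 * d)" by (simp add: swap_mat_def)
  have sw1: "kron (swap_mat (d\<^sup>2) d) (1\<^sub>m d) \<in> carrier_mat (d * d\<^sup>2 * d) (d\<^sup>2 * d * d)"
    by (rule kron_carrier[OF sw one_carrier_mat])
  \<comment> \<open>The row and column dimensions of W are products of the same factors in different
    orders.\<close>
  have NN: "d\<^sup>2 * d\<^sup>2 * (d\<^sup>2 * d * d) = N" by (simp add: N_def mult_ac)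
  have W: "W \<in> carrier_mat N N"
    using kron_carrier[OF one_carrier_mat[of "d\<^sup>2 * d\<^sup>2"] sw1] unfolding W_def NN N_def[symmetric] .
  have NM: "(d\<^sup>2 * d\<^sup>2 * d\<^sup>2) * (d * d) = N" by (simp add: N_def mult_ac)
  have inp: "input_state G d ix \<in> carrier_mat (d\<^sup>2 * d\<^sup>2 * d\<^sup>2) (d\<^sup>2 * d\<^sup>2 * d\<^sup>2)"
    by (simp add: input_state_def mat_sum_def)
  have M: "kron (input_state G d ix) \<sigma> \<in> carrier_mat N N"
    using kron_carrier[OF inp \<sigma>] unfolding NM .
  have Went: "W $$ (r, q) = (if q = f r then 1 else 0)" if rq: "r < N" "q < N" for r q
  proof -
    obtain c u where r1: "c < d\<^sup>2 * d\<^sup>2" "u < d * d\<^sup>2 * d" "r = c * (d * d\<^sup>2 * d) + u"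
      using rq(1) unfolding N_def by (rule tensor_index_cases)
    obtain v b where r2: "v < d * d\<^sup>2" "b < d" "u = v * d + b" using r1(2) by (rule tensor_index_cases)
    obtain a y where r3: "a < d" "y < d\<^sup>2" "v = a * d\<^sup>2 + y" using r2(1) by (rule tensor_index_cases)
    obtain c' u' where q1: "c' < d\<^sup>2 * d\<^sup>2" "u' < d\<^sup>2 * d * d" "q = c' * (d\<^sup>2 * d * d) + u'"
      using rq(2) unfolding NN[symmetric] by (rule tensor_index_cases)
    obtain v' b' where q2: "v' < d\<^sup>2 * d" "b' < d" "u' = v' * d + b'" using q1(2) by (rule tensor_index_cases)
    obtain y' a' where q3: "y' < d\<^sup>2" "a' < d" "v' = y' * d + a'" using q2(1) by (rule tensor_index_cases)
    have "W $$ (r, q) = 1\<^sub>m (d\<^sup>2 * d\<^sup>2) $$ (c, c') * (swap_mat (d\<^sup>2) d $$ (v, v') * 1\<^sub>m d $$ (b, b'))"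
      unfolding W_def r1(3) q1(3) kron_index[OF one_carrier_mat sw1 r1(1) q1(1) r1(2) q1(2)]
      unfolding r2(3) q2(3) kron_index[OF sw one_carrier_mat r2(1) q2(1) r2(2) q2(2)] ..
    also have "swap_mat (d\<^sup>2) d $$ (v, v') = (if a = a' \<and> y = y' then 1 else 0)"
      using r2(1) q2(1) unfolding r3(3) q3(3) swap_mat_def
      by (simp add: tensor_index_div[OF r3(2)] tensor_index_mod[OF r3(2)] tensor_index_div[OF q3(2)] tensor_index_mod[OF q3(2)]
          mod_less[OF r3(2)] mod_less[OF q3(2)])
    also have "1\<^sub>m (d\<^sup>2 * d\<^sup>2) $$ (c, c') * ((if a = a' \<and> y = y' then 1 else 0) * 1\<^sub>m d $$ (b, b'))
      = (if c' = c \<and> y' = y \<and> a' = a \<and> b' = b then 1 else 0 :: complex)"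
      using r1(1) q1(1) r2(2) q2(2) by auto
    also have "c' = c \<and> y' = y \<and> a' = a \<and> b' = b \<longleftrightarrow> q = f r"
    proof -
      have "f r = (c * d\<^sup>2 + y) * (d * d) + (a * d + b)" unfolding r1(3) r2(3) r3(3) by (rule f[OF r3(1,2) r2(2)])
      moreover have "q = (c' * d\<^sup>2 + y') * (d * d) + (a' * d + b')"
        unfolding q1(3) q2(3) q3(3) by (simp add: algebra_simps)
      moreover have "a * d + b < d * d" "a' * d + b' < d * d" using r3 r2 q3 q2 by (auto intro!: tensor_index_less)
      ultimately show ?thesis using r3 q3 r2 q2 by (auto simp: tensor_index_eq)
    qed
    finally show ?thesis .
  qed
  obtain i k' where k1: "i < ?D" "k' < ?D" "k = i * ?D + k'" using kl(1) by (rule tensor_index_cases)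
  obtain j l' where l1: "j < ?D" "l' < ?D" "l = j * ?D + l'" using kl(2) by (rule tensor_index_cases)
  obtain x a where k2: "x < d\<^sup>2" "a < d" "i = x * d + a" using k1(1) by (rule tensor_index_cases)
  obtain y b where k3: "y < d\<^sup>2" "b < d" "k' = y * d + b" using k1(2) by (rule tensor_index_cases)
  obtain x' a' where l2: "x' < d\<^sup>2" "a' < d" "j = x' * d + a'" using l1(1) by (rule tensor_index_cases)
  obtain y' b' where l3: "y' < d\<^sup>2" "b' < d" "l' = y' * d + b'" using l1(2) by (rule tensor_index_cases)
  let ?r = "z * (?D * ?D) + k" and ?s = "z * (?D * ?D) + l"
  \<comment> \<open>The protocol's index (z, ((x, a), (y, b))) is the same number as ((z, x), ((a,
    y), b)), the bracketing of the rows of W.\<close>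
  have re: "?r = (z * d\<^sup>2 + x) * (d * d\<^sup>2 * d) + ((a * d\<^sup>2 + y) * d + b)"
    unfolding k1(3) k2(3) k3(3) by (simp add: algebra_simps power2_eq_square)
  have se: "?s = (z * d\<^sup>2 + x') * (d * d\<^sup>2 * d) + ((a' * d\<^sup>2 + y') * d + b')"
    unfolding l1(3) l2(3) l3(3) by (simp add: algebra_simps power2_eq_square)
  have "?r < d\<^sup>2 * (?D * ?D)" "?s < d\<^sup>2 * (?D * ?D)" using tensor_index_less[OF z kl(1)] tensor_index_less[OF z kl(2)] .
  moreover have "d\<^sup>2 * (?D * ?D) = N" by (simp add: N_def mult_ac)
  ultimately have rs: "?r < N" "?s < N" by simp_all
  have fr: "f ?r = ((z * d\<^sup>2 + x) * d\<^sup>2 + y) * (d * d) + (a * d + b)"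
    unfolding re by (rule f[OF k2(2) k3(1,2)])
  have fs: "f ?s = ((z * d\<^sup>2 + x') * d\<^sup>2 + y') * (d * d) + (a' * d + b')"
    unfolding se by (rule f[OF l2(2) l3(1,2)])
  have lt: "(z * d\<^sup>2 + x) * d\<^sup>2 + y < d\<^sup>2 * d\<^sup>2 * d\<^sup>2" "(z * d\<^sup>2 + x') * d\<^sup>2 + y' < d\<^sup>2 * d\<^sup>2 * d\<^sup>2"
    "a * d + b < d * d" "a' * d + b' < d * d"
    by (intro tensor_index_less z k2 k3 l2 l3)+
  have flt: "f ?r < N" "f ?s < N"
    unfolding fr fs NM[symmetric] by (rule tensor_index_less[OF lt(1,3)], rule tensor_index_less[OF lt(2,4)])
  have "joint_input G d ix \<sigma> $$ (?r, ?s) = kron (input_state G d ix) \<sigma> $$ (f ?r, f ?s)"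
    unfolding joint_input_def Let_def W_def[symmetric]
    by (rule conj_reindex[OF W M _ flt rs]) (rule Went)
  also have "\<dots> = input_state G d ix $$ ((z * d\<^sup>2 + x) * d\<^sup>2 + y, (z * d\<^sup>2 + x') * d\<^sup>2 + y') * \<sigma> $$ (a * d + b, a' * d + b')"
    unfolding fr fs by (rule kron_index[OF inp \<sigma> lt])
  also have "\<dots> = 1 / (of_nat (d\<^sup>2))\<^sup>2 * (\<Sum>(g, h)\<in>carrier G \<times> carrier G.
      (if ix (g \<otimes> h) = z \<and> ix g = x \<and> ix h = y \<and> ix g = x' \<and> ix h = y' then 1 else 0) * \<sigma> $$ (a * d + b, a' * d + b'))"
    unfolding input_state_index[OF z k2(1) k3(1) l2(1) l3(1)] split_beta sum_distrib_right mult.assoc ..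
  also have "(\<Sum>(g, h)\<in>carrier G \<times> carrier G.
      (if ix (g \<otimes> h) = z \<and> ix g = x \<and> ix h = y \<and> ix g = x' \<and> ix h = y' then 1 else 0) * \<sigma> $$ (a * d + b, a' * d + b'))
    = (\<Sum>(g, h)\<in>carrier G \<times> carrier G. if ix (g \<otimes> h) = z then sender_input d (ix g) (ix h) \<sigma> $$ (k, l) else 0)"
    unfolding k1(3) l1(3) sender_input_index[OF k1(1,2) l1(1,2)]
    unfolding k2(3) k3(3) l2(3) l3(3) tensor_index_div[OF k2(2)] tensor_index_mod[OF k2(2)] tensor_index_div[OF k3(2)] tensor_index_mod[OF k3(2)]
      tensor_index_div[OF l2(2)] tensor_index_mod[OF l2(2)] tensor_index_div[OF l3(2)] tensor_index_mod[OF l3(2)]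
    by (intro sum.cong[OF refl]) auto
  finally show ?thesis .
qed

text \<open>A correct outcome z reads the diagonal entry (z, z) of the image of the block Z = z. F
  is linear, so it passes through the mixture, and the sum over z meets each pair (g, h) exactly
  once, at its product.\<close>

lemma success_prob_average:
  assumes \<sigma>: "\<sigma> \<in> carrier_mat (d * d) (d * d)"
    and F: "operator_linear ((d\<^sup>2 * d) * (d\<^sup>2 * d)) (d\<^sup>2) F"
  shows "success_prob G d ix (tensor_map (d\<^sup>2) (d\<^sup>2) ((d\<^sup>2 * d) * (d\<^sup>2 * d)) (d\<^sup>2) (\<lambda>K. K) F (joint_input G d ix \<sigma>))
    = (\<Sum>(g, h)\<in>carrier G \<times> carrier G. Re (F (sender_input d (ix g) (ix h) \<sigma>) $$ (ix (g \<otimes> h), ix (g \<otimes> h)))) / (real (d\<^sup>2))\<^sup>2"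
proof -
  let ?N = "(d\<^sup>2 * d) * (d\<^sup>2 * d)"
  let ?\<tau> = "tensor_map (d\<^sup>2) (d\<^sup>2) ?N (d\<^sup>2) (\<lambda>K. K) F (joint_input G d ix \<sigma>)"
  let ?P = "carrier G \<times> carrier G" and ?q = "1 / (of_nat (d\<^sup>2))\<^sup>2 :: complex"
  let ?S = "\<lambda>g h. sender_input d (ix g) (ix h) \<sigma>"
  have diag: "?\<tau> $$ (z * d\<^sup>2 + z, z * d\<^sup>2 + z) = ?q * (\<Sum>(g, h)\<in>?P. if ix (g \<otimes> h) = z then F (?S g h) $$ (z, z) else 0)"
    if z: "z < d\<^sup>2" for z
  proof -
    have "?\<tau> $$ (z * d\<^sup>2 + z, z * d\<^sup>2 + z)
      = (\<Sum>k<?N. \<Sum>l<?N. joint_input G d ix \<sigma> $$ (z * ?N + k, z * ?N + l) * F (mat_unit ?N k l) $$ (z, z))"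
      by (rule tensor_map_id_left_index[OF operator_linear_map[OF F] z z z z])
    also have "\<dots> = (\<Sum>k<?N. \<Sum>l<?N. \<Sum>(g, h)\<in>?P. ?q * (if ix (g \<otimes> h) = z then ?S g h $$ (k, l) * F (mat_unit ?N k l) $$ (z, z) else 0))"
    proof (intro sum.cong[OF refl])
      fix k l assume "k \<in> {..<?N}" "l \<in> {..<?N}"
      then have kl: "k < ?N" "l < ?N" by auto
      show "joint_input G d ix \<sigma> $$ (z * ?N + k, z * ?N + l) * F (mat_unit ?N k l) $$ (z, z)
        = (\<Sum>(g, h)\<in>?P. ?q * (if ix (g \<otimes> h) = z then ?S g h $$ (k, l) * F (mat_unit ?N k l) $$ (z, z) else 0))"
        unfolding joint_input_index[OF \<sigma> z kl] sum_distrib_left sum_distrib_right split_beta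
        by (intro sum.cong[OF refl]) auto
    qed
    also have "\<dots> = (\<Sum>(g, h)\<in>?P. \<Sum>k<?N. \<Sum>l<?N. ?q * (if ix (g \<otimes> h) = z then ?S g h $$ (k, l) * F (mat_unit ?N k l) $$ (z, z) else 0))"
      unfolding split_beta by (rule sum_swap_last)
    also have "\<dots> = (\<Sum>(g, h)\<in>?P. ?q * (if ix (g \<otimes> h) = z then F (?S g h) $$ (z, z) else 0))"
    proof (intro sum.cong[OF refl], unfold split_beta)
      fix gh
      let ?T = "?S (fst gh) (snd gh)"
      show "(\<Sum>k<?N. \<Sum>l<?N. ?q * (if ix (fst gh \<otimes> snd gh) = z then ?T $$ (k, l) * F (mat_unit ?N k l) $$ (z, z) else 0))
        = ?q * (if ix (fst gh \<otimes> snd gh) = z then F ?T $$ (z, z) else 0)"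
        unfolding operator_linear_expand[OF F sender_input_carrier z z] by (simp add: sum_divide_distrib)
    qed
    finally show ?thesis unfolding split_beta sum_distrib_left .
  qed
  have "success_prob G d ix ?\<tau> = (\<Sum>z\<in>carrier G. outcome_prob d ix ?\<tau> (z, z))"
  proof -
    have "{(z, z'). z \<in> carrier G \<and> z' \<in> carrier G \<and> z = z'} = (\<lambda>z. (z, z)) ` carrier G" by auto
    then show ?thesis unfolding success_prob_def by (simp add: sum.reindex inj_on_def)
  qed
  also have "\<dots> = (\<Sum>z\<in>carrier G. Re (?\<tau> $$ (ix z * d\<^sup>2 + ix z, ix z * d\<^sup>2 + ix z)))"
  proof (rule sum.cong[OF refl])
    fix z assume "z \<in> carrier G"
    note z = ix_less[OF this]
    show "outcome_prob d ix ?\<tau> (z, z) = Re (?\<tau> $$ (ix z * d\<^sup>2 + ix z, ix z * d\<^sup>2 + ix z))"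
      unfolding outcome_prob_def prod.case classical_def kron_mat_unit[OF z z z z]
        mat_trace_mat_unit_mult[OF tensor_map_carrier tensor_index_less[OF z z]] ..
  qed
  also have "\<dots> = Re (\<Sum>z\<in>carrier G. ?q * (\<Sum>(g, h)\<in>?P. if ix (g \<otimes> h) = ix z then F (?S g h) $$ (ix z, ix z) else 0))"
    unfolding Re_sum by (intro sum.cong[OF refl]) (simp only: diag ix_less)
  also have "(\<Sum>z\<in>carrier G. ?q * (\<Sum>(g, h)\<in>?P. if ix (g \<otimes> h) = ix z then F (?S g h) $$ (ix z, ix z) else 0))
    = ?q * (\<Sum>(g, h)\<in>?P. \<Sum>z\<in>carrier G. if ix (g \<otimes> h) = ix z then F (?S g h) $$ (ix z, ix z) else 0)"
    unfolding sum_distrib_left[symmetric] split_beta by (rule arg_cong[OF sum.swap])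
  also have "(\<Sum>(g, h)\<in>?P. \<Sum>z\<in>carrier G. if ix (g \<otimes> h) = ix z then F (?S g h) $$ (ix z, ix z) else 0)
    = (\<Sum>(g, h)\<in>?P. F (?S g h) $$ (ix (g \<otimes> h), ix (g \<otimes> h)))"
  proof (intro sum.cong[OF refl], clarify)
    fix g h assume "g \<in> carrier G" "h \<in> carrier G"
    then have "g \<otimes> h \<in> carrier G" by simp
    from sum_carrier_delta[OF this, of "\<lambda>z. F (?S g h) $$ (ix z, ix z)"]
    show "(\<Sum>z\<in>carrier G. if ix (g \<otimes> h) = ix z then F (?S g h) $$ (ix z, ix z) else 0) = F (?S g h) $$ (ix (g \<otimes> h), ix (g \<otimes> h))"
      by (simp only: eq_commute[of "ix (g \<otimes> h)"])
  qed
  also have "Re (?q * (\<Sum>(g, h)\<in>?P. F (?S g h) $$ (ix (g \<otimes> h), ix (g \<otimes> h))))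
    = (\<Sum>(g, h)\<in>?P. Re (F (?S g h) $$ (ix (g \<otimes> h), ix (g \<otimes> h)))) / (real (d\<^sup>2))\<^sup>2"
  proof -
    have "?q = of_real (1 / (real (d\<^sup>2))\<^sup>2)" by simp
    then show ?thesis unfolding split_beta by (simp only: Re_complex_of_real times_complex.sel Im_complex_of_real Re_sum) simp
  qed
  finally show ?thesis .
qed

text \<open>The real run is split into the one-sided channels E2, E1, T2, T1, in this order, and
  then the decoder, so that the component next in line for replacement is the last one to
  act.\<close>

lemma branch_bound:
  assumes \<sigma>: "density_mat (d * d) \<sigma>"
    and E1: "quantum_channel (d\<^sup>2 * d) d E1" and E2: "quantum_channel (d\<^sup>2 * d) d E2"
    and T1: "quantum_channel d d T1" and T2: "quantum_channel d d T2"
    and Dr: "quantum_channel (d * d) (d\<^sup>2) Dr"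
    and g: "g \<in> carrier G" and h: "h \<in> carrier G"
  shows "1 - (1/2 * trace_norm (\<sigma> - ideal_state d)
         + 1/2 * diamond_norm (d\<^sup>2 * d) d (\<lambda>K. E1 K - ideal_encoder1 G d ix U K)
         + 1/2 * diamond_norm (d\<^sup>2 * d) d (\<lambda>K. E2 K - ideal_encoder2 G d ix U K)
         + 1/2 * diamond_norm d d (\<lambda>K. T1 K - ideal_transmission K)
         + 1/2 * diamond_norm d d (\<lambda>K. T2 K - ideal_transmission K)
         + 1/2 * diamond_norm (d * d) (d\<^sup>2) (\<lambda>K. Dr K - ideal_decoder G d ix U K))
    \<le> Re (Dr (tensor_map d d d d T1 T2 (tensor_map (d\<^sup>2 * d) d (d\<^sup>2 * d) d E1 E2 (sender_input d (ix g) (ix h) \<sigma>)))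
          $$ (ix (g \<otimes> h), ix (g \<otimes> h)))"
proof -
  let ?D = "d\<^sup>2 * d" and ?z = "ix (g \<otimes> h)"
  let ?e1 = "ideal_encoder1 G d ix U" and ?e2 = "ideal_encoder2 G d ix U"
  have gh: "g \<otimes> h \<in> carrier G" using g h by simp
  define w where "w p = code_state d U (g \<otimes> h) $ p" for p
  have w: "(\<Sum>p<d * d. (cmod (w p))\<^sup>2) = 1" unfolding w_def by (rule code_state_norm[OF gh])
  let ?q = "\<lambda>\<rho>. Re (quad_form (d * d) \<rho> w)"
  note e1 = ideal_encoder1_channel and e2 = ideal_encoder2_channel and t = ideal_transmission_channel[of d]
  note mp = quantum_channel_map
  define P where "P = sender_input d (ix g) (ix h) \<sigma>"
  have P: "density_mat (?D * ?D) P" unfolding P_def by (rule sender_input_density[OF \<sigma> ix_less[OF g] ix_less[OF h]])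
  define R1 where "R1 = tensor_map ?D ?D ?D d (\<lambda>K. K) E2 P"
  have R1: "density_mat (?D * d) R1" unfolding R1_def by (rule channel_density[OF E2 P])
  define R2 where "R2 = tensor_map ?D d d d E1 (\<lambda>K. K) R1"
  have R2: "density_mat (d * d) R2" unfolding R2_def by (rule channel_density_left[OF E1 R1])
  define R3 where "R3 = tensor_map d d d d (\<lambda>K. K) T2 R2"
  have R3: "density_mat (d * d) R3" unfolding R3_def by (rule channel_density[OF T2 R2])
  define R4 where "R4 = tensor_map d d d d T1 (\<lambda>K. K) R3"
  have R4: "density_mat (d * d) R4" unfolding R4_def by (rule channel_density_left[OF T1 R3])
  define Q where "Q = tensor_map ?D d ?D ?D ?e1 (\<lambda>K. K) P"
  have Q: "density_mat (d * ?D) Q" unfolding Q_def by (rule channel_density_left[OF e1 P])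
  have run: "tensor_map d d d d T1 T2 (tensor_map ?D d ?D d E1 E2 P) = R4"
    unfolding R4_def R3_def R2_def R1_def tensor_map_left_right[OF mp[OF E1] mp[OF E2]] tensor_map_left_right[OF mp[OF T1] mp[OF T2]] ..
  have "Re (ideal_decoder G d ix U R4 $$ (?z, ?z)) - 1/2 * diamond_norm (d * d) (d\<^sup>2) (\<lambda>K. Dr K - ideal_decoder G d ix U K)
      \<le> Re (Dr R4 $$ (?z, ?z))"
    by (rule channel_replace_plain[OF Dr ideal_decoder_channel R4 ix_less[OF gh]])
  moreover have "Re (ideal_decoder G d ix U R4 $$ (?z, ?z)) = ?q R4"
    unfolding ideal_decoder_diag[OF density_matD(1)[OF R4] gh] w_def ..
  \<comment> \<open>The ideal transmission is the identity, so replacing T1 removes it and leaves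
    R3.\<close>
  moreover have "?q R3 - 1/2 * diamond_norm d d (\<lambda>K. T1 K - ideal_transmission K) \<le> ?q R4"
    using channel_replace_left[OF T1 t R3 w] unfolding R4_def
    by (simp only: ideal_transmission_eq tensor_map_id_id[OF density_matD(1)[OF R3]])
  moreover have "?q R2 - 1/2 * diamond_norm d d (\<lambda>K. T2 K - ideal_transmission K) \<le> ?q R3"
    using channel_replace_right[OF T2 t R2 w] unfolding R3_def
    by (simp only: ideal_transmission_eq tensor_map_id_id[OF density_matD(1)[OF R2]])
  moreover have "?q (tensor_map ?D d d d ?e1 (\<lambda>K. K) R1) - 1/2 * diamond_norm ?D d (\<lambda>K. E1 K - ?e1 K) \<le> ?q R2"
    unfolding R2_def by (rule channel_replace_left[OF E1 e1 R1 w])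
  \<comment> \<open>Both sides are the ideal first encoder and E2 applied to P; the exchange makes
    E2 the last channel.\<close>
  moreover have "?q (tensor_map ?D d d d ?e1 (\<lambda>K. K) R1) = ?q (tensor_map d d ?D d (\<lambda>K. K) E2 Q)"
    unfolding R1_def Q_def tensor_map_left_right[OF mp[OF e1] mp[OF E2]] tensor_map_right_left[OF mp[OF e1] mp[OF E2]] ..
  moreover have "?q (tensor_map d d ?D d (\<lambda>K. K) ?e2 Q) - 1/2 * diamond_norm ?D d (\<lambda>K. E2 K - ?e2 K)
      \<le> ?q (tensor_map d d ?D d (\<lambda>K. K) E2 Q)"
    by (rule channel_replace_right[OF E2 e2 Q w])
  moreover have "?q (tensor_map d d ?D d (\<lambda>K. K) ?e2 Q) = Re (quad_form (d * d) \<sigma> (\<lambda>p. max_entangled d $ p))"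
    unfolding Q_def tensor_map_right_left[OF mp[OF e1] mp[OF e2]] P_def w_def ideal_run[OF g h] ..
  \<comment> \<open>With all channels ideal, the resource is tested against the maximally entangled
    vector, on which the ideal state has value 1.\<close>
  moreover have "\<bar>Re (quad_form (d * d) \<sigma> (\<lambda>p. max_entangled d $ p)) - Re (quad_form (d * d) (ideal_state d) (\<lambda>p. max_entangled d $ p))\<bar>
      \<le> 1/2 * trace_norm (\<sigma> - ideal_state d)"
    by (rule density_quad_form_diff_le[OF \<sigma> ideal_state_density[OF d_pos] max_entangled_norm[OF d_pos]])
  moreover have "Re (quad_form (d * d) (ideal_state d) (\<lambda>p. max_entangled d $ p)) = 1"
    unfolding ideal_state_def quad_form_ketbra[OF max_entangled_carrier] max_entangled_inner[OF d_pos] by simp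
  ultimately show ?thesis unfolding P_def[symmetric] run by linarith
qed

end

theorem theorem11:
  fixes G :: "('g, 'b) monoid_scheme"
    and d :: nat
    and U :: "'g \<Rightarrow> complex mat"
    and ix :: "'g \<Rightarrow> nat"
    and \<sigma>r :: "complex mat"
    and E1r E2r T1r T2r Dr :: "complex mat \<Rightarrow> complex mat"
  assumes "tnc_representation G d U"
    and "bij_betw ix (carrier G) {..<d\<^sup>2}"
    and "density_mat (d * d) \<sigma>r"
    and "quantum_channel (d\<^sup>2 * d) d E1r"
    and "quantum_channel (d\<^sup>2 * d) d E2r"
    and "quantum_channel d d T1r"
    and "quantum_channel d d T2r"
    and "quantum_channel (d * d) (d\<^sup>2) Dr"
    and "classical_output (d * d) Dr"
  shows "success_prob G d ix (protocol_output G d ix \<sigma>r E1r E2r T1r T2r Dr)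
    \<ge> 1 - (1/2 * trace_norm (\<sigma>r - ideal_state d)
         + 1/2 * diamond_norm (d\<^sup>2 * d) d (\<lambda>K. E1r K - ideal_encoder1 G d ix U K)
         + 1/2 * diamond_norm (d\<^sup>2 * d) d (\<lambda>K. E2r K - ideal_encoder2 G d ix U K)
         + 1/2 * diamond_norm d d (\<lambda>K. T1r K - ideal_transmission K)
         + 1/2 * diamond_norm d d (\<lambda>K. T2r K - ideal_transmission K)
         + 1/2 * diamond_norm (d * d) (d\<^sup>2) (\<lambda>K. Dr K - ideal_decoder G d ix U K))"
    (is "?lhs \<ge> ?b")
proof -
  interpret tnc G d U ix by unfold_locales (rule assms(1,2))+
  note mp = quantum_channel_map
  let ?F = "Dr \<circ> tensor_map d d d d T1r T2r \<circ> tensor_map (d\<^sup>2 * d) d (d\<^sup>2 * d) d E1r E2r"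
  let ?P = "carrier G \<times> carrier G"
  let ?p = "\<lambda>(g, h). Re (?F (sender_input d (ix g) (ix h) \<sigma>r) $$ (ix (g \<otimes>\<^bsub>G\<^esub> h), ix (g \<otimes>\<^bsub>G\<^esub> h)))"
  have F: "operator_linear ((d\<^sup>2 * d) * (d\<^sup>2 * d)) (d\<^sup>2) ?F"
    by (rule operator_linear_comp[OF operator_linear_tensor_map[OF mp[OF assms(4)] mp[OF assms(5)]]
          operator_linear_comp[OF operator_linear_tensor_map[OF mp[OF assms(6)] mp[OF assms(7)]] quantum_channel_linear[OF assms(8)]]])
  have lhs: "?lhs = sum ?p ?P / (real (d\<^sup>2))\<^sup>2"
    unfolding protocol_output_def by (rule success_prob_average[OF density_matD(1)[OF assms(3)] F])
  \<comment> \<open>The bound is the same for every pair (g, h), so averaging over the d^4 pairs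
    leaves it unchanged.\<close>
  have "(\<Sum>gh\<in>?P. ?b) \<le> sum ?p ?P"
  proof (rule sum_mono, clarify)
    fix g h assume "g \<in> carrier G" "h \<in> carrier G"
    then show "?b \<le> Re (?F (sender_input d (ix g) (ix h) \<sigma>r) $$ (ix (g \<otimes>\<^bsub>G\<^esub> h), ix (g \<otimes>\<^bsub>G\<^esub> h)))"
      unfolding comp_def by (rule branch_bound[OF assms(3-8)])
  qed
  moreover have "card ?P = d\<^sup>2 * d\<^sup>2" using order_eq by (simp add: Coset.order_def card_cartesian_product)
  ultimately have "?b * (real (d\<^sup>2))\<^sup>2 \<le> sum ?p ?P"
    unfolding sum_constant by (simp only: of_nat_mult power2_eq_square[of "real (d\<^sup>2)"] mult.commute)
  moreover have "0 < (real (d\<^sup>2))\<^sup>2" using d_pos by simp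
  ultimately show ?thesis unfolding lhs by (simp only: pos_le_divide_eq)
qed

end
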